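(* Let $N\in\hat G$ and consider the set $\hat G_N$ of elements $f\in\hat G$ that are formally conjugated to $N$. For each $m$, the subset $\pi_m(\hat G_N)\subset\mathbb{C}^{d(m)}$ is an affine algebraic variety, of dimension denoted $d(N,m)$. Moreover, there is an onto polynomial map of degree less than or equal to $m$ $$\varphi_{m,N}:\ \mathbb{C}^{d(m)-m}\to\pi_m(\hat G_N)$$ whose fibers are isomorphic non-singular affine algebraic varieties. Assume now that $N=A\in\mathrm{GL}_n(\mathbb{C})$. For a given $f\in\hat G_A$ and any $m$, the $m$-jet projection $\pi_m(\hat G_0(f))$ of the set $\hat G_0(f)\subset\hat G_0$ of formal linearizations of $f$ is a linear subspace of $\mathbb{C}^{d(m)-m}$ of dimension $$\delta(A,m)=d(m)-m-d(A,m).$$ There are linear isomorphisms $$\psi_{m,A,f}:\ \mathbb{C}^{\delta(A,m)}\to\pi_m(\hat G_0(f))$$ and a universal linearization linear isomorphism (obtained as an inductive limit) $$\psi_{\infty,A,f}:\ \mathbb{C}^{\delta(A)}\to\hat G_0(f),$$ where $\delta(A)=\lim_{m\to+\infty}\delta(A,m)$ (which can be infinite).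
   Context: $\hat G=\widehat{\mathrm{Diff}}(\mathbb{C}^n,0)$ is the group of formal diffeomorphisms of $(\mathbb{C}^n,0)$ (vanishing at $0$). An element of $\hat G$ is identified with the ordered set of the coefficients of its formal power series (for a chosen monomial ordering), so $\hat G\subset\mathbb{C}^{\infty}$. For $m\ge 1$, $\hat G_m$ is the group of $m$-jets of elements of $\hat G$, $\pi_m:\hat G\to\hat G_m$ is the $m$-jet morphism, $d(m)$ is the number of coefficients of the $m$-jet, and $\hat G_m$ is identified with a subset of $\mathbb{C}^{d(m)}$. $\hat G_0\subset\hat G$ is the normal subgroup of elements $h$ with identity linear part, $D_0h=I$; for $m\ge 2$, $\pi_m(\hat G_0)$ is identified with $\mathbb{C}^{d(m)-m}$. For $N\in\hat G$ (a fixed normal form), $\hat G_N=\{h^{-1}\circ N\circ h:\ h\in\hat G_0\}$. For $A\in\mathrm{GL}_n(\mathbb{C})$ (taken in Jordan normal form) and $f\in\hat G_A$, the set of formal linearizations of $f$ is $\hat G_0(f)=\{h\in\hat G_0:\ h^{-1}\circ f\circ h=A\}$. The number $d(A,m)$ is $d(N,m)$ for $N=A$.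
   Formalization: d(m)-m is read as d(m)-n^2, the number of coefficients of degree >= 2. For f different from A, "linear" becomes "affine" and is stated for the inverses of the formal linearizations; their own m-jets form an affine variety isomorphic to C^delta. For f=A the claim is linear as printed. *)

theory Defs
  imports
    "HOL-Analysis.Analysis"
    "HOL-Algebra.Group"
    "HOL-Library.Poly_Mapping"
    "HOL-Library.Function_Algebras"
    "HOL-Library.Extended_Nat"
begin

section \<open>Formal power series in finitely many variables\<close>

type_synonym 'v mono = "'v \<Rightarrow>\<^sub>0 nat"

definition mdeg :: "'v mono \<Rightarrow> nat" where
  "mdeg k = (\<Sum>v\<in>Poly_Mapping.keys k. Poly_Mapping.lookup k v)"

typedef 'n mfps = "UNIV :: ('n::finite mono \<Rightarrow> complex) set"
  morphisms mcoeff Abs_mfps ..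

setup_lifting type_definition_mfps

lemma mfps_eqI: "(\<And>a. mcoeff f a = mcoeff g a) \<Longrightarrow> f = g"
  by (metis ext mcoeff_inject)

definition splits :: "'n mono \<Rightarrow> ('n mono \<times> 'n mono) set" where
  "splits a = {(b, c). b + c = a}"

lemma mem_splits [simp]: "(b, c) \<in> splits a \<longleftrightarrow> b + c = a"
  by (simp add: splits_def)

lemma finite_splits [simp]: "finite (splits (a :: 'n::finite mono))"
proof -
  let ?P = "PiE (UNIV :: 'n set) (\<lambda>i. {..Poly_Mapping.lookup a i})"
  have "finite ?P" by (intro finite_PiE) auto
  moreover have "(\<lambda>(b, c). Poly_Mapping.lookup b) ` splits a \<subseteq> ?P"
    by (auto simp: splits_def lookup_add)
  ultimately have "finite ((\<lambda>(b, c). Poly_Mapping.lookup b) ` splits a)"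
    by (rule finite_subset[rotated])
  moreover have "inj_on (\<lambda>(b, c). Poly_Mapping.lookup b) (splits a)"
    by (auto simp: inj_on_def splits_def lookup_inject)
  ultimately show ?thesis by (rule finite_imageD)
qed

instantiation mfps :: (finite) comm_ring_1
begin

lift_definition zero_mfps :: "'a mfps" is "\<lambda>_. 0" .
lift_definition one_mfps :: "'a mfps" is "\<lambda>a. if a = 0 then 1 else 0" .
lift_definition plus_mfps :: "'a mfps \<Rightarrow> 'a mfps \<Rightarrow> 'a mfps" is "\<lambda>f g a. f a + g a" .
lift_definition minus_mfps :: "'a mfps \<Rightarrow> 'a mfps \<Rightarrow> 'a mfps" is "\<lambda>f g a. f a - g a" .
lift_definition uminus_mfps :: "'a mfps \<Rightarrow> 'a mfps" is "\<lambda>f a. - f a" .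
lift_definition times_mfps :: "'a mfps \<Rightarrow> 'a mfps \<Rightarrow> 'a mfps" is
  "\<lambda>f g a. \<Sum>(b, c)\<in>splits a. f b * g c" .

instance
proof
  fix f g h :: "'a mfps"
  have swap: "(\<Sum>(b, c)\<in>splits a. F b c) = (\<Sum>(b, c)\<in>splits a. F c b)"
    for a :: "'a mono" and F :: "'a mono \<Rightarrow> 'a mono \<Rightarrow> complex"
    by (rule sum.reindex_bij_witness[where i = prod.swap and j = prod.swap])
      (auto simp: splits_def add.commute)
  show "f * g = g * f"
    by (rule mfps_eqI) (simp add: times_mfps.rep_eq swap[of "\<lambda>b c. mcoeff f b * mcoeff g c"] mult.commute)
  show "f * g * h = f * (g * h)"
  proof (rule mfps_eqI)
    fix a
    have "mcoeff (f * g * h) a =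
        (\<Sum>(x, y)\<in>(SIGMA p:splits a. splits (fst p)). mcoeff f (fst y) * mcoeff g (snd y) * mcoeff h (snd x))"
      by (simp add: times_mfps.rep_eq sum_distrib_right case_prod_unfold sum.Sigma)
    also have "\<dots> =
        (\<Sum>(x, y)\<in>(SIGMA p:splits a. splits (snd p)). mcoeff f (fst x) * (mcoeff g (fst y) * mcoeff h (snd y)))"
      by (rule sum.reindex_bij_witness[where
            i = "\<lambda>((b, c), (d, e)). ((b + d, e), (b, d))" and
            j = "\<lambda>((b, c), (d, e)). ((d, e + c), (e, c))"])
        (auto simp: splits_def add.assoc mult.assoc)
    also have "\<dots> = mcoeff (f * (g * h)) a"
      by (simp add: times_mfps.rep_eq sum_distrib_left case_prod_unfold sum.Sigma)
    finally show "mcoeff (f * g * h) a = mcoeff (f * (g * h)) a" .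
  qed
  show "1 * f = f"
  proof (rule mfps_eqI)
    fix a
    have "mcoeff (1 * f) a = (\<Sum>p\<in>splits a. if p = (0, a) then mcoeff f a else 0)"
      unfolding times_mfps.rep_eq one_mfps.rep_eq
      by (rule sum.cong) (auto simp: splits_def split: if_splits)
    then show "mcoeff (1 * f) a = mcoeff f a" by simp
  qed
  show "(f + g) * h = f * h + g * h"
    by (rule mfps_eqI)
      (simp add: times_mfps.rep_eq plus_mfps.rep_eq case_prod_unfold distrib_right sum.distrib)
  show "(0 :: 'a mfps) \<noteq> 1"
    by transfer (metis zero_neq_one)
qed (transfer; simp add: fun_eq_iff algebra_simps)+

end

lift_definition mX :: "'n::finite \<Rightarrow> 'n mfps" is
  "\<lambda>i a. if a = Poly_Mapping.single i 1 then 1 else 0" .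


section \<open>Formal diffeomorphisms\<close>

type_synonym 'n fmap = "'n \<Rightarrow> 'n mfps"

text \<open>Substitution is only used for maps without constant term; then the power product
  of multidegree \<open>b\<close> has no terms of degree below \<open>mdeg b\<close>, so the sum below may be
  restricted to \<open>mdeg b \<le> mdeg a\<close>.\<close>

lift_definition msubst :: "'n::finite mfps \<Rightarrow> 'n fmap \<Rightarrow> 'n mfps" is
  "\<lambda>p G a. \<Sum>b | mdeg b \<le> mdeg a. p b * mcoeff (\<Prod>i\<in>UNIV. G i ^ Poly_Mapping.lookup b i) a" .

definition fcomp :: "'n::finite fmap \<Rightarrow> 'n fmap \<Rightarrow> 'n fmap" where
  "fcomp F G = (\<lambda>i. msubst (F i) G)"

definition linear_part :: "'n::finite fmap \<Rightarrow> complex ^ 'n ^ 'n" where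
  "linear_part F = (\<chi> i j. mcoeff (F i) (Poly_Mapping.single j 1))"

definition Ghat :: "('n::finite fmap) monoid" where
  "Ghat = \<lparr>carrier = {F. (\<forall>i. mcoeff (F i) 0 = 0) \<and> invertible (linear_part F)},
           mult = fcomp, one = mX\<rparr>"

definition Ghat0 :: "('n::finite fmap) set" where
  "Ghat0 = {h \<in> carrier Ghat. linear_part h = mat 1}"

definition conj_orbit :: "'n::finite fmap \<Rightarrow> 'n fmap set" where
  "conj_orbit N = {inv\<^bsub>Ghat\<^esub> h \<otimes>\<^bsub>Ghat\<^esub> N \<otimes>\<^bsub>Ghat\<^esub> h |h. h \<in> Ghat0}"

definition matrix_map :: "complex ^ 'n ^ 'n \<Rightarrow> 'n::finite fmap" where
  "matrix_map A = (\<lambda>i. \<Sum>j\<in>UNIV. Abs_mfps (\<lambda>a. if a = 0 then A $ i $ j else 0) * mX j)"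

text \<open>The inverses \<open>g\<close> of the elements of \<open>linearizations A f\<close>
  are the solutions in \<open>Ghat0\<close> of \<open>g \<circ> f = A \<circ> g\<close>, an equation that is linear in the
  coefficients of \<open>g\<close>; the equation \<open>f \<circ> h = h \<circ> A\<close> for \<open>h\<close> itself is not linear
  in \<open>h\<close> unless \<open>f\<close> is linear.\<close>

definition linearizations :: "complex ^ 'n ^ 'n \<Rightarrow> 'n::finite fmap \<Rightarrow> 'n fmap set" where
  "linearizations A f = {h \<in> Ghat0. inv\<^bsub>Ghat\<^esub> h \<otimes>\<^bsub>Ghat\<^esub> f \<otimes>\<^bsub>Ghat\<^esub> h = matrix_map A}"


section \<open>Coordinate spaces and jets\<close>

text \<open>The space \<open>\<complex>\<^sup>I\<close> for an index set \<open>I\<close> (finite or not) is rendered by functions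
  vanishing outside \<open>I\<close>. Coefficients are indexed by pairs (component, multi-index) rather
  than by their position in some monomial ordering.\<close>

definition cspace :: "'v set \<Rightarrow> ('v \<Rightarrow> complex) set" where
  "cspace I = {x. \<forall>v. v \<notin> I \<longrightarrow> x v = 0}"

definition restr :: "'v set \<Rightarrow> ('v \<Rightarrow> complex) \<Rightarrow> 'v \<Rightarrow> complex" where
  "restr I x = (\<lambda>v. if v \<in> I then x v else 0)"

type_synonym 'n cindex = "'n \<times> 'n mono"

definition jet_index :: "nat \<Rightarrow> 'n::finite cindex set" where
  "jet_index m = {(i, a). 1 \<le> mdeg a \<and> mdeg a \<le> m}"

definition jet0_index :: "nat \<Rightarrow> 'n::finite cindex set" where
  "jet0_index m = {(i, a). 2 \<le> mdeg a \<and> mdeg a \<le> m}"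

definition higher_index :: "'n::finite cindex set" where
  "higher_index = {(i, a). 2 \<le> mdeg a}"

definition coeffs :: "'n::finite fmap \<Rightarrow> 'n cindex \<Rightarrow> complex" where
  "coeffs F = (\<lambda>(i, a). mcoeff (F i) a)"

definition jet :: "nat \<Rightarrow> 'n::finite fmap \<Rightarrow> 'n cindex \<Rightarrow> complex" where
  "jet m F = restr (jet_index m) (coeffs F)"

text \<open>On \<open>Ghat0\<close> the linear part is fixed, so jets and full expansions are identified with
  their coefficients of degree at least 2.\<close>

definition jet0 :: "nat \<Rightarrow> 'n::finite fmap \<Rightarrow> 'n cindex \<Rightarrow> complex" where
  "jet0 m F = restr (jet0_index m) (coeffs F)"

definition coeffs0 :: "'n::finite fmap \<Rightarrow> 'n cindex \<Rightarrow> complex" where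
  "coeffs0 F = restr higher_index (coeffs F)"

definition jet_size :: "'n::finite itself \<Rightarrow> nat \<Rightarrow> nat" where
  "jet_size _ m = card (jet_index m :: 'n cindex set)"

lemma finite_mdeg_le: "finite {a :: 'n::finite mono. mdeg a \<le> m}"
proof -
  let ?P = "PiE (UNIV :: 'n set) (\<lambda>i. {..m})"
  have le: "Poly_Mapping.lookup a i \<le> mdeg a" for a :: "'n mono" and i
    unfolding mdeg_def
    by (cases "i \<in> Poly_Mapping.keys a") (auto intro: member_le_sum simp: in_keys_iff)
  have "finite ?P" by (intro finite_PiE) auto
  moreover have "Poly_Mapping.lookup ` {a :: 'n mono. mdeg a \<le> m} \<subseteq> ?P"
    using le by (auto intro: order_trans)
  ultimately have "finite (Poly_Mapping.lookup ` {a :: 'n mono. mdeg a \<le> m})"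
    by (rule finite_subset[rotated])
  moreover have "inj_on Poly_Mapping.lookup {a :: 'n mono. mdeg a \<le> m}"
    by (auto simp: inj_on_def lookup_inject)
  ultimately show ?thesis by (rule finite_imageD)
qed

lemma finite_jet_index: "finite (jet_index m :: 'n::finite cindex set)"
proof (rule finite_subset)
  show "jet_index m \<subseteq> (UNIV :: 'n set) \<times> {a :: 'n mono. mdeg a \<le> m}"
    by (auto simp: jet_index_def)
qed (simp add: finite_mdeg_le)

lemma card_jet0_index:
  assumes "m \<ge> 1"
  shows "card (jet0_index m :: 'n::finite cindex set) = jet_size TYPE('n) m - jet_size TYPE('n) 1"
proof -
  have "jet0_index m = (jet_index m - jet_index 1 :: 'n cindex set)"
    by (auto simp: jet_index_def jet0_index_def)
  moreover have "(jet_index 1 :: 'n cindex set) \<subseteq> jet_index m"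
    using assms by (auto simp: jet_index_def)
  ultimately show ?thesis
    by (simp add: jet_size_def card_Diff_subset finite_jet_index)
qed


section \<open>Linear and affine subspaces of coordinate spaces\<close>

definition cscale :: "complex \<Rightarrow> ('v \<Rightarrow> complex) \<Rightarrow> 'v \<Rightarrow> complex" where
  "cscale c x = (\<lambda>v. c * x v)"

global_interpretation cfun: vector_space cscale
  by standard (auto simp: cscale_def fun_eq_iff algebra_simps)

definition affine_subspace :: "('v \<Rightarrow> complex) set \<Rightarrow> nat \<Rightarrow> bool" where
  "affine_subspace S k \<longleftrightarrow>
     (\<exists>c W. cfun.subspace W \<and> cfun.dim W = k \<and> S = (\<lambda>w. c + w) ` W)"

definition linear_iso ::
  "(('v \<Rightarrow> complex) \<Rightarrow> ('w \<Rightarrow> complex)) \<Rightarrow> 'v set \<Rightarrow> ('w \<Rightarrow> complex) set \<Rightarrow> bool" where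
  "linear_iso L I S \<longleftrightarrow> Vector_Spaces.linear cscale cscale L \<and> bij_betw L (cspace I) S"

definition affine_iso ::
  "(('v \<Rightarrow> complex) \<Rightarrow> ('w \<Rightarrow> complex)) \<Rightarrow> 'v set \<Rightarrow> ('w \<Rightarrow> complex) set \<Rightarrow> bool" where
  "affine_iso T I S \<longleftrightarrow>
     (\<exists>c L. Vector_Spaces.linear cscale cscale L \<and> T = (\<lambda>x. c + L x)) \<and> bij_betw T (cspace I) S"


section \<open>Affine algebraic varieties\<close>

type_synonym 'v mpoly = "('v \<Rightarrow>\<^sub>0 nat) \<Rightarrow>\<^sub>0 complex"

definition mpeval :: "'v mpoly \<Rightarrow> ('v \<Rightarrow> complex) \<Rightarrow> complex" where
  "mpeval p x = (\<Sum>k\<in>Poly_Mapping.keys p.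
     Poly_Mapping.lookup p k * (\<Prod>v\<in>Poly_Mapping.keys k. x v ^ Poly_Mapping.lookup k v))"

definition mpvars :: "'v mpoly \<Rightarrow> 'v set" where
  "mpvars p = (\<Union>k\<in>Poly_Mapping.keys p. Poly_Mapping.keys k)"

definition poly_map_on ::
  "('v \<Rightarrow> complex) set \<Rightarrow> (('v \<Rightarrow> complex) \<Rightarrow> ('w \<Rightarrow> complex)) \<Rightarrow> bool" where
  "poly_map_on V f \<longleftrightarrow> (\<forall>w. \<exists>p. \<forall>x\<in>V. f x w = mpeval p x)"

definition poly_map_deg_le ::
  "('v \<Rightarrow> complex) set \<Rightarrow> nat \<Rightarrow> (('v \<Rightarrow> complex) \<Rightarrow> ('w \<Rightarrow> complex)) \<Rightarrow> bool" where
  "poly_map_deg_le V d f \<longleftrightarrow>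
     (\<forall>w. \<exists>p. (\<forall>k\<in>Poly_Mapping.keys p. mdeg k \<le> d) \<and> (\<forall>x\<in>V. f x w = mpeval p x))"

definition algebraic_set :: "'v set \<Rightarrow> ('v \<Rightarrow> complex) set \<Rightarrow> bool" where
  "algebraic_set I V \<longleftrightarrow> (\<exists>P. V = {x \<in> cspace I. \<forall>p\<in>P. mpeval p x = 0})"

definition affine_variety :: "'v set \<Rightarrow> ('v \<Rightarrow> complex) set \<Rightarrow> bool" where
  "affine_variety I V \<longleftrightarrow> algebraic_set I V \<and> V \<noteq> {} \<and>
     (\<forall>V1 V2. algebraic_set I V1 \<and> algebraic_set I V2 \<and> V = V1 \<union> V2 \<longrightarrow> V = V1 \<or> V = V2)"

text \<open>\<open>alg_independent V k p\<close>: the restrictions to \<open>V\<close> of \<open>p 0, \<dots>, p (k - 1)\<close> are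
  algebraically independent in the coordinate ring of \<open>V\<close>. The maximal such \<open>k\<close> is, for
  irreducible \<open>V\<close>, the transcendence degree of the function field of \<open>V\<close>.\<close>

definition alg_independent :: "('v \<Rightarrow> complex) set \<Rightarrow> nat \<Rightarrow> (nat \<Rightarrow> 'v mpoly) \<Rightarrow> bool" where
  "alg_independent V k p \<longleftrightarrow>
     (\<forall>Q. mpvars Q \<subseteq> {..<k} \<longrightarrow> (\<forall>x\<in>V. mpeval Q (\<lambda>j. mpeval (p j) x) = 0) \<longrightarrow> Q = 0)"

definition variety_dim :: "('v \<Rightarrow> complex) set \<Rightarrow> nat" where
  "variety_dim V = Sup {k. \<exists>p. alg_independent V k p}"

definition tangent_space :: "'v set \<Rightarrow> ('v \<Rightarrow> complex) set \<Rightarrow> ('v \<Rightarrow> complex) \<Rightarrow> ('v \<Rightarrow> complex) set" where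
  "tangent_space I V x = {u \<in> cspace I. \<forall>p. (\<forall>y\<in>V. mpeval p y = 0) \<longrightarrow>
     deriv (\<lambda>t. mpeval p (\<lambda>v. x v + t * u v)) 0 = 0}"

definition nonsingular :: "'v set \<Rightarrow> ('v \<Rightarrow> complex) set \<Rightarrow> bool" where
  "nonsingular I V \<longleftrightarrow> (\<forall>x\<in>V. cfun.dim (tangent_space I V x) = variety_dim V)"

definition alg_isomorphic :: "('v \<Rightarrow> complex) set \<Rightarrow> ('w \<Rightarrow> complex) set \<Rightarrow> bool" where
  "alg_isomorphic V W \<longleftrightarrow>
     (\<exists>f g. poly_map_on V f \<and> poly_map_on W g \<and> f ` V \<subseteq> W \<and> g ` W \<subseteq> V \<and>
        (\<forall>x\<in>V. g (f x) = x) \<and> (\<forall>y\<in>W. f (g y) = y))"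


section \<open>The numerical invariants\<close>

definition orbit_dim :: "'n::finite fmap \<Rightarrow> nat \<Rightarrow> nat" where
  "orbit_dim N m = variety_dim (jet m ` conj_orbit N)"

text \<open>\<open>jet_size TYPE('n) m - jet_size TYPE('n) 1\<close> is the number of coefficients of degree
  at least 2, i.e. the dimension of the space of \<open>m\<close>-jets of \<open>Ghat0\<close>
  (lemma \<open>card_jet0_index\<close>).\<close>

definition delta :: "complex ^ 'n ^ 'n::finite \<Rightarrow> nat \<Rightarrow> nat" where
  "delta A m = jet_size TYPE('n) m - jet_size TYPE('n) 1 - orbit_dim (matrix_map A) m"

definition delta_inf :: "complex ^ 'n ^ 'n::finite \<Rightarrow> enat" where
  "delta_inf A = lim (\<lambda>m. enat (delta A m))"

end

theory Submission
  imports Defs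
begin

text \<open>
  Both halves of the theorem rest on two features of the group of \<open>m\<close>-jets tangent to the identity:
  its actions are triangular with respect to the degree, and it is closed under complex powers.

  \<^emph>\<open>Triangularity.\<close> Conjugating a map by \<open>h\<close>, or composing it with \<open>h\<close>, changes each coefficient by an
  amount that depends on the coefficients of lower degree only. \<^emph>\<open>Complex powers.\<close> The iterates of
  \<open>h\<close> extend to powers \<open>h\<^sup>t\<close> with \<open>t \<in> \<complex>\<close> whose coefficients are polynomials in \<open>t\<close> (\<open>fpow\<close>). A stabilizer
  contains the natural powers of its elements, hence their complex powers, because a polynomial in \<open>t\<close>
  that is constant on \<open>\<nat>\<close> is constant.

  Let a group closed under complex powers act on \<open>\<complex>\<^sup>I\<close>, and treat the coordinates of a point of an orbit
  one at a time in order of degree. The stabilizer of the coordinates already treated translates the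
  next coordinate. If all these translations vanish, then the coordinate is a polynomial in the earlier
  ones; otherwise the powers of one element realize every translation, and the coordinate is a free
  parameter. This yields a polynomial map from \<open>\<complex>\<^sup>r\<close> onto the orbit with a polynomial left inverse
  defined on all of \<open>\<complex>\<^sup>I\<close> (\<open>orbit_parametrization\<close>). Such a set, here called an affine cell, is closed
  (it is the locus where embedding and inverse compose to the identity), irreducible, non-singular and
  isomorphic to \<open>\<complex>\<^sup>r\<close>, so that its dimension is \<open>r\<close>.

  For the first half, the group acts on jets of maps by conjugation, which gives the variety
  \<open>\<pi>\<^sub>m (G\<^sub>N)\<close>. The map \<open>\<phi>\<close> sends \<open>h\<close> to the jet of \<open>h\<inverse> N h\<close>; counting weights, where a coefficient
  of degree \<open>d\<close> has weight \<open>d - 1\<close>, bounds its degree. Its fibers are the orbits of the stabilizer of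
  the jet of \<open>N\<close> under composition on the left, and composition on the right carries one fiber to another.
  The parametrization of the orbit provides a section of \<open>\<phi>\<close>, so that the group is the product of the
  orbit and the stabilizer, and the dimensions of orbit and fiber add up to that of the group
  (\<open>orbit_stabilizer_dim\<close>).

  For the second half, fix a linearization \<open>h\<^sub>0\<close> of \<open>f\<close>. The inverses of all the linearizations are the maps
  \<open>c h\<^sub>0\<inverse>\<close>, where \<open>c\<close> runs through the maps tangent to the identity that commute with \<open>A\<close>. Composition
  with \<open>A\<close> preserves degrees, so the commutation equation is linear and splits into its homogeneous
  parts; bases of the spaces of homogeneous solutions, concatenated in order of degree, give linear
  coordinates on the solutions that are compatible with all truncations. Composition with
  \<open>h\<^sub>0\<inverse>\<close> on the right is affine, bijective and also compatible with truncations. Finally, the \<open>m\<close>-jets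
  commuting with \<open>A\<close> are a fiber of \<open>\<phi>\<close> for \<open>N = A\<close>, so the additivity of dimensions identifies the
  number of coordinates up to degree \<open>m\<close> with \<open>\<delta>(A, m)\<close>.
\<close>


section \<open>Polynomial functions\<close>

definition mon :: "'v mono \<Rightarrow> ('v \<Rightarrow> complex) \<Rightarrow> complex" where
  "mon k x = (\<Prod>v\<in>Poly_Mapping.keys k. x v ^ Poly_Mapping.lookup k v)"

lemma mon_superset:
  assumes "finite K" "Poly_Mapping.keys k \<subseteq> K"
  shows "mon k x = (\<Prod>v\<in>K. x v ^ Poly_Mapping.lookup k v)"
  unfolding mon_def by (rule prod.mono_neutral_left) (use assms in \<open>auto simp: in_keys_iff\<close>)

lemma mon_add: "mon (k + l) x = mon k x * mon l x"
proof -
  let ?K = "Poly_Mapping.keys k \<union> Poly_Mapping.keys l"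
  have "mon (k + l) x = (\<Prod>v\<in>?K. x v ^ Poly_Mapping.lookup (k + l) v)"
    by (rule mon_superset) (auto simp: keys_add)
  also have "\<dots> = (\<Prod>v\<in>?K. x v ^ Poly_Mapping.lookup k v) * (\<Prod>v\<in>?K. x v ^ Poly_Mapping.lookup l v)"
    by (simp add: lookup_add power_add prod.distrib)
  finally show ?thesis by (simp add: mon_superset[of ?K k] mon_superset[of ?K l])
qed

lemma mon_zero [simp]: "mon 0 x = 1"
  by (simp add: mon_def)

lemma mon_single [simp]: "mon (Poly_Mapping.single v n) x = x v ^ n"
  by (simp add: mon_def)

lemma mdeg_superset:
  assumes "finite K" "Poly_Mapping.keys k \<subseteq> K"
  shows "mdeg k = (\<Sum>v\<in>K. Poly_Mapping.lookup k v)"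
  unfolding mdeg_def by (rule sum.mono_neutral_left) (use assms in \<open>auto simp: in_keys_iff\<close>)

lemma mdeg_add [simp]: "mdeg (k + l) = mdeg k + mdeg l"
proof -
  let ?K = "Poly_Mapping.keys k \<union> Poly_Mapping.keys l"
  have "mdeg (k + l) = (\<Sum>v\<in>?K. Poly_Mapping.lookup (k + l) v)"
    by (rule mdeg_superset) (auto simp: keys_add)
  then show ?thesis
    by (simp add: mdeg_superset[of ?K k] mdeg_superset[of ?K l] lookup_add sum.distrib)
qed

lemma mdeg_zero [simp]: "mdeg 0 = 0"
  by (simp add: mdeg_def)

lemma mdeg_single [simp]: "mdeg (Poly_Mapping.single v n) = n"
  by (simp add: mdeg_def)

lemma mdeg_eq_0_iff: "mdeg k = 0 \<longleftrightarrow> k = 0"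
  by (auto simp: mdeg_def in_keys_iff poly_mapping_eq_iff fun_eq_iff)

lemma lookup_le_mdeg: "Poly_Mapping.lookup k v \<le> mdeg k"
  unfolding mdeg_def by (cases "v \<in> Poly_Mapping.keys k") (auto intro: member_le_sum simp: in_keys_iff)

lemma mpeval_eq_mon: "mpeval p x = (\<Sum>k\<in>Poly_Mapping.keys p. Poly_Mapping.lookup p k * mon k x)"
  by (simp add: mpeval_def mon_def)

lemma mpeval_superset:
  assumes "finite K" "Poly_Mapping.keys p \<subseteq> K"
  shows "mpeval p x = (\<Sum>k\<in>K. Poly_Mapping.lookup p k * mon k x)"
  unfolding mpeval_eq_mon
  by (rule sum.mono_neutral_left) (use assms in \<open>auto simp: in_keys_iff\<close>)

lemma mpeval_add: "mpeval (p + q) x = mpeval p x + mpeval q x"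
proof -
  let ?K = "Poly_Mapping.keys p \<union> Poly_Mapping.keys q"
  have "mpeval (p + q) x = (\<Sum>k\<in>?K. Poly_Mapping.lookup (p + q) k * mon k x)"
    by (rule mpeval_superset) (auto simp: keys_add)
  then show ?thesis
    by (simp add: mpeval_superset[of ?K p] mpeval_superset[of ?K q] lookup_add sum.distrib algebra_simps)
qed

lemma mpeval_zero [simp]: "mpeval 0 x = 0"
  by (simp add: mpeval_def)

lemma mpeval_sum: "mpeval (\<Sum>i\<in>A. p i) x = (\<Sum>i\<in>A. mpeval (p i) x)"
  by (induction A rule: infinite_finite_induct) (simp_all add: mpeval_add)

lemma mpeval_single [simp]: "mpeval (Poly_Mapping.single k c) x = c * mon k x"
  by (cases "c = 0") (simp_all add: mpeval_eq_mon)

text \<open>Degree bounds are attached to functions rather than to polynomials, so that closure under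
  the ring operations can be used without naming the polynomials.\<close>

definition pdeg :: "nat \<Rightarrow> (('v \<Rightarrow> complex) \<Rightarrow> complex) \<Rightarrow> bool" where
  "pdeg d f \<longleftrightarrow> (\<exists>p. (\<forall>k\<in>Poly_Mapping.keys p. mdeg k \<le> d) \<and> (\<forall>x. f x = mpeval p x))"

definition polyfn :: "(('v \<Rightarrow> complex) \<Rightarrow> complex) \<Rightarrow> bool" where
  "polyfn f \<longleftrightarrow> (\<exists>p. \<forall>x. f x = mpeval p x)"

lemma polyfn_iff_pdeg: "polyfn f \<longleftrightarrow> (\<exists>d. pdeg d f)"
proof
  assume "polyfn f"
  then obtain p where p: "\<forall>x. f x = mpeval p x" by (auto simp: polyfn_def)
  have "\<forall>k\<in>Poly_Mapping.keys p. mdeg k \<le> Max (mdeg ` Poly_Mapping.keys p)" by simp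
  with p show "\<exists>d. pdeg d f" unfolding pdeg_def by blast
qed (auto simp: polyfn_def pdeg_def)

lemma pdeg_imp_polyfn: "pdeg d f \<Longrightarrow> polyfn f"
  by (auto simp: polyfn_iff_pdeg)

lemma pdeg_mono: "pdeg d f \<Longrightarrow> d \<le> e \<Longrightarrow> pdeg e f"
  by (force simp: pdeg_def)

lemma pdeg_const: "pdeg d (\<lambda>_. c)"
  unfolding pdeg_def by (rule exI[of _ "Poly_Mapping.single 0 c"]) auto

lemma pdeg_coord: "pdeg (Suc 0) (\<lambda>x. x v)"
  unfolding pdeg_def
  by (rule exI[of _ "Poly_Mapping.single (Poly_Mapping.single v 1) 1"]) auto

lemma pdeg_add:
  assumes "pdeg d f" "pdeg d g" shows "pdeg d (\<lambda>x. f x + g x)"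
proof -
  obtain p q where pq: "\<forall>k\<in>Poly_Mapping.keys p. mdeg k \<le> d" "\<forall>x. f x = mpeval p x"
    "\<forall>k\<in>Poly_Mapping.keys q. mdeg k \<le> d" "\<forall>x. g x = mpeval q x"
    using assms by (auto simp: pdeg_def)
  show ?thesis unfolding pdeg_def
    by (rule exI[of _ "p + q"]) (use pq keys_add[of p q] in \<open>auto simp: mpeval_add\<close>)
qed

lemma pdeg_sum: "(\<And>i. i \<in> A \<Longrightarrow> pdeg d (f i)) \<Longrightarrow> pdeg d (\<lambda>x. \<Sum>i\<in>A. f i x)"
  by (induction A rule: infinite_finite_induct) (simp_all add: pdeg_const pdeg_add)

lemma pdeg_mult:
  assumes "pdeg d f" "pdeg e g" shows "pdeg (d + e) (\<lambda>x. f x * g x)"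
proof -
  obtain p q where pq: "\<forall>k\<in>Poly_Mapping.keys p. mdeg k \<le> d" "\<forall>x. f x = mpeval p x"
    "\<forall>k\<in>Poly_Mapping.keys q. mdeg k \<le> e" "\<forall>x. g x = mpeval q x"
    using assms by (auto simp: pdeg_def)
  have *: "(\<lambda>x. f x * g x) = (\<lambda>x. \<Sum>k\<in>Poly_Mapping.keys p. \<Sum>l\<in>Poly_Mapping.keys q.
      Poly_Mapping.lookup p k * Poly_Mapping.lookup q l * mon (k + l) x)"
    using pq by (simp add: mpeval_eq_mon sum_product mon_add mult_ac)
  have "pdeg (d + e) (\<lambda>x. c * mon (k + l) x)"
    if "k \<in> Poly_Mapping.keys p" "l \<in> Poly_Mapping.keys q" for k l c
    unfolding pdeg_def
    by (rule exI[of _ "Poly_Mapping.single (k + l) c"]) (use pq that in \<open>auto intro: add_mono\<close>)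
  then show ?thesis unfolding * by (intro pdeg_sum) auto
qed

lemma pdeg_mult': "pdeg d f \<Longrightarrow> pdeg e g \<Longrightarrow> d + e \<le> n \<Longrightarrow> pdeg n (\<lambda>x. f x * g x)"
  using pdeg_mult pdeg_mono by blast

lemma polyfn_const [simp, intro]: "polyfn (\<lambda>_. c)"
  by (rule pdeg_imp_polyfn, rule pdeg_const)

lemma polyfn_coord [simp, intro]: "polyfn (\<lambda>x. x v)"
  by (rule pdeg_imp_polyfn, rule pdeg_coord)

lemma polyfn_add [intro]: "polyfn f \<Longrightarrow> polyfn g \<Longrightarrow> polyfn (\<lambda>x. f x + g x)"
  unfolding polyfn_iff_pdeg by (metis pdeg_add pdeg_mono max.cobounded1 max.cobounded2)

lemma polyfn_mult [intro]: "polyfn f \<Longrightarrow> polyfn g \<Longrightarrow> polyfn (\<lambda>x. f x * g x)"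
  unfolding polyfn_iff_pdeg using pdeg_mult by blast

lemma polyfn_sum [intro]: "(\<And>i. i \<in> A \<Longrightarrow> polyfn (f i)) \<Longrightarrow> polyfn (\<lambda>x. \<Sum>i\<in>A. f i x)"
  by (induction A rule: infinite_finite_induct) (simp_all add: polyfn_add)

lemma polyfn_prod [intro]: "(\<And>i. i \<in> A \<Longrightarrow> polyfn (f i)) \<Longrightarrow> polyfn (\<lambda>x. \<Prod>i\<in>A. f i x)"
  by (induction A rule: infinite_finite_induct) (simp_all add: polyfn_mult)

lemma polyfn_diff [intro]: "polyfn f \<Longrightarrow> polyfn g \<Longrightarrow> polyfn (\<lambda>x. f x - g x)"
  using polyfn_add[of f "\<lambda>x. (-1) * g x"] polyfn_mult[of "\<lambda>_. -1" g] by simp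

lemma polyfn_mpeval [intro]: "polyfn (mpeval p)"
  by (auto simp: polyfn_def)

lemma polyfn_induct [consumes 1, case_names const coord add mult]:
  assumes "polyfn f"
    and const: "\<And>c. P (\<lambda>_. c)" and coord: "\<And>v. P (\<lambda>x. x v)"
    and add: "\<And>f g. P f \<Longrightarrow> P g \<Longrightarrow> P (\<lambda>x. f x + g x)"
    and mult: "\<And>f g. P f \<Longrightarrow> P g \<Longrightarrow> P (\<lambda>x. f x * g x)"
  shows "P f"
proof -
  have sum: "(\<And>i. i \<in> A \<Longrightarrow> P (f i)) \<Longrightarrow> P (\<lambda>x. \<Sum>i\<in>A. f i x)" for A :: "'v mono set" and f
    by (induction A rule: infinite_finite_induct) (simp_all add: const add)
  have pow: "P (\<lambda>x. x v ^ n)" for v and n :: nat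
    by (induction n) (simp_all add: const coord mult)
  have prod: "(\<And>i. i \<in> A \<Longrightarrow> P (f i)) \<Longrightarrow> P (\<lambda>x. \<Prod>i\<in>A. f i x)" for A :: "'v set" and f
    by (induction A rule: infinite_finite_induct) (simp_all add: const mult)
  obtain p where "f = mpeval p" using assms(1) by (auto simp: polyfn_def fun_eq_iff)
  moreover have "P (mpeval p)" unfolding mpeval_def
    by (intro sum mult const prod pow)
  ultimately show ?thesis by simp
qed

lemma polyfn_subst:
  assumes "polyfn f" "\<And>v. polyfn (\<lambda>z. y z v)"
  shows "polyfn (\<lambda>z. f (y z))"
  using assms(1) by (induction rule: polyfn_induct) (auto simp: assms(2))

text \<open>Along a polynomial curve a polynomial function becomes a polynomial in one variable, to which the
  finiteness of the set of roots applies.\<close>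

lemma polyfn_line:
  assumes "polyfn f" "\<And>v. \<exists>q. \<forall>t. y t v = poly q t"
  shows "\<exists>q. \<forall>t. f (y t) = poly q (t :: complex)"
  using assms(1)
proof (induction rule: polyfn_induct)
  case (const c) show ?case by (rule exI[of _ "[:c:]"]) simp
next
  case (coord v) show ?case using assms(2) .
next
  case (add f g) then show ?case by (metis poly_add)
next
  case (mult f g) then show ?case by (metis poly_mult)
qed

lemma polyfn_univariate:
  fixes f :: "(nat \<Rightarrow> complex) \<Rightarrow> complex"
  assumes "polyfn f" shows "\<exists>q. \<forall>t. f (\<lambda>_. t) = poly q t"
  using assms by (rule polyfn_line) (rule exI[of _ "[:0, 1:]"], simp)

text \<open>Identities that are polynomial in a complex exponent need to be checked for natural exponents
  only.\<close>

lemma poly_fun_eq_of_nat: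
  fixes p q :: "complex poly"
  assumes "\<And>n :: nat. poly p (of_nat n) = poly q (of_nat n)"
  shows "p = q"
proof (rule ccontr)
  assume "p \<noteq> q"
  then have "finite {t. poly (p - q) t = 0}" by (intro poly_roots_finite) simp
  moreover have "range (of_nat :: nat \<Rightarrow> complex) \<subseteq> {t. poly (p - q) t = 0}"
    using assms by auto
  ultimately show False
    using finite_subset finite_imageD[of "of_nat :: nat \<Rightarrow> complex" UNIV] inj_of_nat by auto
qed

text \<open>The derivative of a polynomial function along a differentiable curve depends only on the velocity, and
  linearly; this chain rule serves to compute the tangent spaces of parametrized varieties.\<close>

definition dirder :: "(('v \<Rightarrow> complex) \<Rightarrow> complex) \<Rightarrow> ('v \<Rightarrow> complex) \<Rightarrow> ('v \<Rightarrow> complex) \<Rightarrow> complex" where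
  "dirder f x u = deriv (\<lambda>t. f (\<lambda>v. x v + t * u v)) 0"

lemma polyfn_gradient:
  fixes f :: "('v \<Rightarrow> complex) \<Rightarrow> complex"
  assumes "polyfn f"
  shows "\<exists>V c. finite V \<and> (\<forall>y u. (\<forall>v. ((\<lambda>t. y t v) has_field_derivative u v) (at 0)) \<and> y 0 = x \<longrightarrow>
     ((\<lambda>t. f (y t)) has_field_derivative (\<Sum>v\<in>V. c v * u v)) (at 0))"
    (is "\<exists>V c. ?P f V c")
  using assms
proof (induction rule: polyfn_induct)
  case (const c) show ?case by (rule exI[of _ "{}"]) auto
next
  case (coord v) show ?case by (rule exI[of _ "{v}"], rule exI[of _ "\<lambda>_. 1"]) auto
next
  case (add f g)
  then obtain V c W d where 1: "?P f V c" and 2: "?P g W d" by blast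
  let ?c = "\<lambda>v. (if v \<in> V then c v else 0) + (if v \<in> W then d v else 0)"
  have "(\<Sum>v\<in>V \<union> W. ?c v * u v) = (\<Sum>v\<in>V. c v * u v) + (\<Sum>v\<in>W. d v * u v)" for u
  proof -
    have "(\<Sum>v\<in>V \<union> W. (if v \<in> V then c v else 0) * u v) = (\<Sum>v\<in>V. c v * u v)"
      by (rule sum.mono_neutral_cong_right) (use 1 2 in auto)
    moreover have "(\<Sum>v\<in>V \<union> W. (if v \<in> W then d v else 0) * u v) = (\<Sum>v\<in>W. d v * u v)"
      by (rule sum.mono_neutral_cong_right) (use 1 2 in auto)
    ultimately show ?thesis by (simp add: distrib_right sum.distrib)
  qed
  then have "?P (\<lambda>x. f x + g x) (V \<union> W) ?c"
    using 1 2 by (auto intro!: DERIV_add)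
  then show ?case by (intro exI[of _ "V \<union> W"] exI[of _ ?c])
next
  case (mult f g)
  then obtain V c W d where 1: "?P f V c" and 2: "?P g W d" by blast
  let ?c = "\<lambda>v. (if v \<in> V then c v * g x else 0) + (if v \<in> W then d v * f x else 0)"
  have *: "(\<Sum>v\<in>V \<union> W. ?c v * u v) = (\<Sum>v\<in>V. c v * u v) * g x + (\<Sum>v\<in>W. d v * u v) * f x" for u
  proof -
    have "(\<Sum>v\<in>V \<union> W. (if v \<in> V then c v * g x else 0) * u v) = (\<Sum>v\<in>V. c v * g x * u v)"
      by (rule sum.mono_neutral_cong_right) (use 1 2 in auto)
    moreover have "(\<Sum>v\<in>V \<union> W. (if v \<in> W then d v * f x else 0) * u v) = (\<Sum>v\<in>W. d v * f x * u v)"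
      by (rule sum.mono_neutral_cong_right) (use 1 2 in auto)
    ultimately show ?thesis by (simp add: algebra_simps sum.distrib sum_distrib_left)
  qed
  have "?P (\<lambda>x. f x * g x) (V \<union> W) ?c"
  proof (intro conjI allI impI)
    fix y u assume y: "(\<forall>v. ((\<lambda>t. y t v) has_field_derivative u v) (at 0)) \<and> y 0 = x"
    show "((\<lambda>t. f (y t) * g (y t)) has_field_derivative (\<Sum>v\<in>V \<union> W. ?c v * u v)) (at 0)"
      unfolding * using DERIV_mult[of "\<lambda>t. f (y t)" _ 0 UNIV "\<lambda>t. g (y t)"] 1 2 y by auto
  qed (use 1 2 in auto)
  then show ?case by (intro exI[of _ "V \<union> W"] exI[of _ ?c])
qed

lemma
  assumes "polyfn f"
  shows polyfn_chain_rule: "(\<And>v. ((\<lambda>t. y t v) has_field_derivative u v) (at 0)) \<Longrightarrow> y 0 = x \<Longrightarrow>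
      ((\<lambda>t. f (y t)) has_field_derivative dirder f x u) (at 0)"
    and dirder_add: "dirder f x (\<lambda>v. u v + w v) = dirder f x u + dirder f x w"
    and dirder_scale: "dirder f x (\<lambda>v. c * u v) = c * dirder f x u"
proof -
  obtain V c where V: "\<And>y u. (\<And>v. ((\<lambda>t. y t v) has_field_derivative u v) (at 0)) \<Longrightarrow> y 0 = x \<Longrightarrow>
     ((\<lambda>t. f (y t)) has_field_derivative (\<Sum>v\<in>V. c v * u v)) (at 0)"
    using polyfn_gradient[OF assms] by metis
  have *: "dirder f x u = (\<Sum>v\<in>V. c v * u v)" for u
    unfolding dirder_def by (rule DERIV_imp_deriv, rule V) (auto intro!: derivative_eq_intros)
  show "(\<And>v. ((\<lambda>t. y t v) has_field_derivative u v) (at 0)) \<Longrightarrow> y 0 = x \<Longrightarrow>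
      ((\<lambda>t. f (y t)) has_field_derivative dirder f x u) (at 0)" for y u
    unfolding * by (rule V)
  show "dirder f x (\<lambda>v. u v + w v) = dirder f x u + dirder f x w"
    by (simp add: * distrib_left sum.distrib)
  show "dirder f x (\<lambda>v. c * u v) = c * dirder f x u" for c
    by (simp add: * sum_distrib_left mult_ac)
qed


section \<open>Embedded affine spaces\<close>

text \<open>A copy of \<open>\<complex>\<^sup>l\<close> inside \<open>\<complex>\<^sup>I\<close>, embedded by a polynomial map that has a polynomial left inverse. The
  left inverse is defined on the whole of \<open>\<complex>\<^sup>I\<close>, which is what makes the image closed.\<close>

definition affine_cell :: "'v set \<Rightarrow> ('v \<Rightarrow> complex) set \<Rightarrow> nat \<Rightarrow> bool" where
  "affine_cell I V l \<longleftrightarrow> (\<exists>F G. (\<forall>v. polyfn (\<lambda>z. F z v)) \<and> (\<forall>k. polyfn (\<lambda>y. G y k)) \<and>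
     F ` cspace {..<l} = V \<and> V \<subseteq> cspace I \<and> (\<forall>y. G y \<in> cspace {..<l}) \<and>
     (\<forall>z\<in>cspace {..<l}. G (F z) = z))"

lemma polyfn_if [intro]: "polyfn f \<Longrightarrow> polyfn g \<Longrightarrow> polyfn (\<lambda>z. if c then f z else g z)"
  by (cases c) simp_all

lemma zero_in_cspace [simp]: "(\<lambda>_. 0) \<in> cspace I" "0 \<in> cspace I"
  by (auto simp: cspace_def)

lemma restr_in_cspace [simp]: "restr I x \<in> cspace I"
  by (auto simp: restr_def cspace_def)

lemma restr_cspace: "x \<in> cspace I \<Longrightarrow> restr I x = x"
  by (auto simp: restr_def cspace_def)

lemma polyfn_restr [intro]: "(\<And>v. polyfn (\<lambda>z. y z v)) \<Longrightarrow> polyfn (\<lambda>z. restr I (y z) v)"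
  by (cases "v \<in> I") (simp_all add: restr_def)

lemma affine_cell_affine_variety:
  assumes "affine_cell I V l" shows "affine_variety I V"
proof -
  obtain F G where F: "\<And>v. polyfn (\<lambda>z. F z v)" and G: "\<And>k. polyfn (\<lambda>y. G y k)"
    and V: "F ` cspace {..<l} = V" "V \<subseteq> cspace I" and Gr: "\<And>y. G y \<in> cspace {..<l}"
    and GF: "\<And>z. z \<in> cspace {..<l} \<Longrightarrow> G (F z) = z"
    using assms unfolding affine_cell_def by blast
  have "\<exists>p. \<forall>y. y v - F (G y) v = mpeval p y" for v
    using polyfn_diff[OF polyfn_coord polyfn_subst[OF F[of v], of G]] G by (auto simp: polyfn_def)
  then obtain p where p: "\<And>v y. y v - F (G y) v = mpeval (p v) y" by metis
  \<comment> \<open>A point lies on the image iff the embedding recovers it from its coordinates.\<close>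
  have "V = {x \<in> cspace I. \<forall>q\<in>range p. mpeval q x = 0}"
  proof (intro equalityI subsetI)
    fix y assume "y \<in> V"
    then obtain z where z: "z \<in> cspace {..<l}" "y = F z" using V by auto
    then show "y \<in> {x \<in> cspace I. \<forall>q\<in>range p. mpeval q x = 0}"
      using V GF by (auto simp: p[symmetric])
  next
    fix y assume "y \<in> {x \<in> cspace I. \<forall>q\<in>range p. mpeval q x = 0}"
    then have "y = F (G y)" by (auto simp: p[symmetric] fun_eq_iff)
    then show "y \<in> V" using V Gr by blast
  qed
  then have "algebraic_set I V" unfolding algebraic_set_def by blast
  moreover have "V \<noteq> {}" using V zero_in_cspace by blast
  moreover have "V = V1 \<or> V = V2"
    if alg: "algebraic_set I V1" "algebraic_set I V2" and un: "V = V1 \<union> V2" for V1 V2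
  proof (rule ccontr)
    assume "\<not> (V = V1 \<or> V = V2)"
    then obtain x y where xy: "x \<in> V" "x \<notin> V1" "y \<in> V" "y \<notin> V2" using un by blast
    obtain P1 P2 where P: "V1 = {x \<in> cspace I. \<forall>p\<in>P1. mpeval p x = 0}"
      "V2 = {x \<in> cspace I. \<forall>p\<in>P2. mpeval p x = 0}"
      using alg unfolding algebraic_set_def by blast
    obtain p q where p: "p \<in> P1" "mpeval p x \<noteq> 0" and q: "q \<in> P2" "mpeval q y \<noteq> 0"
      using xy P V by blast
    obtain a b where ab: "a \<in> cspace {..<l}" "x = F a" "b \<in> cspace {..<l}" "y = F b"
      using xy V by blast
    \<comment> \<open>Two polynomials, each nonzero at some point of the cell, are both nonzero at some
      point of the line that joins the parameters of these points.\<close>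
    define L where "L t = (\<lambda>v. a v + t * (b v - a v))" for t :: complex
    have L: "\<exists>q. \<forall>t. L t v = poly q t" for v
      unfolding L_def by (rule exI[of _ "[:a v, b v - a v:]"]) simp
    have "\<exists>q. \<forall>t. mpeval p (F (L t)) = poly q t"
      by (rule polyfn_line[OF polyfn_mpeval]) (rule polyfn_line[OF F L])
    then obtain r where r: "\<And>t. mpeval p (F (L t)) = poly r t" by blast
    have "\<exists>q'. \<forall>t. mpeval q (F (L t)) = poly q' t"
      by (rule polyfn_line[OF polyfn_mpeval]) (rule polyfn_line[OF F L])
    then obtain s where s: "\<And>t. mpeval q (F (L t)) = poly s t" by blast
    have "L 0 = a" "L 1 = b" by (auto simp: L_def)
    then have "r \<noteq> 0" "s \<noteq> 0" using p q ab r[of 0] s[of 1] by auto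
    then have "finite {t. poly (r * s) t = 0}" by (intro poly_roots_finite) simp
    then obtain t where t: "poly (r * s) t \<noteq> 0"
      using infinite_UNIV_char_0[where 'a = complex] by (metis (mono_tags, lifting) UNIV_eq_I mem_Collect_eq)
    have "L t \<in> cspace {..<l}" using ab by (auto simp: L_def cspace_def)
    then have "F (L t) \<in> V" using V by blast
    then show False using t r[of t] s[of t] p q P un by auto
  qed
  ultimately show ?thesis by (auto simp: affine_variety_def)
qed

lemma poly_map_onI:
  assumes "\<And>v. polyfn (\<lambda>x. f x v)" shows "poly_map_on V f"
  using assms unfolding poly_map_on_def polyfn_def by blast

lemma affine_cell_alg_isomorphic:
  assumes "affine_cell I V l" shows "alg_isomorphic (cspace {..<l}) V"
proof -
  obtain F G where F: "\<And>v. polyfn (\<lambda>z. F z v)" and G: "\<And>k. polyfn (\<lambda>y. G y k)"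
    and V: "F ` cspace {..<l} = V" "V \<subseteq> cspace I" and Gr: "\<And>y. G y \<in> cspace {..<l}"
    and GF: "\<And>z. z \<in> cspace {..<l} \<Longrightarrow> G (F z) = z"
    using assms unfolding affine_cell_def by blast
  have "poly_map_on (cspace {..<l}) F" "poly_map_on V G"
    using F G by (intro poly_map_onI; blast)+
  then show ?thesis unfolding alg_isomorphic_def
    using V Gr GF by (intro exI[of _ F] exI[of _ G]) auto
qed

lemma alg_isomorphic_sym: "alg_isomorphic V W \<Longrightarrow> alg_isomorphic W V"
  unfolding alg_isomorphic_def by blast

lemma affine_cell_image:
  assumes "affine_cell I V l"
    and f: "\<And>v. polyfn (\<lambda>x. f x v)" and g: "\<And>v. polyfn (\<lambda>x. g x v)"
    and "\<And>x. x \<in> V \<Longrightarrow> f x \<in> cspace J" "\<And>x. x \<in> V \<Longrightarrow> g (f x) = x"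
  shows "affine_cell J (f ` V) l"
proof -
  obtain F G where F: "\<And>v. polyfn (\<lambda>z. F z v)" and G: "\<And>k. polyfn (\<lambda>y. G y k)"
    and V: "F ` cspace {..<l} = V" "V \<subseteq> cspace I" and Gr: "\<And>y. G y \<in> cspace {..<l}"
    and GF: "\<And>z. z \<in> cspace {..<l} \<Longrightarrow> G (F z) = z"
    using assms(1) unfolding affine_cell_def by blast
  have "polyfn (\<lambda>z. f (F z) v)" "polyfn (\<lambda>z. G (g z) k)" for v k
    using polyfn_subst[OF f, of F] polyfn_subst[OF G, of g] F g by blast+
  then show ?thesis unfolding affine_cell_def
    by (intro exI[of _ "\<lambda>z. f (F z)"] exI[of _ "\<lambda>y. G (g y)"])
      (use V Gr GF assms in auto)
qed


subsection \<open>Dimension\<close>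

lemma alg_independent_transport:
  assumes "alg_isomorphic V W" "alg_independent V k p"
  shows "\<exists>q. alg_independent W k q"
proof -
  obtain f g where f: "f ` V \<subseteq> W" "\<And>x. x \<in> V \<Longrightarrow> g (f x) = x" and g: "poly_map_on W g"
    using assms(1) unfolding alg_isomorphic_def by blast
  obtain G where G: "\<And>w y. y \<in> W \<Longrightarrow> g y w = mpeval (G w) y"
    using g unfolding poly_map_on_def by metis
  have "polyfn (\<lambda>y. mpeval (p j) (\<lambda>w. mpeval (G w) y))" for j
    by (rule polyfn_subst) auto
  then obtain q where q: "\<And>j y. mpeval (p j) (\<lambda>w. mpeval (G w) y) = mpeval (q j) y"
    unfolding polyfn_def by metis
  have "mpeval (q j) (f x) = mpeval (p j) x" if "x \<in> V" for j x
  proof -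
    have "(\<lambda>w. mpeval (G w) (f x)) = x"
      using that f G[of "f x"] by (auto simp: fun_eq_iff image_subset_iff)
    then show ?thesis by (simp add: q[symmetric])
  qed
  then have "\<forall>x\<in>V. mpeval Q (\<lambda>j. mpeval (p j) x) = 0"
    if "\<forall>y\<in>W. mpeval Q (\<lambda>j. mpeval (q j) y) = 0" for Q
    using that f(1) by (force simp: image_subset_iff)
  then have "alg_independent W k q"
    using assms(2) unfolding alg_independent_def by blast
  then show ?thesis by blast
qed

lemma variety_dim_alg_isomorphic:
  assumes "alg_isomorphic V W" shows "variety_dim V = variety_dim W"
proof -
  have "(\<exists>p. alg_independent V k p) \<longleftrightarrow> (\<exists>p. alg_independent W k p)" for k
    using alg_independent_transport[OF assms] alg_independent_transport[OF alg_isomorphic_sym[OF assms]]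
    by blast
  then show ?thesis by (simp add: variety_dim_def)
qed

lemma digits_unique:
  fixes a b :: "nat \<Rightarrow> nat"
  assumes "(\<Sum>v<l. a v * B ^ v) = (\<Sum>v<l. b v * B ^ v)" "\<And>v. v < l \<Longrightarrow> a v < B" "\<And>v. v < l \<Longrightarrow> b v < B" "v < l"
  shows "a v = b v"
  using assms
proof (induction l arbitrary: a b v)
  case (Suc l)
  let ?s = "\<lambda>a. \<Sum>v<l. a (Suc v) * B ^ v"
  have *: "(\<Sum>v<Suc l. a v * B ^ v) = a 0 + B * ?s a" for a
    by (simp add: sum.lessThan_Suc_shift sum_distrib_left mult_ac del: sum.lessThan_Suc)
  have "(a 0 + B * ?s a) mod B = (b 0 + B * ?s b) mod B"
    using Suc.prems(1) by (simp only: *)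
  then have 0: "a 0 = b 0" using Suc.prems(2,3)[of 0] by simp
  moreover have "B > 0" using Suc.prems(2)[of 0] by simp
  ultimately have "?s a = ?s b" using Suc.prems(1) by (simp only: *) simp
  then have "a (Suc v) = b (Suc v)" if "v < l" for v
    using Suc.IH[of "\<lambda>v. a (Suc v)" "\<lambda>v. b (Suc v)" v] Suc.prems(2,3) that by simp
  with 0 show ?case using Suc.prems(4) by (cases v) auto
qed simp

text \<open>Kronecker's substitution \<open>x\<^sub>v = t ^ B ^ v\<close> separates the finitely many monomials of a
  polynomial, once \<open>B\<close> exceeds their exponents.\<close>

lemma mpeval_eq_0_imp_zero:
  fixes Q :: "nat mpoly"
  assumes "mpvars Q \<subseteq> {..<l}" and "\<And>x. x \<in> cspace {..<l} \<Longrightarrow> mpeval Q x = 0"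
  shows "Q = 0"
proof -
  have keys: "Poly_Mapping.keys k \<subseteq> {..<l}" if "k \<in> Poly_Mapping.keys Q" for k
    using assms(1) that by (auto simp: mpvars_def)
  define B where "B = Suc (\<Sum>k\<in>Poly_Mapping.keys Q. mdeg k)"
  have B: "Poly_Mapping.lookup k v < B" if "k \<in> Poly_Mapping.keys Q" for k v
  proof -
    have "mdeg k \<le> (\<Sum>k\<in>Poly_Mapping.keys Q. mdeg k)" using that by (intro member_le_sum) auto
    with lookup_le_mdeg[of k v] show ?thesis by (simp add: B_def)
  qed
  define N where "N k = (\<Sum>v<l. Poly_Mapping.lookup k v * B ^ v)" for k
  have inj: "inj_on N (Poly_Mapping.keys Q)"
  proof (rule inj_onI)
    fix k k' assume k: "k \<in> Poly_Mapping.keys Q" "k' \<in> Poly_Mapping.keys Q" "N k = N k'"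
    have "Poly_Mapping.lookup k v = Poly_Mapping.lookup k' v" for v
    proof (cases "v < l")
      case True
      then show ?thesis
        using digits_unique[of "Poly_Mapping.lookup k" B l "Poly_Mapping.lookup k'" v] k B by (simp add: N_def)
    next
      case False
      then show ?thesis using keys[OF k(1)] keys[OF k(2)] by (metis in_keys_iff lessThan_iff subsetD)
    qed
    then show "k = k'" by (rule poly_mapping_eqI)
  qed
  define q where "q = (\<Sum>k\<in>Poly_Mapping.keys Q. monom (Poly_Mapping.lookup Q k) (N k))"
  have "poly q t = 0" for t
  proof -
    define x where "x = (\<lambda>v. if v < l then t ^ B ^ v else 0)"
    have "mon k x = t ^ N k" if "k \<in> Poly_Mapping.keys Q" for k
      using keys[OF that]
      by (simp add: mon_superset[of "{..<l}"] x_def N_def power_sum mult.commute flip: power_mult)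
    then have "mpeval Q x = poly q t" by (simp add: mpeval_eq_mon q_def poly_sum poly_monom)
    moreover have "x \<in> cspace {..<l}" by (auto simp: x_def cspace_def)
    ultimately show ?thesis using assms(2) by simp
  qed
  then have "q = 0" using poly_all_0_iff_0 by blast
  have "Poly_Mapping.lookup Q k = 0" if "k \<in> Poly_Mapping.keys Q" for k
  proof -
    have "coeff q (N k) = (\<Sum>k'\<in>Poly_Mapping.keys Q. if k' = k then Poly_Mapping.lookup Q k' else 0)"
      unfolding q_def coeff_sum coeff_monom using inj that by (intro sum.cong) (auto dest: inj_onD)
    then show ?thesis using that \<open>q = 0\<close> by simp
  qed
  then show ?thesis by (metis in_keys_iff lookup_zero poly_mapping_eqI)
qed

lemma card_bounded_monomials:
  "finite {k :: 'v mono. Poly_Mapping.keys k \<subseteq> I \<and> mdeg k \<le> d}"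
  "card {k :: 'v mono. Poly_Mapping.keys k \<subseteq> I \<and> mdeg k \<le> d} \<le> Suc d ^ card I"
  if "finite I"
proof -
  let ?A = "{k :: 'v mono. Poly_Mapping.keys k \<subseteq> I \<and> mdeg k \<le> d}" and ?P = "PiE I (\<lambda>_. {..d})"
  let ?f = "\<lambda>k :: 'v mono. restrict (Poly_Mapping.lookup k) I"
  have sub: "?f ` ?A \<subseteq> ?P" by (auto intro: order_trans[OF lookup_le_mdeg])
  have inj: "inj_on ?f ?A"
  proof (rule inj_onI)
    fix k k' assume k: "k \<in> ?A" "k' \<in> ?A" "?f k = ?f k'"
    show "k = k'"
    proof (rule poly_mapping_eqI)
      fix v show "Poly_Mapping.lookup k v = Poly_Mapping.lookup k' v"
      proof (cases "v \<in> I")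
        case True then show ?thesis using k(3) by (metis restrict_apply')
      next
        case False then show ?thesis using k(1,2) by (metis (mono_tags, lifting) in_keys_iff mem_Collect_eq subsetD)
      qed
    qed
  qed
  have fin: "finite ?P" using that by (intro finite_PiE) auto
  show "finite ?A" using finite_imageD[OF finite_subset[OF sub fin] inj] .
  show "card ?A \<le> Suc d ^ card I"
    using card_inj_on_le[OF inj sub fin] that by (simp add: card_PiE)
qed

text \<open>The functions are indexed by \<open>E\<close> because two indices may carry the same function; then the
  difference of the two is already a relation.\<close>

lemma exists_linear_relation:
  fixes f :: "'e \<Rightarrow> 'x \<Rightarrow> complex"
  assumes "finite E" "finite B" "f ` E \<subseteq> cfun.span B" "card B < card E"
  shows "\<exists>c. (\<exists>e\<in>E. c e \<noteq> 0) \<and> (\<forall>x. (\<Sum>e\<in>E. c e * f e x) = 0)"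
proof (cases "inj_on f E")
  case True
  have "cfun.dependent (f ` E)"
    using cfun.independent_span_bound[of B "f ` E"] assms card_image[OF True] by force
  then obtain u where u: "\<exists>v\<in>f ` E. u v \<noteq> 0" "(\<Sum>v\<in>f ` E. cscale (u v) v) = 0"
    using cfun.dependent_finite[of "f ` E"] assms by auto
  have "(\<Sum>e\<in>E. cscale (u (f e)) (f e)) x = 0" for x
    using u(2) by (simp add: sum.reindex[OF True])
  moreover have "(\<Sum>e\<in>E. cscale (u (f e)) (f e)) x = (\<Sum>e\<in>E. u (f e) * f e x)" for x
    by (induction E rule: infinite_finite_induct) (auto simp: cscale_def)
  ultimately show ?thesis using u(1) by (intro exI[of _ "\<lambda>e. u (f e)"]) auto
next
  case False
  then obtain a b where ab: "a \<in> E" "b \<in> E" "a \<noteq> b" "f a = f b" by (auto simp: inj_on_def)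
  let ?c = "\<lambda>e. if e = a then 1 else if e = b then -1 else 0 :: complex"
  have "(\<Sum>e\<in>E. ?c e * f e x) = (\<Sum>e\<in>{a, b}. ?c e * f e x)" for x
    by (rule sum.mono_neutral_right) (use ab assms in auto)
  then show ?thesis using ab by (intro exI[of _ ?c]) auto
qed

text \<open>More than \<open>l\<close> polynomials in \<open>l\<close> variables are algebraically dependent, by counting: the
  \<open>n ^ k\<close> power products of \<open>k > l\<close> polynomials with exponents below \<open>n\<close> lie in the span of
  \<open>O(n ^ l)\<close> monomials.\<close>

lemma alg_independent_cspace_le:
  assumes "alg_independent (cspace {..<l}) k p"
  shows "k \<le> l"
proof (rule ccontr)
  assume "\<not> k \<le> l"
  then have kl: "Suc l \<le> k" by simp
  define D where "D = (\<Sum>j<k. \<Sum>e\<in>Poly_Mapping.keys (p j). mdeg e)"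
  have pD: "pdeg D (mpeval (p j))" if "j < k" for j
  proof -
    have "mdeg e \<le> D" if e: "e \<in> Poly_Mapping.keys (p j)" for e
    proof -
      have "mdeg e \<le> (\<Sum>e\<in>Poly_Mapping.keys (p j). mdeg e)" using e by (intro member_le_sum) auto
      also have "\<dots> \<le> D" unfolding D_def
        by (rule member_le_sum[of j "{..<k}" "\<lambda>j. \<Sum>e\<in>Poly_Mapping.keys (p j). mdeg e"])
          (use \<open>j < k\<close> in auto)
      finally show ?thesis .
    qed
    then show ?thesis by (auto simp: pdeg_def)
  qed
  \<comment> \<open>This \<open>n\<close> makes \<open>n ^ (l + 1)\<close> larger than \<open>(k * D * n + 1) ^ l\<close>, a bound for the number of
    monomials of degree at most \<open>k * D * n\<close>.\<close>
  define n where "n = Suc ((k * D + 1) ^ l)"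
  define M where "M a = (\<Sum>j<k. Poly_Mapping.single j (a j))" for a :: "nat \<Rightarrow> nat"
  have M: "Poly_Mapping.lookup (M a) j = (if j < k then a j else 0)" for a j
    by (simp add: M_def lookup_sum lookup_single when_def)
  define P where "P = PiE {..<k} (\<lambda>_. {..<n})"
  define E where "E = M ` P"
  have "inj_on M P"
  proof (rule inj_onI)
    fix a b assume ab: "a \<in> P" "b \<in> P" "M a = M b"
    then have "a j = b j" if "j < k" for j using M[of a j] M[of b j] that by simp
    then show "a = b" using ab(1,2) unfolding P_def by (intro PiE_ext[of a _ _ b]) auto
  qed
  then have cardE: "card E = n ^ k" by (simp add: E_def P_def card_image card_PiE)
  have "finite P" unfolding P_def by (intro finite_PiE) auto
  then have finE: "finite E" by (simp add: E_def)
  define d where "d = k * D * n"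
  define B where "B = mon ` {e :: nat mono. Poly_Mapping.keys e \<subseteq> {..<l} \<and> mdeg e \<le> d}"
  have finB: "finite B" unfolding B_def by (simp add: card_bounded_monomials)
  have "card B \<le> Suc d ^ l" unfolding B_def
    by (rule order_trans[OF card_image_le]) (use card_bounded_monomials[of "{..<l}" d] in simp_all)
  also have "\<dots> \<le> ((k * D + 1) * n) ^ l"
    by (rule power_mono) (auto simp: d_def n_def algebra_simps)
  also have "\<dots> < n * n ^ l"
    unfolding power_mult_distrib by (rule mult_strict_right_mono) (auto simp: n_def)
  also have "\<dots> \<le> n ^ k" using power_increasing[OF kl, of n] by (simp add: n_def)
  finally have card: "card B < card E" by (simp add: cardE)
  define f where "f e = (\<lambda>x. mon e (\<lambda>j. mpeval (p j) (restr {..<l} x)))" for e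
  \<comment> \<open>Only the values on \<open>\<complex>\<^sup>l\<close> matter; restricting the argument turns monomials in other
    variables into zero.\<close>
  have span: "(\<lambda>x. g (restr {..<l} x)) \<in> cfun.span B" if g: "pdeg d g" for g
  proof -
    obtain q where q: "\<And>k. k \<in> Poly_Mapping.keys q \<Longrightarrow> mdeg k \<le> d" "\<And>x. g x = mpeval q x"
      using g unfolding pdeg_def by blast
    let ?K = "{e \<in> Poly_Mapping.keys q. Poly_Mapping.keys e \<subseteq> {..<l}}"
    have mon: "mon e (restr {..<l} x) = (if Poly_Mapping.keys e \<subseteq> {..<l} then mon e x else 0)" for e x
    proof (cases "Poly_Mapping.keys e \<subseteq> {..<l}")
      case True then show ?thesis by (auto simp: mon_def restr_def intro!: prod.cong)
    next
      case False
      then obtain v where "v \<in> Poly_Mapping.keys e" "\<not> v < l" by auto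
      then show ?thesis using False unfolding mon_def restr_def
        by (auto simp: in_keys_iff intro!: prod_zero bexI[of _ v])
    qed
    have "g (restr {..<l} x) = (\<Sum>e\<in>?K. cscale (Poly_Mapping.lookup q e) (mon e)) x" for x
    proof -
      have "(\<Sum>e\<in>A. cscale (Poly_Mapping.lookup q e) (mon e)) x = (\<Sum>e\<in>A. Poly_Mapping.lookup q e * mon e x)" for A
        by (induction A rule: infinite_finite_induct) (auto simp: cscale_def)
      moreover have "g (restr {..<l} x) = (\<Sum>e\<in>?K. Poly_Mapping.lookup q e * mon e x)"
        unfolding q mpeval_eq_mon mon by (rule sum.mono_neutral_cong_right) auto
      ultimately show ?thesis by simp
    qed
    then have "(\<lambda>x. g (restr {..<l} x)) = (\<Sum>e\<in>?K. cscale (Poly_Mapping.lookup q e) (mon e))" by auto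
    also have "\<dots> \<in> cfun.span B"
      by (intro cfun.span_sum cfun.span_scale cfun.span_base) (auto simp: B_def q)
    finally show ?thesis .
  qed
  have "f e \<in> cfun.span B" if "e \<in> E" for e
  proof -
    have keys: "Poly_Mapping.keys e \<subseteq> {..<k}" and small: "\<And>j. Poly_Mapping.lookup e j \<le> n"
      using that M by (auto simp: E_def P_def in_keys_iff PiE_def Pi_def split: if_splits intro: less_imp_le)
    have pow: "pdeg (D * i) (\<lambda>x. mpeval (p j) x ^ i)" if "j < k" for i j
      by (induction i) (auto intro: pdeg_const pdeg_mult' pD[OF that])
    have "pdeg (m * (D * n)) (\<lambda>x. \<Prod>j<m. mpeval (p j) x ^ Poly_Mapping.lookup e j)" if "m \<le> k" for m
      using that
    proof (induction m)
      case (Suc m)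
      have "pdeg (D * n) (\<lambda>x. mpeval (p m) x ^ Poly_Mapping.lookup e m)"
        by (rule pdeg_mono[OF pow]) (use Suc.prems small in auto)
      with Suc show ?case by (auto intro!: pdeg_mult')
    qed (simp add: pdeg_const)
    from this[of k] have "pdeg d (\<lambda>x. mon e (\<lambda>j. mpeval (p j) x))"
      by (simp add: mon_superset[OF _ keys] d_def mult.assoc)
    from span[OF this] show ?thesis by (simp add: f_def)
  qed
  then obtain c where c: "\<exists>e\<in>E. c e \<noteq> 0" "\<And>x. (\<Sum>e\<in>E. c e * f e x) = 0"
    using exists_linear_relation[OF finE finB _ card, of f] by blast
  define Q where "Q = (\<Sum>e\<in>E. Poly_Mapping.single e (c e))"
  have Q: "Poly_Mapping.lookup Q e = (if e \<in> E then c e else 0)" for e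
    using finE by (simp add: Q_def lookup_sum lookup_single when_def)
  have "mpvars Q \<subseteq> {..<k}"
    using M by (auto simp: mpvars_def in_keys_iff Q E_def split: if_splits)
  moreover have "mpeval Q (\<lambda>j. mpeval (p j) x) = 0" if "x \<in> cspace {..<l}" for x
    using c(2)[of x] that by (simp add: Q_def mpeval_sum f_def restr_cspace)
  ultimately have "Q = 0" using assms by (auto simp: alg_independent_def)
  then show False using c(1) Q by (metis lookup_zero)
qed

lemma variety_dim_cspace: "variety_dim (cspace {..<l}) = l"
  unfolding variety_dim_def
proof (rule cSup_eq_maximum)
  have "alg_independent (cspace {..<l}) l (\<lambda>j. Poly_Mapping.single (Poly_Mapping.single j 1) 1)"
    unfolding alg_independent_def by (auto intro: mpeval_eq_0_imp_zero)
  then show "l \<in> {k. \<exists>p. alg_independent (cspace {..<l}) k p}" by blast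
qed (auto dest: alg_independent_cspace_le)

lemma affine_cell_dim: "affine_cell I V l \<Longrightarrow> variety_dim V = l"
  using affine_cell_alg_isomorphic variety_dim_alg_isomorphic variety_dim_cspace by metis

lemma affine_cell_cspace:
  assumes "finite I" shows "affine_cell I (cspace I) (card I)"
proof -
  obtain h where h: "bij_betw h {..<card I} I"
    using ex_bij_betw_nat_finite[OF assms] by (auto simp: atLeast0LessThan)
  define F where "F z = (\<lambda>v. if v \<in> I then z (inv_into {..<card I} h v) else 0)" for z :: "nat \<Rightarrow> complex"
  define G where "G y = (\<lambda>k. if k < card I then y (h k) else 0)" for y :: "'a \<Rightarrow> complex"
  have "F (G y) = y" if "y \<in> cspace I" for y
    using that h bij_betw_inv_into_right[OF h] bij_betwE[OF bij_betw_inv_into[OF h]]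
    by (auto simp: F_def G_def cspace_def fun_eq_iff)
  moreover have "G (F z) = z" if "z \<in> cspace {..<card I}" for z
    using that bij_betw_inv_into_left[OF h] bij_betwE[OF h]
    by (auto simp: F_def G_def cspace_def fun_eq_iff)
  moreover have "F z \<in> cspace I" "G y \<in> cspace {..<card I}" for z y
    by (auto simp: F_def G_def cspace_def)
  moreover from calculation have "F ` cspace {..<card I} = cspace I"
    by (metis (no_types, lifting) image_subset_iff subsetI subset_antisym image_eqI)
  ultimately show ?thesis unfolding affine_cell_def
    by (intro exI[of _ F] exI[of _ G]) (auto simp: F_def G_def)
qed

lemma dim_cspace: "cfun.dim (cspace {..<l}) = l" and subspace_cspace: "cfun.subspace (cspace I)"
proof -
  show sub: "cfun.subspace (cspace I)" for I :: "'b set"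
    by (rule cfun.subspaceI) (auto simp: cspace_def cscale_def)
  define e where "e k = (\<lambda>v. if v = k then 1 else 0 :: complex)" for k :: nat
  have sum: "(\<Sum>k\<in>A. cscale (u k) (e k)) v = (if v \<in> A then u v else 0)" if "finite A" for A u v
    using that by (induction A) (auto simp: cscale_def e_def)
  have inj: "inj_on e {..<l}" by (rule inj_onI) (metis e_def zero_neq_one)
  have "cfun.independent (e ` {..<l})"
  proof -
    have "u v = 0" if "(\<Sum>v\<in>e ` {..<l}. cscale (u v) v) = 0" "v \<in> e ` {..<l}" for u v
    proof -
      have "(\<Sum>k<l. cscale (u (e k)) (e k)) = 0" using that(1) by (simp add: sum.reindex[OF inj])
      then show ?thesis using that(2) sum[of "{..<l}" "\<lambda>k. u (e k)"] by (auto simp: fun_eq_iff) (metis lessThan_iff zero_fun_apply)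
    qed
    then show ?thesis by (auto simp: cfun.dependent_finite)
  qed
  moreover have "cspace {..<l} \<subseteq> cfun.span (e ` {..<l})"
  proof
    fix x assume "x \<in> cspace {..<l}"
    then have "x = (\<Sum>k<l. cscale (x k) (e k))" by (auto simp: fun_eq_iff sum cspace_def)
    also have "\<dots> \<in> cfun.span (e ` {..<l})"
      by (intro cfun.span_sum cfun.span_scale cfun.span_base) auto
    finally show "x \<in> cfun.span (e ` {..<l})" .
  qed
  moreover have "e ` {..<l} \<subseteq> cspace {..<l}" by (auto simp: e_def cspace_def)
  ultimately show "cfun.dim (cspace {..<l}) = l"
    using cfun.dim_eq_card[of "e ` {..<l}" "cspace {..<l}"] card_image[OF inj]
      cfun.span_minimal[OF _ sub] cfun.span_eq_iff[of "cspace {..<l}"] sub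
    by (metis card_lessThan subset_antisym)
qed

global_interpretation cfun_pair: vector_space_pair cscale cscale
  by unfold_locales

lemma linear_cscaleI:
  assumes "\<And>x y. L (x + y) = L x + L y" "\<And>c x. L (cscale c x) = cscale c (L x)"
  shows "Vector_Spaces.linear cscale cscale L"
  by unfold_locales (use assms in auto)

lemma dim_image_inj:
  assumes L: "Vector_Spaces.linear cscale cscale L" and inj: "inj_on L S" and S: "cfun.subspace S"
  shows "cfun.dim (L ` S) = cfun.dim S"
proof -
  obtain B where B: "B \<subseteq> S" "cfun.independent B" "S \<subseteq> cfun.span B" "card B = cfun.dim S"
    using cfun.basis_exists[of S] by blast
  have span: "cfun.span B = S" using B S by (metis cfun.span_minimal subset_antisym)
  have "cfun.independent (L ` B)"
    using cfun_pair.linear_independent_injective_image[OF L B(2)] inj span by simp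
  moreover have "cfun.span (L ` B) = L ` S"
    using cfun_pair.linear_span_image[OF L] span by metis
  ultimately have "cfun.dim (L ` S) = card (L ` B)"
    by (metis cfun.dim_eq_card_independent cfun.dim_span)
  then show ?thesis using B card_image[of L B] inj inj_on_subset by metis
qed

text \<open>The differentials of the embedding and of its polynomial left inverse identify the tangent
  space with the space of parameters.\<close>

lemma affine_cell_nonsingular:
  assumes "affine_cell I V l" shows "nonsingular I V"
proof -
  obtain F G where F: "\<And>v. polyfn (\<lambda>z. F z v)" and G: "\<And>k. polyfn (\<lambda>y. G y k)"
    and V: "F ` cspace {..<l} = V" "V \<subseteq> cspace I" and Gr: "\<And>y. G y \<in> cspace {..<l}"
    and GF: "\<And>z. z \<in> cspace {..<l} \<Longrightarrow> G (F z) = z"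
    using assms unfolding affine_cell_def by blast
  have "cfun.dim (tangent_space I V x) = l" if "x \<in> V" for x
  proof -
    obtain a where a: "a \<in> cspace {..<l}" "x = F a" using \<open>x \<in> V\<close> V by blast
    define dF where "dF w = (\<lambda>v. dirder (\<lambda>z. F z v) a w)" for w
    define dG where "dG u = (\<lambda>k. dirder (\<lambda>y. G y k) x u)" for u
    have line: "((\<lambda>t. x v + t * u v) has_field_derivative u v) (at 0)" for x u :: "'w \<Rightarrow> complex" and v
      by (auto intro!: derivative_eq_intros)
    have dF: "((\<lambda>t. F (\<lambda>v. a v + t * w v) v) has_field_derivative dF w v) (at 0)" for w v
      unfolding dF_def by (rule polyfn_chain_rule[OF F line]) simp
    have dG: "((\<lambda>t. G (\<lambda>v. x v + t * u v) k) has_field_derivative dG u k) (at 0)" for u k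
      unfolding dG_def by (rule polyfn_chain_rule[OF G line]) simp
    have cs: "(\<lambda>v. a v + t * w v) \<in> cspace {..<l}" if "w \<in> cspace {..<l}" for w t
      using a that by (auto simp: cspace_def)
    have dG_cs: "dG u \<in> cspace {..<l}" for u
      using Gr by (auto simp: dG_def dirder_def cspace_def)
    have dF_cs: "dF w \<in> cspace I" if "w \<in> cspace {..<l}" for w
    proof -
      have "F (\<lambda>v. a v + t * w v) v = 0" if "v \<notin> I" for t v
        using cs[OF \<open>w \<in> cspace {..<l}\<close>, of t] V that by (auto simp: cspace_def image_subset_iff)
      then show ?thesis by (auto simp: dF_def dirder_def cspace_def)
    qed
    have dGdF: "dG (dF w) = w" if "w \<in> cspace {..<l}" for w
    proof
      fix k
      have "((\<lambda>t. G (F (\<lambda>v. a v + t * w v)) k) has_field_derivative dG (dF w) k) (at 0)"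
        unfolding dG_def by (rule polyfn_chain_rule[OF G dF]) (simp add: a)
      moreover have "((\<lambda>t. G (F (\<lambda>v. a v + t * w v)) k) has_field_derivative w k) (at 0)"
        unfolding GF[OF cs[OF that]] by (rule line)
      ultimately show "dG (dF w) k = w k" by (rule DERIV_unique)
    qed
    have "tangent_space I V x = dF ` cspace {..<l}"
    proof (intro equalityI subsetI)
      fix u assume u: "u \<in> tangent_space I V x"
      have "u v = dF (dG u) v" for v
      proof -
        have "polyfn (\<lambda>y. y v - F (G y) v)" by (intro polyfn_diff polyfn_coord polyfn_subst[OF F] G)
        then obtain p where p: "\<And>y. y v - F (G y) v = mpeval p y" by (auto simp: polyfn_def)
        have "\<forall>y\<in>V. mpeval p y = 0" using V GF by (auto simp: p[symmetric])
        then have "deriv (\<lambda>t. mpeval p (\<lambda>v. x v + t * u v)) 0 = 0"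
          using u unfolding tangent_space_def by blast
        moreover have "((\<lambda>t. mpeval p (\<lambda>v. x v + t * u v)) has_field_derivative (u v - dF (dG u) v)) (at 0)"
          unfolding p[symmetric] dF_def
          by (intro DERIV_diff line polyfn_chain_rule[OF F] dG) (simp add: GF a)
        ultimately show ?thesis using DERIV_imp_deriv by fastforce
      qed
      then have "u = dF (dG u)" by (rule ext)
      then show "u \<in> dF ` cspace {..<l}" using dG_cs by (rule image_eqI)
    next
      fix u assume "u \<in> dF ` cspace {..<l}"
      then obtain w where w: "w \<in> cspace {..<l}" "u = dF w" by blast
      have "deriv (\<lambda>t. mpeval p (\<lambda>v. x v + t * u v)) 0 = 0" if "\<forall>y\<in>V. mpeval p y = 0" for p
      proof -
        have "((\<lambda>t. mpeval p (F (\<lambda>v. a v + t * w v))) has_field_derivative dirder (mpeval p) x u) (at 0)"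
          unfolding w(2) by (rule polyfn_chain_rule[OF polyfn_mpeval dF]) (simp add: a)
        moreover have "mpeval p (F (\<lambda>v. a v + t * w v)) = 0" for t
          using that V cs[OF w(1)] by blast
        ultimately show ?thesis unfolding dirder_def[symmetric] by (simp add: DERIV_unique[OF _ DERIV_const])
      qed
      then show "u \<in> tangent_space I V x" using w dF_cs by (auto simp: tangent_space_def)
    qed
    moreover have "Vector_Spaces.linear cscale cscale dF"
      by (rule linear_cscaleI)
        (auto simp: dF_def cscale_def fun_eq_iff plus_fun_def dirder_add[OF F] dirder_scale[OF F])
    moreover have "inj_on dF (cspace {..<l})" by (intro inj_on_inverseI[of _ dG]) (rule dGdF)
    ultimately show ?thesis by (simp add: dim_image_inj subspace_cspace dim_cspace)
  qed
  then show ?thesis by (simp add: nonsingular_def affine_cell_dim[OF assms])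
qed


section \<open>Substitution of formal power series\<close>

lemmas mcoeff_simps [simp] = zero_mfps.rep_eq one_mfps.rep_eq plus_mfps.rep_eq minus_mfps.rep_eq
  uminus_mfps.rep_eq mX.rep_eq Abs_mfps_inverse[OF UNIV_I]

lemma mcoeff_sum [simp]: "mcoeff (\<Sum>i\<in>A. f i) a = (\<Sum>i\<in>A. mcoeff (f i) a)"
  by (induction A rule: infinite_finite_induct) simp_all

lemma mcoeff_mult: "mcoeff (f * g) a = (\<Sum>(b, c)\<in>splits a. mcoeff f b * mcoeff g c)"
  by (simp add: times_mfps.rep_eq)

lemma single_neq_0 [simp]: "Poly_Mapping.single i (Suc 0) \<noteq> 0" "0 \<noteq> Poly_Mapping.single i (Suc 0)"
  by (metis lookup_single_eq lookup_zero nat.distinct(1))+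

lemma single_Suc_0_eq_iff [simp]:
  "Poly_Mapping.single i (Suc 0) = Poly_Mapping.single j (Suc 0) \<longleftrightarrow> i = j"
  by (metis lookup_single_eq lookup_single_not_eq nat.distinct(1))

lemma mono_cases:
  fixes b :: "'n mono"
  obtains "b = 0" | i c where "b = Poly_Mapping.single i 1 + c"
proof (cases "b = 0")
  case False
  then obtain i where i: "Poly_Mapping.lookup b i \<noteq> 0"
    by (metis lookup_zero poly_mapping_eqI)
  have "b = Poly_Mapping.single i 1 + (b - Poly_Mapping.single i 1)"
    by (rule poly_mapping_eqI) (use i in \<open>auto simp: lookup_add lookup_minus lookup_single when_def\<close>)
  then show ?thesis by (rule that(2))
qed (rule that(1))

lemma mono_induct [case_names zero add]:
  fixes b :: "'n mono"
  assumes "P 0" and "\<And>i b. P b \<Longrightarrow> P (Poly_Mapping.single i 1 + b)"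
  shows "P b"
proof (induction "mdeg b" arbitrary: b rule: less_induct)
  case less
  show ?case
  proof (cases b rule: mono_cases)
    case (2 i c)
    then have "P c" by (intro less) simp
    with 2 assms(2) show ?thesis by simp
  qed (use assms(1) in simp)
qed

lemma mdeg_eq_1_iff: "mdeg a = Suc 0 \<longleftrightarrow> (\<exists>j. a = Poly_Mapping.single j 1)"
proof
  assume "mdeg a = Suc 0"
  then show "\<exists>j. a = Poly_Mapping.single j 1"
    by (cases a rule: mono_cases) (auto simp: mdeg_eq_0_iff)
qed auto

definition const_series :: "complex \<Rightarrow> 'n::finite mfps" where
  "const_series c = Abs_mfps (\<lambda>a. if a = 0 then c else 0)"

lemma mcoeff_const_mult [simp]: "mcoeff (const_series c * p) a = c * mcoeff p a"
proof -
  have "mcoeff (const_series c * p) a = (\<Sum>x\<in>splits a. if x = (0, a) then c * mcoeff p a else 0)"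
    unfolding mcoeff_mult const_series_def by (rule sum.cong) (auto simp: splits_def split: if_splits)
  then show ?thesis by simp
qed

definition ordge :: "nat \<Rightarrow> 'n::finite mfps \<Rightarrow> bool" where
  "ordge k p \<longleftrightarrow> (\<forall>a. mdeg a < k \<longrightarrow> mcoeff p a = 0)"

lemma ordge_0 [simp]: "ordge 0 p"
  by (simp add: ordge_def)

lemma ordge_zero [simp]: "ordge k 0"
  by (simp add: ordge_def)

lemma ordge_mono: "ordge k p \<Longrightarrow> l \<le> k \<Longrightarrow> ordge l p"
  by (auto simp: ordge_def)

lemma ordge_add: "ordge k p \<Longrightarrow> ordge k q \<Longrightarrow> ordge k (p + q)"
  by (auto simp: ordge_def)

lemma ordge_diff: "ordge k p \<Longrightarrow> ordge k q \<Longrightarrow> ordge k (p - q)"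
  by (auto simp: ordge_def)

lemma ordge_mult:
  assumes "ordge k p" "ordge l q" shows "ordge (k + l) (p * q)"
  unfolding ordge_def
proof (intro allI impI)
  fix a :: "'a mono" assume a: "mdeg a < k + l"
  have "mcoeff p b * mcoeff q c = 0" if "b + c = a" for b c
  proof -
    have "mdeg b + mdeg c = mdeg a" using that by auto
    then have "mdeg b < k \<or> mdeg c < l" using a by linarith
    then show ?thesis using assms by (auto simp: ordge_def)
  qed
  then show "mcoeff (p * q) a = 0" by (auto simp: mcoeff_mult intro!: sum.neutral)
qed

lemma all_ordge_imp_eq: "(\<And>k. ordge k (p - q)) \<Longrightarrow> p = q"
  by (rule mfps_eqI) (metis eq_iff_diff_eq_0 lessI minus_mfps.rep_eq ordge_def)

definition no_const :: "'n::finite fmap \<Rightarrow> bool" where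
  "no_const G \<longleftrightarrow> (\<forall>i. mcoeff (G i) 0 = 0)"

lemma no_const_iff: "no_const G \<longleftrightarrow> (\<forall>i. ordge 1 (G i))"
  by (auto simp: no_const_def ordge_def mdeg_eq_0_iff)

lemma no_const_mX [simp]: "no_const mX"
  by (simp add: no_const_def)

definition mpw :: "'n::finite fmap \<Rightarrow> 'n mono \<Rightarrow> 'n mfps" where
  "mpw G b = (\<Prod>i\<in>UNIV. G i ^ Poly_Mapping.lookup b i)"

lemma mpw_0 [simp]: "mpw G 0 = 1"
  by (simp add: mpw_def)

lemma mpw_add: "mpw G (b + c) = mpw G b * mpw G c"
  by (simp add: mpw_def lookup_add power_add prod.distrib)

lemma mpw_single [simp]: "mpw G (Poly_Mapping.single i (Suc 0)) = G i"
proof -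
  have "mpw G (Poly_Mapping.single i 1) = (\<Prod>j\<in>UNIV. if j = i then G i else 1)"
    unfolding mpw_def by (rule prod.cong) (auto simp: lookup_single when_def)
  then show ?thesis by simp
qed

lemma ordge_mpw: "no_const G \<Longrightarrow> ordge (mdeg b) (mpw G b)"
proof (induction b rule: mono_induct)
  case (add i b)
  then show ?case using ordge_mult[of 1 "G i" "mdeg b" "mpw G b"] by (simp add: mpw_add no_const_iff)
qed simp

lemma mcoeff_mpw_zero: "no_const G \<Longrightarrow> mdeg a < mdeg b \<Longrightarrow> mcoeff (mpw G b) a = 0"
  using ordge_mpw by (auto simp: ordge_def)

lemma mcoeff_msubst:
  "mcoeff (msubst p G) a = (\<Sum>b | mdeg b \<le> mdeg a. mcoeff p b * mcoeff (mpw G b) a)"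
  by (simp add: msubst.rep_eq mpw_def)

lemma mcoeff_msubst_ge:
  assumes "no_const G" "mdeg a \<le> M"
  shows "mcoeff (msubst p G) a = (\<Sum>b | mdeg b \<le> M. mcoeff p b * mcoeff (mpw G b) a)"
  unfolding mcoeff_msubst
  by (rule sum.mono_neutral_left) (use assms in \<open>auto simp: finite_mdeg_le mcoeff_mpw_zero\<close>)

lemma msubst_zero [simp]: "msubst 0 G = 0"
  by (rule mfps_eqI) (simp add: mcoeff_msubst)

lemma msubst_add: "msubst (p + q) G = msubst p G + msubst q G"
  by (rule mfps_eqI) (simp add: mcoeff_msubst distrib_right sum.distrib)

lemma msubst_diff: "msubst (p - q) G = msubst p G - msubst q G"
  by (rule mfps_eqI) (simp add: mcoeff_msubst left_diff_distrib sum_subtractf)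

lemma msubst_sum: "msubst (\<Sum>i\<in>A. p i) G = (\<Sum>i\<in>A. msubst (p i) G)"
  by (induction A rule: infinite_finite_induct) (simp_all add: msubst_add)

lemma msubst_const_mult: "msubst (const_series c * p) G = const_series c * msubst p G"
  by (rule mfps_eqI) (simp add: mcoeff_msubst sum_distrib_left mult.assoc)

lemma ordge_msubst:
  assumes "ordge k p" "no_const G" shows "ordge k (msubst p G)"
  using assms by (auto simp: ordge_def mcoeff_msubst)

lemma msubst_one [simp]: "msubst 1 G = 1"
proof (rule mfps_eqI)
  fix a :: "'a mono"
  have "mcoeff (msubst 1 G) a = (\<Sum>b::'a mono | mdeg b \<le> mdeg a. if b = 0 then mcoeff 1 a else 0)"
    unfolding mcoeff_msubst by (rule sum.cong) auto
  then show "mcoeff (msubst 1 G) a = mcoeff 1 a"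
    by (simp add: finite_mdeg_le)
qed

lemma msubst_mX:
  assumes "no_const G" shows "msubst (mX i) G = G i"
proof (rule mfps_eqI)
  fix a :: "'a mono"
  let ?e = "Poly_Mapping.single i (1 :: nat)"
  have "mcoeff (msubst (mX i) G) a = (\<Sum>b | mdeg b \<le> Suc (mdeg a). mcoeff (mX i) b * mcoeff (mpw G b) a)"
    by (rule mcoeff_msubst_ge[OF assms]) simp
  also have "\<dots> = (\<Sum>b | mdeg b \<le> Suc (mdeg a). if b = ?e then mcoeff (G i) a else 0)"
    by (rule sum.cong) auto
  also have "\<dots> = mcoeff (G i) a" by (simp add: finite_mdeg_le)
  finally show "mcoeff (msubst (mX i) G) a = mcoeff (G i) a" .
qed

text \<open>A power product of maps without constant term starts in its own degree, so the sum over the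
  exponents that contribute to a coefficient may be enlarged to a full rectangle, where it
  factors.\<close>

lemma msubst_mult:
  assumes "no_const G" shows "msubst (p * q) G = msubst p G * msubst q G"
proof (rule mfps_eqI)
  fix a :: "'a mono"
  let ?M = "mdeg a"
  let ?B = "{b :: 'a mono. mdeg b \<le> ?M}"
  define T where "T c d = mcoeff p c * mcoeff q d * mcoeff (mpw G (c + d)) a" for c d
  have fin: "finite ?B" by (rule finite_mdeg_le)
  have van: "mdeg c + mdeg d \<le> ?M" if "T c d \<noteq> 0" for c d
    using mcoeff_mpw_zero[OF assms, of a "c + d"] that by (fastforce simp: T_def)
  have "mcoeff (msubst (p * q) G) a = (\<Sum>b\<in>?B. \<Sum>(c, d)\<in>splits b. T c d)"
    unfolding mcoeff_msubst mcoeff_mult sum_distrib_right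
    by (intro sum.cong) (auto simp: T_def)
  also have "\<dots> = (\<Sum>(b, c, d)\<in>Sigma ?B splits. T c d)"
    by (subst sum.Sigma) (auto simp: fin)
  also have "\<dots> = (\<Sum>(c, d)\<in>{(c, d). mdeg c + mdeg d \<le> ?M}. T c d)"
    by (rule sum.reindex_bij_witness[where j = snd and i = "\<lambda>(c, d). (c + d, c, d)"]) auto
  also have "\<dots> = (\<Sum>(c, d)\<in>?B \<times> ?B. T c d)"
    by (rule sum.mono_neutral_left) (auto simp: fin dest: van)
  also have "\<dots> = (\<Sum>c\<in>?B. \<Sum>d\<in>?B. \<Sum>(x, y)\<in>splits a.
      (mcoeff p c * mcoeff (mpw G c) x) * (mcoeff q d * mcoeff (mpw G d) y))"
    unfolding sum.cartesian_product[symmetric] T_def mpw_add mcoeff_mult sum_distrib_left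
    by (intro sum.cong refl) auto
  also have "\<dots> = (\<Sum>(x, y)\<in>splits a. \<Sum>c\<in>?B. \<Sum>d\<in>?B.
      (mcoeff p c * mcoeff (mpw G c) x) * (mcoeff q d * mcoeff (mpw G d) y))"
    unfolding case_prod_unfold by (subst (2) sum.swap, subst sum.swap) (rule refl)
  also have "\<dots> = (\<Sum>(x, y)\<in>splits a. mcoeff (msubst p G) x * mcoeff (msubst q G) y)"
  proof (intro sum.cong refl, clarsimp)
    fix x y :: "'a mono" assume "a = x + y"
    then have "mdeg x \<le> ?M" "mdeg y \<le> ?M" by auto
    then show "(\<Sum>c\<in>{b. mdeg b \<le> mdeg x + mdeg y}. \<Sum>d\<in>{b. mdeg b \<le> mdeg x + mdeg y}.
        (mcoeff p c * mcoeff (mpw G c) x) * (mcoeff q d * mcoeff (mpw G d) y))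
      = mcoeff (msubst p G) x * mcoeff (msubst q G) y"
      by (simp add: sum_product mcoeff_msubst_ge[OF assms, where M = "mdeg x + mdeg y"])
  qed
  finally show "mcoeff (msubst (p * q) G) a = mcoeff (msubst p G * msubst q G) a"
    by (simp add: mcoeff_mult)
qed

lemma mpw_mX: "mpw mX b = Abs_mfps (\<lambda>a. if a = b then 1 else 0)"
proof (induction b rule: mono_induct)
  case zero show ?case by (rule mfps_eqI) simp
next
  case (add i b)
  show ?case
  proof (rule mfps_eqI)
    fix a
    let ?e = "Poly_Mapping.single i (1 :: nat)"
    have "mcoeff (mpw mX (?e + b)) a = (\<Sum>x\<in>splits a. if x = (?e, b) then 1 else 0)"
      unfolding mpw_add mcoeff_mult by (rule sum.cong) (auto simp: add split: if_splits)
    then show "mcoeff (mpw mX (?e + b)) a = mcoeff (Abs_mfps (\<lambda>a. if a = ?e + b then 1 else 0)) a"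
      by auto
  qed
qed

lemma msubst_mX_right [simp]: "msubst p mX = p"
proof (rule mfps_eqI)
  fix a :: "'a mono"
  have "mcoeff (msubst p mX) a = (\<Sum>b | mdeg b \<le> mdeg a. if b = a then mcoeff p a else 0)"
    unfolding mcoeff_msubst by (rule sum.cong) (auto simp: mpw_mX)
  then show "mcoeff (msubst p mX) a = mcoeff p a" by (simp add: finite_mdeg_le)
qed

lemma msubst_mpw: "no_const H \<Longrightarrow> msubst (mpw G b) H = mpw (fcomp G H) b"
  by (induction b rule: mono_induct) (simp_all add: mpw_add msubst_mult fcomp_def)

lemma no_const_fcomp: "no_const F \<Longrightarrow> no_const G \<Longrightarrow> no_const (fcomp F G)"
  by (simp add: no_const_iff fcomp_def ordge_msubst)

lemma msubst_assoc:
  assumes G: "no_const G" and H: "no_const H"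
  shows "msubst (msubst p G) H = msubst p (fcomp G H)"
proof (rule mfps_eqI)
  fix a :: "'a mono"
  let ?B = "{b :: 'a mono. mdeg b \<le> mdeg a}"
  \<comment> \<open>Up to the degree of \<open>a\<close> the inner substitution is a finite sum, to which the
    homomorphism laws apply.\<close>
  define s where "s = (\<Sum>b\<in>?B. const_series (mcoeff p b) * mpw G b)"
  have "ordge (Suc (mdeg a)) (msubst p G - s)"
    unfolding ordge_def using mcoeff_msubst_ge[OF G, of _ "mdeg a" p] by (auto simp: s_def)
  then have "ordge (Suc (mdeg a)) (msubst (msubst p G) H - msubst s H)"
    using ordge_msubst[OF _ H] by (simp add: msubst_diff[symmetric])
  then have "mcoeff (msubst (msubst p G) H) a = mcoeff (msubst s H) a"
    by (simp add: ordge_def)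
  also have "\<dots> = mcoeff (msubst p (fcomp G H)) a"
    by (simp add: s_def msubst_sum msubst_const_mult msubst_mpw[OF H] mcoeff_msubst)
  finally show "mcoeff (msubst (msubst p G) H) a = mcoeff (msubst p (fcomp G H)) a" .
qed

lemma fcomp_assoc: "no_const G \<Longrightarrow> no_const H \<Longrightarrow> fcomp (fcomp F G) H = fcomp F (fcomp G H)"
  unfolding fcomp_def using msubst_assoc by (fastforce simp: fcomp_def)

lemma fcomp_mX_left: "no_const G \<Longrightarrow> fcomp mX G = G"
  by (simp add: fcomp_def msubst_mX)

lemma fcomp_mX_right [simp]: "fcomp F mX = F"
  by (simp add: fcomp_def)

text \<open>\<open>agree d F G\<close> is equality of the jets of order \<open>d - 1\<close>.\<close>

definition agree :: "nat \<Rightarrow> 'n::finite fmap \<Rightarrow> 'n fmap \<Rightarrow> bool" where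
  "agree d F G \<longleftrightarrow> (\<forall>i. ordge d (F i - G i))"

lemma agree_iff: "agree d F G \<longleftrightarrow> (\<forall>i a. mdeg a < d \<longrightarrow> mcoeff (F i) a = mcoeff (G i) a)"
  by (auto simp: agree_def ordge_def)

lemma agree_refl [simp]: "agree d F F"
  by (simp add: agree_iff)

lemma agree_sym: "agree d F G \<Longrightarrow> agree d G F"
  by (simp add: agree_iff)

lemma agree_trans: "agree d F G \<Longrightarrow> agree d G H \<Longrightarrow> agree d F H"
  by (simp add: agree_iff)

lemma agree_mono: "agree d F G \<Longrightarrow> e \<le> d \<Longrightarrow> agree e F G"
  by (simp add: agree_iff)

lemma agree_all_imp_eq: "(\<And>d. agree d F G) \<Longrightarrow> F = G"
  unfolding agree_def using all_ordge_imp_eq by blast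

lemma ordge_mpw_diff:
  assumes "no_const G" "no_const G'" "agree (Suc n) G G'"
  shows "ordge (n + mdeg b) (mpw G b - mpw G' b)"
proof (induction b rule: mono_induct)
  case (add i b)
  have *: "mpw G (Poly_Mapping.single i 1 + b) - mpw G' (Poly_Mapping.single i 1 + b)
     = (G i - G' i) * mpw G b + G' i * (mpw G b - mpw G' b)"
    by (simp add: mpw_add algebra_simps)
  have "ordge (Suc n + mdeg b) ((G i - G' i) * mpw G b)"
    by (rule ordge_mult) (use assms in \<open>auto simp: agree_def ordge_mpw\<close>)
  moreover have "ordge (1 + (n + mdeg b)) (G' i * (mpw G b - mpw G' b))"
    by (rule ordge_mult) (use assms add in \<open>auto simp: no_const_iff\<close>)
  ultimately show ?case unfolding * by (intro ordge_add) auto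
qed simp

text \<open>A series without terms of degree below \<open>k\<close> gains \<open>k - 1\<close> orders of contact. With \<open>k = 2\<close> this
  makes the iteration for inverses converge and composition on the left triangular.\<close>

lemma ordge_msubst_diff:
  assumes "no_const G" "no_const G'" "agree (Suc n) G G'" "ordge k p"
  shows "ordge (n + k) (msubst p G - msubst p G')"
  unfolding ordge_def
proof (intro allI impI)
  fix a :: "'a mono" assume a: "mdeg a < n + k"
  have "mcoeff p b * mcoeff (mpw G b - mpw G' b) a = 0" for b
    using a assms(4) ordge_mpw_diff[OF assms(1-3), of b] by (cases "mdeg b < k") (auto simp: ordge_def)
  then show "mcoeff (msubst p G - msubst p G') a = 0"
    by (auto simp: mcoeff_msubst sum_subtractf[symmetric] right_diff_distrib[symmetric] intro!: sum.neutral)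
qed

lemma agree_fcomp_left: "agree d F F' \<Longrightarrow> no_const G \<Longrightarrow> agree d (fcomp F G) (fcomp F' G)"
  by (simp add: agree_def fcomp_def msubst_diff[symmetric] ordge_msubst)

lemma agree_fcomp_right:
  assumes "agree d G G'" "no_const G" "no_const G'" "no_const F"
  shows "agree d (fcomp F G) (fcomp F G')"
proof (cases d)
  case (Suc n)
  then show ?thesis
    using ordge_msubst_diff[OF assms(2,3), of n 1] assms by (simp add: agree_def fcomp_def no_const_iff)
qed (simp add: agree_def)

lemma agree_fcomp:
  "agree d F F' \<Longrightarrow> agree d G G' \<Longrightarrow> no_const F' \<Longrightarrow> no_const G \<Longrightarrow> no_const G' \<Longrightarrow>
     agree d (fcomp F G) (fcomp F' G')"
  using agree_fcomp_left agree_fcomp_right agree_trans by blast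


section \<open>Formal diffeomorphisms tangent to the identity\<close>

lemma Ghat0_iff: "h \<in> Ghat0 \<longleftrightarrow> no_const h \<and> agree 2 h mX"
proof -
  have "linear_part h = mat 1 \<longleftrightarrow> (\<forall>i j. mcoeff (h i) (Poly_Mapping.single j 1) = mcoeff (mX i) (Poly_Mapping.single j 1))"
    by (auto simp: linear_part_def mat_def vec_eq_iff)
  also have "\<dots> \<longleftrightarrow> agree 2 h mX" if "no_const h"
    using that no_const_mX unfolding agree_iff no_const_def
    by (metis One_nat_def less_2_cases_iff mdeg_eq_0_iff mdeg_eq_1_iff)
  finally have "linear_part h = mat 1 \<longleftrightarrow> agree 2 h mX" if "no_const h" using that .
  moreover have "invertible (mat 1 :: complex ^ 'a ^ 'a)"
    unfolding invertible_def by (rule exI[of _ "mat 1"]) simp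
  ultimately show ?thesis by (auto simp: Ghat0_def Ghat_def no_const_def)
qed

lemma Ghat0_no_const: "h \<in> Ghat0 \<Longrightarrow> no_const h"
  by (simp add: Ghat0_iff)

lemma Ghat0_mX [simp]: "mX \<in> Ghat0"
  by (simp add: Ghat0_iff)

lemma Ghat0_fcomp:
  assumes "g \<in> Ghat0" "h \<in> Ghat0" shows "fcomp g h \<in> Ghat0"
  using assms agree_fcomp[of 2 g mX h mX] by (simp add: Ghat0_iff no_const_fcomp)

lemma Ghat0_ordge: "h \<in> Ghat0 \<Longrightarrow> ordge 2 (h i - mX i)"
  by (simp add: Ghat0_iff agree_def)

text \<open>For \<open>h\<close> tangent to the identity the equation \<open>h \<circ> f = R\<close> is the fixed point equation
  \<open>f = R - (h - id) \<circ> f\<close>. Its right-hand side gains one order of contact at each iteration, so the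
  coefficients of degree \<open>d\<close> are those of the iterate number \<open>d\<close>. The iteration also shows how the
  solution depends on the coefficients of \<open>h\<close> and \<open>R\<close>.\<close>

primrec solve_iter :: "'n::finite fmap \<Rightarrow> 'n fmap \<Rightarrow> nat \<Rightarrow> 'n fmap" where
  "solve_iter h R 0 = (\<lambda>i. 0)"
| "solve_iter h R (Suc n) = (\<lambda>i. R i - msubst (h i - mX i) (solve_iter h R n))"

definition solve :: "'n::finite fmap \<Rightarrow> 'n fmap \<Rightarrow> 'n fmap" where
  "solve h R = (\<lambda>i. Abs_mfps (\<lambda>a. mcoeff (solve_iter h R (mdeg a) i) a))"

context
  fixes h R :: "'n::finite fmap"
  assumes h: "h \<in> Ghat0" and R: "no_const R"
begin

lemma no_const_solve_iter: "no_const (solve_iter h R n)"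
proof (induction n)
  case 0 show ?case by (simp add: no_const_def)
next
  case (Suc n)
  have "ordge 1 (h i - mX i)" for i by (rule ordge_mono[OF Ghat0_ordge[OF h]]) simp
  with Suc show ?case using R by (simp add: no_const_iff ordge_diff ordge_msubst)
qed

lemma agree_solve_iter_step:
  assumes "no_const F" "no_const G" "agree (Suc n) F G"
  shows "agree (Suc (Suc n)) (\<lambda>i. R i - msubst (h i - mX i) F) (\<lambda>i. R i - msubst (h i - mX i) G)"
proof -
  have "ordge (n + 2) (msubst (h i - mX i) G - msubst (h i - mX i) F)" for i
    by (rule ordge_msubst_diff) (use assms agree_sym Ghat0_ordge[OF h] in auto)
  then show ?thesis by (simp add: agree_def)
qed

lemma agree_solve_iter: "n \<le> m \<Longrightarrow> agree (Suc n) (solve_iter h R n) (solve_iter h R m)"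
proof (induction n arbitrary: m)
  case 0
  then show ?case using no_const_solve_iter[of m] no_const_solve_iter[of 0]
    by (simp add: agree_iff no_const_def mdeg_eq_0_iff)
next
  case (Suc n)
  then obtain m' where "m = Suc m'" "n \<le> m'" by (cases m) auto
  with Suc.IH[of m'] show ?case
    by (simp add: agree_solve_iter_step no_const_solve_iter)
qed

lemma agree_solve: "agree (Suc n) (solve h R) (solve_iter h R n)"
  unfolding agree_iff
proof (intro allI impI)
  fix i and a :: "'n mono" assume "mdeg a < Suc n"
  then show "mcoeff (solve h R i) a = mcoeff (solve_iter h R n i) a"
    using agree_solve_iter[of "mdeg a" n] by (simp add: solve_def agree_iff)
qed

lemma no_const_solve: "no_const (solve h R)"
  using agree_solve[of 0] no_const_solve_iter[of 0] by (simp add: agree_iff no_const_def)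

lemma fcomp_solve: "fcomp h (solve h R) = R"
proof (rule agree_all_imp_eq)
  fix d
  let ?f = "solve h R"
  have "agree (Suc (Suc d)) (\<lambda>i. R i - msubst (h i - mX i) ?f) (solve_iter h R (Suc d))"
    using agree_solve_iter_step[OF no_const_solve no_const_solve_iter agree_solve] by simp
  then have "agree (Suc (Suc d)) ?f (\<lambda>i. R i - msubst (h i - mX i) ?f)"
    using agree_solve agree_sym agree_trans by blast
  then have "agree (Suc (Suc d)) (fcomp h ?f) R"
    by (simp add: agree_def fcomp_def msubst_diff msubst_mX[OF no_const_solve] algebra_simps)
  then show "agree d (fcomp h ?f) R" by (rule agree_mono) simp
qed

end

definition finv :: "'n::finite fmap \<Rightarrow> 'n fmap" where
  "finv h = solve h mX"

lemma fcomp_finv: "h \<in> Ghat0 \<Longrightarrow> fcomp h (finv h) = mX"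
  by (simp add: finv_def fcomp_solve)

lemma finv_Ghat0: assumes "h \<in> Ghat0" shows "finv h \<in> Ghat0"
proof -
  have "agree 2 (finv h) (\<lambda>i. mX i - msubst (h i - mX i) (\<lambda>_. 0))"
    using agree_solve[OF assms no_const_mX, of 1] by (simp add: finv_def numeral_2_eq_2)
  moreover have "ordge 2 (msubst (h i - mX i) (\<lambda>_. 0))" for i
    by (rule ordge_msubst[OF Ghat0_ordge[OF assms]]) (simp add: no_const_def)
  then have "agree 2 (\<lambda>i. mX i - msubst (h i - mX i) (\<lambda>_. 0)) mX"
    by (auto simp: agree_def ordge_def)
  ultimately show ?thesis
    using agree_trans no_const_solve[OF assms no_const_mX] by (auto simp: Ghat0_iff finv_def)
qed

lemma finv_fcomp: assumes "h \<in> Ghat0" shows "fcomp (finv h) h = mX"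
proof -
  let ?r = "finv h"
  have r: "?r \<in> Ghat0" "finv ?r \<in> Ghat0" using assms finv_Ghat0 by blast+
  have "h = fcomp h (fcomp ?r (finv ?r))" by (simp add: fcomp_finv r)
  also have "\<dots> = fcomp (fcomp h ?r) (finv ?r)"
    using r by (simp add: fcomp_assoc Ghat0_no_const)
  also have "\<dots> = finv ?r" using r by (simp add: fcomp_finv assms fcomp_mX_left Ghat0_no_const)
  finally show ?thesis using fcomp_finv[OF r(1)] by simp
qed

lemma solve_eq: assumes "h \<in> Ghat0" "no_const R" shows "solve h R = fcomp (finv h) R"
proof -
  have nc: "no_const (solve h R)" "no_const h" "no_const (finv h)"
    using assms no_const_solve finv_Ghat0 Ghat0_no_const by blast+
  have "solve h R = fcomp (fcomp (finv h) h) (solve h R)"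
    by (simp add: finv_fcomp assms fcomp_mX_left nc)
  then show ?thesis using nc by (simp add: fcomp_assoc fcomp_solve assms)
qed

lemma finv_unique:
  assumes "h \<in> Ghat0" "no_const g" "fcomp h g = mX" shows "g = finv h"
proof -
  have "g = fcomp (fcomp (finv h) h) g" using assms by (simp add: finv_fcomp fcomp_mX_left)
  also have "\<dots> = finv h" using assms by (simp add: fcomp_assoc Ghat0_no_const)
  finally show ?thesis .
qed

lemma finv_finv: "h \<in> Ghat0 \<Longrightarrow> finv (finv h) = h"
  using finv_unique[of "finv h" h] by (simp add: finv_Ghat0 finv_fcomp Ghat0_no_const)

lemma Ghat_mult [simp]: "F \<otimes>\<^bsub>Ghat\<^esub> G = fcomp F G"
  by (simp add: Ghat_def)

lemma Ghat0_subset: "h \<in> Ghat0 \<Longrightarrow> h \<in> carrier Ghat"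
  by (simp add: Ghat0_def)

lemma Ghat_no_const: "F \<in> carrier Ghat \<Longrightarrow> no_const F"
  by (simp add: Ghat_def no_const_def)

lemma Ghat_inv [simp]: assumes "h \<in> Ghat0" shows "inv\<^bsub>Ghat\<^esub> h = finv h"
  unfolding m_inv_def
proof (rule the_equality)
  show "finv h \<in> carrier Ghat \<and> h \<otimes>\<^bsub>Ghat\<^esub> finv h = \<one>\<^bsub>Ghat\<^esub> \<and> finv h \<otimes>\<^bsub>Ghat\<^esub> h = \<one>\<^bsub>Ghat\<^esub>"
    using Ghat0_subset[OF finv_Ghat0[OF assms]] by (simp add: fcomp_finv finv_fcomp assms) (simp add: Ghat_def)
  show "y = finv h" if "y \<in> carrier Ghat \<and> h \<otimes>\<^bsub>Ghat\<^esub> y = \<one>\<^bsub>Ghat\<^esub> \<and> y \<otimes>\<^bsub>Ghat\<^esub> h = \<one>\<^bsub>Ghat\<^esub>" for y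
    using that by (intro finv_unique assms) (auto simp: Ghat_def no_const_def)
qed


section \<open>Complex powers\<close>

definition del :: "'n::finite fmap \<Rightarrow> 'n mfps \<Rightarrow> 'n mfps" where
  "del h p = msubst p h - p"

text \<open>Newton's binomial series for the substitution operator \<open>1 + del h\<close>: since \<open>del h\<close> raises the
  order, each coefficient is a finite sum, polynomial in the exponent.\<close>

definition fpow :: "'n::finite fmap \<Rightarrow> complex \<Rightarrow> 'n fmap" where
  "fpow h t = (\<lambda>i. Abs_mfps (\<lambda>a. \<Sum>j\<le>mdeg a. (t gchoose j) * mcoeff ((del h ^^ j) (mX i)) a))"

lemma del_pow_add: "(del h ^^ j) (p + q) = (del h ^^ j) p + (del h ^^ j) q"
  by (induction j) (simp_all add: del_def msubst_add)

lemma ordge_del_pow: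
  assumes "h \<in> Ghat0" "ordge k p" shows "ordge (k + j) ((del h ^^ j) p)"
proof (induction j)
  case (Suc j)
  have "ordge (1 + (k + j)) (msubst ((del h ^^ j) p) h - msubst ((del h ^^ j) p) mX)"
    by (rule ordge_msubst_diff) (use assms Suc in \<open>auto simp: Ghat0_iff numeral_2_eq_2\<close>)
  then show ?case by (simp add: del_def[of h "(del h ^^ j) p"])
qed (use assms in simp)

lemma sum_binomial_step:
  fixes u :: "nat \<Rightarrow> complex"
  shows "(\<Sum>j\<le>n. of_nat (n choose j) * (u j + u (Suc j))) = (\<Sum>j\<le>Suc n. of_nat (Suc n choose j) * u j)"
proof -
  have "(\<Sum>j\<le>n. of_nat (n choose j) * u j) = (\<Sum>j\<le>Suc n. of_nat (n choose j) * u j)" by simp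
  also have "\<dots> = u 0 + (\<Sum>j\<le>n. of_nat (n choose Suc j) * u (Suc j))"
    by (subst sum.atMost_Suc_shift) simp
  finally show ?thesis
    by (subst sum.atMost_Suc_shift) (simp add: distrib_left distrib_right sum.distrib)
qed

text \<open>The binomial theorem for the power \<open>n\<close> of the operator \<open>1 + del h\<close>.\<close>

lemma mcoeff_iterated_subst:
  "mcoeff (((\<lambda>p. msubst p h) ^^ n) p) a = (\<Sum>j\<le>n. of_nat (n choose j) * mcoeff ((del h ^^ j) p) a)"
proof (induction n arbitrary: p)
  case (Suc n)
  have "((\<lambda>p. msubst p h) ^^ Suc n) p = ((\<lambda>p. msubst p h) ^^ n) (p + del h p)"
    unfolding funpow_Suc_right o_apply by (simp add: del_def)
  then have "mcoeff (((\<lambda>p. msubst p h) ^^ Suc n) p) a =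
      (\<Sum>j\<le>n. of_nat (n choose j) * (mcoeff ((del h ^^ j) p) a + mcoeff ((del h ^^ Suc j) p) a))"
    by (simp only: Suc del_pow_add funpow_Suc_right o_apply mcoeff_simps)
  then show ?case using sum_binomial_step[of n "\<lambda>j. mcoeff ((del h ^^ j) p) a"] by simp
qed simp

lemma fpow_of_nat:
  assumes "h \<in> Ghat0"
  shows "fpow h (of_nat n) = (\<lambda>i. ((\<lambda>p. msubst p h) ^^ n) (mX i))"
proof (intro ext mfps_eqI)
  fix i a
  let ?u = "\<lambda>j. of_nat (n choose j) * mcoeff ((del h ^^ j) (mX i)) a"
  have van: "mcoeff ((del h ^^ j) (mX i)) a = 0" if "j > mdeg a" for j
    using ordge_del_pow[OF assms, of 0 "mX i" j] that by (simp add: ordge_def)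
  have "mcoeff (fpow h (of_nat n) i) a = (\<Sum>j\<le>mdeg a. ?u j)"
    by (simp add: fpow_def binomial_gbinomial)
  also have "\<dots> = (\<Sum>j\<le>mdeg a + n. ?u j)"
    by (rule sum.mono_neutral_left) (auto simp: van)
  also have "\<dots> = (\<Sum>j\<le>n. ?u j)"
    by (rule sum.mono_neutral_right) auto
  finally show "mcoeff (fpow h (of_nat n) i) a = mcoeff (((\<lambda>p. msubst p h) ^^ n) (mX i)) a"
    by (simp add: mcoeff_iterated_subst)
qed

lemma fpow_Ghat0: assumes "h \<in> Ghat0" shows "fpow h t \<in> Ghat0"
proof -
  have "mcoeff (fpow h t i) a = mcoeff (mX i) a" if "mdeg a < 2" for i a
  proof -
    have "ordge 2 ((del h ^^ 1) (mX i))"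
      using ordge_del_pow[OF assms no_const_mX[unfolded no_const_iff, rule_format], of 1 i] by (simp add: numeral_2_eq_2)
    moreover have "mdeg a = 0 \<or> mdeg a = 1" using that by linarith
    ultimately show ?thesis using that by (auto simp: fpow_def ordge_def)
  qed
  then show ?thesis
    unfolding Ghat0_iff agree_iff using no_const_mX unfolding no_const_def by simp
qed

lemma fpow_0: assumes "h \<in> Ghat0" shows "fpow h 0 = mX"
  using fpow_of_nat[OF assms, of 0] by simp

lemma fpow_Suc:
  assumes "h \<in> Ghat0" shows "fpow h (of_nat (Suc n)) = fcomp h (fpow h (of_nat n))"
proof -
  \<comment> \<open>The iterated operator is substitution of the iterated map; hence \<open>h\<close> may be split off on
    either side.\<close>
  have *: "((\<lambda>p. msubst p h) ^^ n) p = msubst p (fpow h (of_nat n))" for p n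
  proof (induction n)
    case 0 show ?case using fpow_0[OF assms] by simp
  next
    case (Suc n)
    have "fpow h (of_nat (Suc n)) = fcomp (fpow h (of_nat n)) h"
      unfolding fpow_of_nat[OF assms] by (simp add: fcomp_def)
    then show ?case
      using Suc assms fpow_Ghat0[OF assms] by (simp add: msubst_assoc Ghat0_no_const del: of_nat_Suc)
  qed
  show ?thesis
    unfolding fpow_of_nat[OF assms, of "Suc n"] funpow_Suc_right o_apply *
    using assms by (simp add: fcomp_def msubst_mX Ghat0_no_const)
qed


section \<open>Polynomial families of formal maps\<close>

definition pser :: "(('v \<Rightarrow> complex) \<Rightarrow> 'n::finite mfps) \<Rightarrow> bool" where
  "pser p \<longleftrightarrow> (\<forall>a. polyfn (\<lambda>z. mcoeff (p z) a))"

definition pfam :: "(('v \<Rightarrow> complex) \<Rightarrow> 'n::finite fmap) \<Rightarrow> bool" where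
  "pfam F \<longleftrightarrow> (\<forall>i. pser (\<lambda>z. F z i))"

lemma pser_const [simp]: "pser (\<lambda>_. p)"
  by (simp add: pser_def)

lemma pfam_const [simp]: "pfam (\<lambda>_. F)"
  by (simp add: pfam_def)

lemma pser_diff: "pser p \<Longrightarrow> pser q \<Longrightarrow> pser (\<lambda>z. p z - q z)"
  by (simp add: pser_def polyfn_diff)

lemma pser_mult: "pser p \<Longrightarrow> pser q \<Longrightarrow> pser (\<lambda>z. p z * q z)"
  unfolding pser_def mcoeff_mult case_prod_unfold by (intro allI polyfn_sum polyfn_mult) auto

lemma pser_mpw: "pfam G \<Longrightarrow> pser (\<lambda>z. mpw (G z) b)"
proof (induction b rule: mono_induct)
  case (add i b)
  then show ?case by (simp add: mpw_add pser_mult pfam_def)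
qed simp

lemma pser_msubst: "pser p \<Longrightarrow> pfam G \<Longrightarrow> pser (\<lambda>z. msubst (p z) (G z))"
  using pser_mpw[of G] unfolding pser_def mcoeff_msubst
  by (intro allI polyfn_sum polyfn_mult) auto

lemma pfam_fcomp: "pfam F \<Longrightarrow> pfam G \<Longrightarrow> pfam (\<lambda>z. fcomp (F z) (G z))"
  by (simp add: pfam_def fcomp_def pser_msubst)

lemma pfam_solve:
  assumes "pfam h" "pfam R" shows "pfam (\<lambda>z. solve (h z) (R z))"
proof -
  have "pfam (\<lambda>z. solve_iter (h z) (R z) n)" for n
  proof (induction n)
    case (Suc n)
    have "pser (\<lambda>z. R z i - msubst (h z i - mX i) (solve_iter (h z) (R z) n))" for i
      using assms by (intro pser_diff pser_msubst Suc) (auto simp: pfam_def)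
    then show ?case by (simp add: pfam_def)
  qed simp
  then show ?thesis by (simp add: pfam_def pser_def solve_def)
qed

lemma pfam_finv: "pfam h \<Longrightarrow> pfam (\<lambda>z. finv (h z))"
  by (simp add: finv_def pfam_solve)

lemma pfam_fpow:
  assumes "polyfn \<tau>" shows "pfam (\<lambda>z. fpow h (\<tau> z))"
proof -
  have "polyfn (\<lambda>z. (\<tau> z gchoose j))" for j
    unfolding gbinomial_prod_rev divide_inverse using assms
    by (intro polyfn_mult polyfn_prod polyfn_diff) auto
  then show ?thesis
    unfolding pfam_def pser_def fpow_def mcoeff_simps by (intro allI polyfn_sum polyfn_mult) auto
qed

lemma pfam_subst:
  assumes "pfam F" "\<And>k. polyfn (\<lambda>y. G y k)" shows "pfam (\<lambda>y. F (G y))"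
  using assms polyfn_subst[where y = G] unfolding pfam_def pser_def by blast

text \<open>The weight of a coefficient of degree \<open>d\<close> of a tangent-to-identity map is \<open>d - 1\<close>;
  composition and inversion respect weights, which bounds the degree of the coefficients of a
  conjugate.\<close>

definition wser :: "nat \<Rightarrow> (('v \<Rightarrow> complex) \<Rightarrow> 'n::finite mfps) \<Rightarrow> bool" where
  "wser w p \<longleftrightarrow> (\<forall>z. ordge w (p z)) \<and> (\<forall>a. pdeg (mdeg a - w) (\<lambda>z. mcoeff (p z) a))"

lemma wser_diff:
  assumes "wser w p" "wser w q" shows "wser w (\<lambda>z. p z - q z)"
  unfolding wser_def
proof (intro conjI allI)
  fix a :: "'b mono"
  have "pdeg (mdeg a - w) (\<lambda>z. (-1) * mcoeff (q z) a)"
    using assms by (intro pdeg_mult'[OF pdeg_const[of 0]]) (auto simp: wser_def)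
  then have "pdeg (mdeg a - w) (\<lambda>z. mcoeff (p z) a + (-1) * mcoeff (q z) a)"
    using assms by (intro pdeg_add) (auto simp: wser_def)
  then show "pdeg (mdeg a - w) (\<lambda>z. mcoeff (p z - q z) a)" by simp
qed (use assms in \<open>auto simp: wser_def ordge_diff\<close>)

lemma wser_mult:
  assumes "wser v p" "wser w q" shows "wser (v + w) (\<lambda>z. p z * q z)"
  unfolding wser_def
proof (intro conjI allI)
  fix a :: "'b mono"
  have "pdeg (mdeg a - (v + w)) (\<lambda>z. mcoeff (p z) b * mcoeff (q z) c)" if "b + c = a" for b c
  proof (cases "mdeg b < v \<or> mdeg c < w")
    case True
    then have "(\<lambda>z. mcoeff (p z) b * mcoeff (q z) c) = (\<lambda>_. 0)"
      using assms by (auto simp: wser_def ordge_def)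
    then show ?thesis by (simp add: pdeg_const)
  next
    case False
    then show ?thesis using that assms
      by (intro pdeg_mult'[of "mdeg b - v" _ "mdeg c - w"]) (auto simp: wser_def)
  qed
  then show "pdeg (mdeg a - (v + w)) (\<lambda>z. mcoeff (p z * q z) a)"
    unfolding mcoeff_mult case_prod_unfold by (intro pdeg_sum) auto
qed (use assms in \<open>auto simp: wser_def ordge_mult\<close>)

lemma wser_mpw:
  assumes "\<And>i. wser 1 (\<lambda>z. G z i)" shows "wser (mdeg b) (\<lambda>z. mpw (G z) b)"
proof (induction b rule: mono_induct)
  case zero show ?case by (simp add: wser_def pdeg_const)
next
  case (add i b)
  then show ?case using wser_mult[OF assms[of i], of "mdeg b" "\<lambda>z. mpw (G z) b"] by (simp add: mpw_add)
qed

lemma wser_msubst: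
  assumes "wser w p" and G: "\<And>i. wser 1 (\<lambda>z. G z i)"
  shows "wser w (\<lambda>z. msubst (p z) (G z))"
  unfolding wser_def
proof (intro conjI allI)
  show "ordge w (msubst (p z) (G z))" for z
    using assms by (intro ordge_msubst) (auto simp: wser_def no_const_iff)
  fix a :: "'b mono"
  have "pdeg (mdeg a - w) (\<lambda>z. mcoeff (p z) b * mcoeff (mpw (G z) b) a)" if "mdeg b \<le> mdeg a" for b
  proof (cases "mdeg b < w")
    case True
    then have "mcoeff (p z) b = 0" for z using assms by (auto simp: wser_def ordge_def)
    then show ?thesis by (simp add: pdeg_const)
  next
    case False
    then show ?thesis using that assms(1) wser_mpw[of G, OF G, of b]
      by (intro pdeg_mult'[of "mdeg b - w" _ "mdeg a - mdeg b"]) (auto simp: wser_def)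
  qed
  then show "pdeg (mdeg a - w) (\<lambda>z. mcoeff (msubst (p z) (G z)) a)"
    unfolding mcoeff_msubst by (intro pdeg_sum) auto
qed

lemma wser_const: "ordge w p \<Longrightarrow> wser w (\<lambda>_. p)"
  by (simp add: wser_def pdeg_const)

lemma wser_solve:
  assumes h: "\<And>i. wser 1 (\<lambda>z. h z i)" and R: "\<And>i. wser 1 (\<lambda>z. R z i)"
  shows "pdeg (mdeg a - 1) (\<lambda>z. mcoeff (solve (h z) (R z) i) a)"
proof -
  have mX: "wser 1 (\<lambda>_. mX i)" for i
    by (intro wser_const no_const_iff[THEN iffD1, OF no_const_mX, rule_format])
  have "wser 1 (\<lambda>z. solve_iter (h z) (R z) n i)" for n i
  proof (induction n arbitrary: i)
    case 0 show ?case by (simp add: wser_const)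
  next
    case (Suc n)
    show ?case unfolding solve_iter.simps
      by (intro wser_diff wser_msubst R h mX Suc)
  qed
  then show ?thesis by (simp add: solve_def wser_def)
qed


section \<open>Jets\<close>

text \<open>Coordinate vectors are read as maps in two ways: \<open>fmap_of\<close> sets the constant term to zero, and
  \<open>diffeo\<close> also replaces the linear part by the identity. Both are defined on all vectors, so that
  they can be used in polynomial families.\<close>

definition fmap_of :: "('n::finite cindex \<Rightarrow> complex) \<Rightarrow> 'n fmap" where
  "fmap_of y = (\<lambda>i. Abs_mfps (\<lambda>a. if a = 0 then 0 else y (i, a)))"

definition diffeo :: "('n::finite cindex \<Rightarrow> complex) \<Rightarrow> 'n fmap" where
  "diffeo x = (\<lambda>i. Abs_mfps (\<lambda>a. if mdeg a < 2 then mcoeff (mX i) a else x (i, a)))"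

lemma no_const_fmap_of [simp]: "no_const (fmap_of y)"
  by (simp add: no_const_def fmap_of_def)

lemma diffeo_Ghat0 [simp]: "diffeo x \<in> Ghat0"
  by (simp add: Ghat0_iff diffeo_def agree_iff no_const_def)

lemma diffeo_0 [simp]: "diffeo (\<lambda>_. 0) = mX"
  by (intro ext mfps_eqI) (auto simp: diffeo_def)

lemma jet_cspace [simp]: "jet m F \<in> cspace (jet_index m)"
  by (simp add: jet_def)

lemma jet0_cspace [simp]: "jet0 m F \<in> cspace (jet0_index m)"
  by (simp add: jet0_def)

lemma agree_fmap_of_jet: "no_const F \<Longrightarrow> agree (Suc m) (fmap_of (jet m F)) F"
  by (auto simp: agree_iff fmap_of_def jet_def restr_def coeffs_def jet_index_def no_const_def mdeg_eq_0_iff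
      Suc_le_eq zero_less_iff_neq_zero)

lemma agree_diffeo_jet0: "h \<in> Ghat0 \<Longrightarrow> agree (Suc m) (diffeo (jet0 m h)) h"
  by (auto simp: agree_iff diffeo_def jet0_def restr_def coeffs_def jet0_index_def Ghat0_iff)

lemma jet_eqI: "agree (Suc m) F G \<Longrightarrow> jet m F = jet m G"
  by (auto simp: agree_iff jet_def restr_def coeffs_def jet_index_def fun_eq_iff)

lemma jet0_eqI: "agree (Suc m) F G \<Longrightarrow> jet0 m F = jet0 m G"
  by (auto simp: agree_iff jet0_def restr_def coeffs_def jet0_index_def fun_eq_iff)

lemma agree_if_jet0_eq:
  "g \<in> Ghat0 \<Longrightarrow> h \<in> Ghat0 \<Longrightarrow> jet0 m g = jet0 m h \<Longrightarrow> agree (Suc m) g h"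
  using agree_diffeo_jet0[of g m] agree_diffeo_jet0[of h m] agree_sym agree_trans by metis

lemma agree_if_jet_eq:
  "no_const F \<Longrightarrow> no_const G \<Longrightarrow> jet m F = jet m G \<Longrightarrow> agree (Suc m) F G"
  using agree_fmap_of_jet[of F m] agree_fmap_of_jet[of G m] agree_sym agree_trans by metis

lemma jet_fmap_of: "y \<in> cspace (jet_index m) \<Longrightarrow> jet m (fmap_of y) = y"
  by (auto simp: fmap_of_def jet_def restr_def coeffs_def jet_index_def cspace_def fun_eq_iff)

lemma jet0_diffeo: "x \<in> cspace (jet0_index m) \<Longrightarrow> jet0 m (diffeo x) = x"
  by (auto simp: diffeo_def jet0_def restr_def coeffs_def jet0_index_def cspace_def fun_eq_iff)

lemma pfam_fmap_of: "(\<And>v. polyfn (\<lambda>z. y z v)) \<Longrightarrow> pfam (\<lambda>z. fmap_of (y z))"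
  unfolding pfam_def pser_def fmap_of_def mcoeff_simps by (intro allI polyfn_if) auto

lemma pfam_diffeo: "(\<And>v. polyfn (\<lambda>z. y z v)) \<Longrightarrow> pfam (\<lambda>z. diffeo (y z))"
  unfolding pfam_def pser_def diffeo_def mcoeff_simps by (intro allI polyfn_if) auto

lemma polyfn_coeffs: "pfam F \<Longrightarrow> polyfn (\<lambda>z. coeffs (F z) v)"
  by (cases v) (simp add: coeffs_def pfam_def pser_def)

lemma polyfn_jet: "pfam F \<Longrightarrow> polyfn (\<lambda>z. jet m (F z) v)"
  unfolding jet_def by (intro polyfn_restr polyfn_coeffs)

lemma polyfn_jet0: "pfam F \<Longrightarrow> polyfn (\<lambda>z. jet0 m (F z) v)"
  unfolding jet0_def by (intro polyfn_restr polyfn_coeffs)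

lemma agree_finv:
  assumes "g \<in> Ghat0" "h \<in> Ghat0" "agree d g h" shows "agree d (finv g) (finv h)"
proof -
  have nc: "no_const g" "no_const h" "no_const (finv g)" "no_const (finv h)"
    using assms finv_Ghat0 Ghat0_no_const by blast+
  have "agree d (fcomp (finv g) (fcomp g (finv h))) (fcomp (finv g) (fcomp h (finv h)))"
    by (intro agree_fcomp_right agree_fcomp_left assms nc no_const_fcomp)
  then have "agree d (finv h) (finv g)"
    using assms nc by (simp add: fcomp_assoc[symmetric] finv_fcomp fcomp_finv fcomp_mX_left)
  then show ?thesis by (rule agree_sym)
qed


section \<open>Orbits of triangular actions\<close>

text \<open>The subgroups closed under complex powers take the place of the connected algebraic subgroups of
  a unipotent group.\<close>

definition power_group :: "'n::finite fmap set \<Rightarrow> bool" where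
  "power_group S \<longleftrightarrow> S \<subseteq> Ghat0 \<and> mX \<in> S \<and> (\<forall>g\<in>S. \<forall>h\<in>S. fcomp g h \<in> S) \<and>
     (\<forall>h\<in>S. finv h \<in> S \<and> (\<forall>t. fpow h t \<in> S))"

lemma power_group_Ghat0: "power_group Ghat0"
  by (simp add: power_group_def Ghat0_fcomp finv_Ghat0 fpow_Ghat0)

text \<open>An action of the formal diffeomorphisms tangent to the identity on \<open>\<complex>\<^sup>I\<close> that moves a coordinate
  by an amount that depends on the coordinates of lower rank only and that is polynomial in the
  coefficients of the group element.\<close>

locale triangular_action =
  fixes I :: "'w set" and rank :: "'w \<Rightarrow> nat"
    and act :: "'n::finite fmap \<Rightarrow> ('w \<Rightarrow> complex) \<Rightarrow> ('w \<Rightarrow> complex)"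
  assumes finite_I: "finite I"
    and act_cspace: "s \<in> Ghat0 \<Longrightarrow> x \<in> cspace I \<Longrightarrow> act s x \<in> cspace I"
    and act_mX: "x \<in> cspace I \<Longrightarrow> act mX x = x"
    and act_fcomp: "s \<in> Ghat0 \<Longrightarrow> s' \<in> Ghat0 \<Longrightarrow> x \<in> cspace I \<Longrightarrow> act (fcomp s s') x = act s (act s' x)"
    and act_triangular: "s \<in> Ghat0 \<Longrightarrow> x \<in> cspace I \<Longrightarrow> y \<in> cspace I \<Longrightarrow> v \<in> I \<Longrightarrow>
      (\<And>w. w \<in> I \<Longrightarrow> rank w < rank v \<Longrightarrow> x w = y w) \<Longrightarrow> act s x v - x v = act s y v - y v"
    and act_poly: "pfam \<sigma> \<Longrightarrow> (\<And>z :: nat \<Rightarrow> complex. \<sigma> z \<in> Ghat0) \<Longrightarrow> x \<in> cspace I \<Longrightarrow>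
      polyfn (\<lambda>z. act (\<sigma> z) x v)"
begin

lemma act_fpow_poly:
  assumes "s \<in> Ghat0" "x \<in> cspace I"
  shows "\<exists>q. \<forall>t. act (fpow s t) x v = poly q t"
proof -
  have "polyfn (\<lambda>z :: nat \<Rightarrow> complex. act (fpow s (z 0)) x v)"
    by (intro act_poly pfam_fpow polyfn_coord fpow_Ghat0 assms)
  from polyfn_univariate[OF this] show ?thesis by simp
qed

lemma act_fpow_eq:
  assumes "s \<in> Ghat0" "x \<in> cspace I"
    and "\<And>n. act (fpow s (of_nat n)) x v = a + of_nat n * c"
  shows "act (fpow s t) x v = a + t * c"
proof -
  obtain q where q: "\<And>t. act (fpow s t) x v = poly q t"
    using act_fpow_poly[OF assms(1,2)] by blast
  have "q = [:a, c:]"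
    by (rule poly_fun_eq_of_nat) (use assms(3) in \<open>simp add: q[symmetric] mult.commute\<close>)
  then show ?thesis by (simp add: q mult.commute)
qed

text \<open>The stabilizer contains the complex powers of its elements, because the powers with natural
  exponents stabilize and the action is polynomial in the exponent.\<close>

lemma power_group_stabilizer:
  assumes x: "x \<in> cspace I" shows "power_group {s \<in> Ghat0. act s x = x}"
proof -
  have "act (fpow s t) x = x" if s: "s \<in> Ghat0" "act s x = x" for s t
  proof
    fix v
    have "act (fpow s (of_nat n)) x = x" for n
    proof (induction n)
      case (Suc n)
      then show ?case using s x
        by (simp add: fpow_Suc act_fcomp fpow_Ghat0 del: of_nat_Suc)
    qed (simp add: fpow_0 s act_mX x)
    then show "act (fpow s t) x v = x v"
      using act_fpow_eq[OF s(1) x, of v "x v" 0 t] by simp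
  qed
  moreover have "act (finv s) x = x" if s: "s \<in> Ghat0" "act s x = x" for s
    using act_fcomp[OF finv_Ghat0 _ x, of s s] s by (simp add: finv_fcomp act_mX x)
  ultimately show ?thesis
    using x by (auto simp: power_group_def Ghat0_fcomp finv_Ghat0 fpow_Ghat0 act_mX act_fcomp)
qed

definition down_closed :: "'w set \<Rightarrow> bool" where
  "down_closed K \<longleftrightarrow> K \<subseteq> I \<and> (\<forall>v\<in>K. \<forall>w\<in>I. rank w < rank v \<longrightarrow> w \<in> K)"

lemma act_agree_on:
  assumes "down_closed K" "s \<in> Ghat0" "x \<in> cspace I" "y \<in> cspace I" "\<And>v. v \<in> K \<Longrightarrow> x v = y v" "v \<in> K"
  shows "act s x v = act s y v"
  using act_triangular[OF assms(2-4), of v] assms unfolding down_closed_def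
  by (metis diff_add_cancel subsetD)

text \<open>The coordinates are added one at a time, in order of rank. The elements of the group that fix
  the coordinates of \<open>x\<close> treated so far translate the next one. Either all of these translations are
  trivial, and the new coordinate of a point of the orbit is a function of the previous ones, or
  one of them is not, and its complex powers reach every value, so that the new coordinate becomes
  a free parameter.\<close>

lemma orbit_parametrization_on:
  assumes S: "power_group S" and x: "x \<in> cspace I" and K: "down_closed K"
  shows "\<exists>(r :: nat) \<sigma> G. pfam \<sigma> \<and> (\<forall>z. \<sigma> z \<in> S) \<and> (\<forall>k. polyfn (\<lambda>y. G y k)) \<and> (\<forall>y. G y \<in> cspace {..<r}) \<and>
     (\<forall>z\<in>cspace {..<r}. \<forall>y. (\<forall>v\<in>K. y v = act (\<sigma> z) x v) \<longrightarrow> G y = z) \<and>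
     (\<forall>s\<in>S. \<forall>v\<in>K. act (\<sigma> (G (act s x))) x v = act s x v)"
  using K
proof (induction "card K" arbitrary: K)
  case 0
  then have "K = {}" using finite_I by (auto simp: down_closed_def dest: finite_subset)
  moreover have "cspace {..<0::nat} = {\<lambda>_. 0}" by (auto simp: cspace_def)
  ultimately show ?case using S
    by (intro exI[of _ 0] exI[of _ "\<lambda>_. mX"] exI[of _ "\<lambda>_ _. 0"]) (auto simp: power_group_def)
next
  case (Suc c K)
  have finK: "finite K" "K \<noteq> {}" using Suc.hyps(2) by (auto intro: card_ge_0_finite)
  have "Max (rank ` K) \<in> rank ` K" using finK by (intro Max_in) auto
  then obtain i where "i \<in> K" "rank i = Max (rank ` K)" by auto
  then have i: "i \<in> K" "\<And>v. v \<in> K \<Longrightarrow> rank v \<le> rank i" using finK by simp_all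
  define K' where "K' = K - {i}"
  have K: "K = insert i K'" "i \<in> I" using i Suc.prems by (auto simp: K'_def down_closed_def)
  have low: "w \<in> K'" if "w \<in> I" "rank w < rank i" for w
    using that Suc.prems i by (auto simp: K'_def down_closed_def)
  have dc: "down_closed K'"
    unfolding down_closed_def
  proof (intro conjI ballI impI)
    show "K' \<subseteq> I" using Suc.prems by (auto simp: down_closed_def K'_def)
    fix v w assume "v \<in> K'" "w \<in> I" "rank w < rank v"
    then show "w \<in> K'" using i(2)[of v] by (intro low) (auto simp: K'_def)
  qed
  have "c = card K'" using Suc.hyps(2) i finK by (simp add: K'_def)
  from Suc.hyps(1)[OF this dc] obtain r :: nat and \<sigma> G where IH: "pfam \<sigma>" "\<forall>z. \<sigma> z \<in> S"
    "\<forall>k. polyfn (\<lambda>y. G y k)" "\<forall>y. G y \<in> cspace {..<r}"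
    "\<forall>z\<in>cspace {..<r}. \<forall>y. (\<forall>v\<in>K'. y v = act (\<sigma> z) x v) \<longrightarrow> G y = z"
    "\<forall>s\<in>S. \<forall>v\<in>K'. act (\<sigma> (G (act s x))) x v = act s x v"
    by blast
  note \<sigma> = IH(1) IH(2)[rule_format] and G = IH(3,4)[rule_format]
    and GF = IH(5)[rule_format] and FG = IH(6)[rule_format]
  have S0: "s \<in> Ghat0" if "s \<in> S" for s using S that by (auto simp: power_group_def)
  have ax: "act s x \<in> cspace I" if "s \<in> S" for s using act_cspace S0 x that by blast
  have tri: "act s y i - y i = act s x i - x i"
    if "s \<in> S" "y \<in> cspace I" "\<And>v. v \<in> K' \<Longrightarrow> y v = x v" for s y
    using act_triangular[OF S0[OF that(1)] that(2) x K(2)] that(3) low by blast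
  show ?case
  proof (cases "\<forall>s\<in>S. (\<forall>v\<in>K'. act s x v = x v) \<longrightarrow> act s x i = x i")
    case True
    \<comment> \<open>Dividing \<open>s\<close> by the section at its own coordinates gives an element that fixes the old
      coordinates of \<open>x\<close>, hence the new one too.\<close>
    have "act (\<sigma> (G (act s x))) x v = act s x v" if s: "s \<in> S" and v: "v \<in> K" for s v
    proof -
      let ?g = "\<sigma> (G (act s x))"
      let ?s = "fcomp (finv ?g) s"
      have g: "?g \<in> S" "finv ?g \<in> S" "?s \<in> S" using S \<sigma> s by (auto simp: power_group_def)
      have "act (finv ?g) (act ?g x) = x"
        using g x by (simp add: act_fcomp[symmetric] S0 finv_fcomp act_mX)
      moreover have "act (finv ?g) (act s x) v = act (finv ?g) (act ?g x) v" if "v \<in> K'" for v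
        by (rule act_agree_on[OF dc]) (use g s ax S0 FG that in auto)
      ultimately have "\<forall>v\<in>K'. act ?s x v = x v" using g s x by (simp add: act_fcomp S0)
      with True g have same: "act ?s x v = x v" if "v \<in> K" for v using K that by blast
      have "act ?g (act ?s x) v = act ?g x v"
        by (rule act_agree_on[OF Suc.prems]) (use g ax S0 x same v in auto)
      moreover have "act ?g (act ?s x) = act (fcomp (fcomp ?g (finv ?g)) s) x"
        using g s x by (simp add: act_fcomp[symmetric] S0 fcomp_assoc Ghat0_no_const Ghat0_fcomp)
      ultimately show ?thesis
        using g s by (simp add: fcomp_finv S0 fcomp_mX_left Ghat0_no_const)
    qed
    then show ?thesis using \<sigma> G GF K
      by (intro exI[of _ r] exI[of _ \<sigma>] exI[of _ G]) auto
  next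
    case False
    then obtain s0 where s0: "s0 \<in> S" "\<And>v. v \<in> K' \<Longrightarrow> act s0 x v = x v" "act s0 x i \<noteq> x i" by blast
    define c where "c = act s0 x i - x i"
    have c: "c \<noteq> 0" using s0 by (simp add: c_def)
    have pS: "fpow s0 t \<in> S" for t using S s0 by (auto simp: power_group_def)
    \<comment> \<open>The natural powers of \<open>s0\<close> fix the old coordinates of \<open>x\<close> and translate the new one by
      multiples of \<open>c\<close>; by polynomiality so do the complex powers.\<close>
    have nat: "(\<forall>v\<in>K'. act (fpow s0 (of_nat n)) x v = x v) \<and> act (fpow s0 (of_nat n)) x i = x i + of_nat n * c" for n
    proof (induction n)
      case 0
      then show ?case using s0 x by (simp add: fpow_0 S0 act_mX)
    next
      case (Suc n)
      let ?y = "act (fpow s0 (of_nat n)) x"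
      have y: "?y \<in> cspace I" using pS ax by blast
      have step: "act (fpow s0 (of_nat (Suc n))) x = act s0 ?y"
        using s0 x pS by (simp add: fpow_Suc S0 act_fcomp del: of_nat_Suc)
      have "act s0 ?y v = act s0 x v" if "v \<in> K'" for v
        by (rule act_agree_on[OF dc]) (use s0 S0 y x Suc that in auto)
      moreover have "act s0 ?y i - ?y i = c" unfolding c_def
        by (rule tri) (use s0 y Suc in auto)
      ultimately show ?case unfolding step using s0 Suc by (auto simp: algebra_simps)
    qed
    have p1: "act (fpow s0 t) x v = x v" if "v \<in> K'" for v t
      using act_fpow_eq[OF S0[OF s0(1)] x, of v "x v" 0 t] nat that by simp
    have p2: "act (fpow s0 t) x i = x i + t * c" for t
      using act_fpow_eq[OF S0[OF s0(1)] x, of i "x i" c t] nat by simp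
    \<comment> \<open>The exponent is divided by \<open>c\<close> so that the parameter \<open>z r\<close> translates by exactly \<open>z r\<close>.\<close>
    define \<sigma>' where "\<sigma>' z = fcomp (\<sigma> (restr {..<r} z)) (fpow s0 (z r / c))" for z
    define G' where "G' y = (\<lambda>k. if k < r then G y k else if k = r then y i - act (\<sigma> (G y)) x i else 0)" for y
    have \<sigma>'S: "\<sigma>' z \<in> S" for z using S \<sigma> pS by (auto simp: \<sigma>'_def power_group_def)
    have new: "(\<forall>v\<in>K'. act (\<sigma>' z) x v = act (\<sigma> (restr {..<r} z)) x v) \<and>
        act (\<sigma>' z) x i = act (\<sigma> (restr {..<r} z)) x i + z r" for z
    proof -
      let ?g = "\<sigma> (restr {..<r} z)" and ?y = "act (fpow s0 (z r / c)) x"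
      have y: "?y \<in> cspace I" using pS ax by blast
      have "act (\<sigma>' z) x = act ?g ?y" using \<sigma> pS x by (simp add: \<sigma>'_def act_fcomp S0)
      moreover have "act ?g ?y v = act ?g x v" if "v \<in> K'" for v
        by (rule act_agree_on[OF dc]) (use \<sigma> S0 y x p1 that in auto)
      moreover have "act ?g ?y i - ?y i = act ?g x i - x i"
        by (rule tri) (use \<sigma> y p1 in auto)
      ultimately show ?thesis using p2 c by (simp add: algebra_simps)
    qed
    have "pfam \<sigma>'" unfolding \<sigma>'_def divide_inverse
      by (intro pfam_fcomp pfam_fpow pfam_subst[OF \<sigma>(1)] polyfn_mult polyfn_restr) auto
    moreover have "polyfn (\<lambda>y. G' y k)" for k
    proof -
      have "polyfn (\<lambda>z. act (\<sigma> z) x i)" using \<sigma> S0 x by (intro act_poly) auto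
      from polyfn_subst[OF this G(1)] show ?thesis
        unfolding G'_def by (intro polyfn_if polyfn_diff G(1)) auto
    qed
    moreover have "G' y \<in> cspace {..<Suc r}" for y by (auto simp: G'_def cspace_def)
    moreover have restrG: "restr {..<r} (G' y) = G y" for y
      using G(2)[of y] by (auto simp: G'_def restr_def cspace_def fun_eq_iff)
    have "G' y = z" if z: "z \<in> cspace {..<Suc r}" and y: "\<forall>v\<in>K. y v = act (\<sigma>' z) x v" for z y
    proof -
      have Gy: "G y = restr {..<r} z" by (rule GF) (use y new K in auto)
      have "y i - act (\<sigma> (G y)) x i = z r" using y new[of z] K by (simp add: Gy)
      then have "G' y k = z k" for k
        using z Gy less_Suc_eq by (cases k r rule: linorder_cases) (auto simp: G'_def restr_def cspace_def)
      then show ?thesis by (rule ext)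
    qed
    moreover have "act (\<sigma>' (G' (act s x))) x v = act s x v" if "s \<in> S" "v \<in> K" for s v
      using new[of "G' (act s x)"] FG[OF that(1)] that(2) K unfolding restrG
      by (auto simp: G'_def)
    ultimately show ?thesis using \<sigma>'S
      by (intro exI[of _ "Suc r"] exI[of _ \<sigma>'] exI[of _ G']) auto
  qed
qed

text \<open>The maps \<open>\<sigma>\<close> and \<open>G\<close> are a polynomial section of the orbit map and the coordinates of a point of
  the orbit; both enter the comparison of the group with orbit and stabilizer.\<close>

theorem orbit_parametrization:
  assumes S: "power_group S" and x: "x \<in> cspace I"
  obtains r \<sigma> G where "pfam \<sigma>" "\<forall>z. \<sigma> z \<in> S" "\<forall>k. polyfn (\<lambda>y. G y k)" "\<forall>y. G y \<in> cspace {..<r}"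
    "\<forall>z\<in>cspace {..<r}. G (act (\<sigma> z) x) = z"
    "\<forall>s\<in>S. act (\<sigma> (G (act s x))) x = act s x"
    "affine_cell I ((\<lambda>s. act s x) ` S) r"
proof -
  have "down_closed I" by (simp add: down_closed_def)
  from orbit_parametrization_on[OF S x this] obtain r :: nat and \<sigma> G where *: "pfam \<sigma>" "\<forall>z. \<sigma> z \<in> S"
    "\<forall>k. polyfn (\<lambda>y. G y k)" "\<forall>y. G y \<in> cspace {..<r}"
    "\<forall>z\<in>cspace {..<r}. \<forall>y. (\<forall>v\<in>I. y v = act (\<sigma> z) x v) \<longrightarrow> G y = z"
    "\<forall>s\<in>S. \<forall>v\<in>I. act (\<sigma> (G (act s x))) x v = act s x v"
    by blast
  have S0: "s \<in> Ghat0" if "s \<in> S" for s using S that by (auto simp: power_group_def)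
  have ax: "act s x \<in> cspace I" if "s \<in> S" for s using act_cspace S0 x that by blast
  have FG: "act (\<sigma> (G (act s x))) x = act s x" if "s \<in> S" for s
  proof
    fix v show "act (\<sigma> (G (act s x))) x v = act s x v"
      using * that ax[OF that] ax[of "\<sigma> (G (act s x))"] by (cases "v \<in> I") (auto simp: cspace_def)
  qed
  have GF: "G (act (\<sigma> z) x) = z" if "z \<in> cspace {..<r}" for z using * that by blast
  have poly: "polyfn (\<lambda>z. act (\<sigma> z) x v)" for v
    by (rule act_poly) (use * S0 x in auto)
  have "(\<lambda>z. act (\<sigma> z) x) ` cspace {..<r} = (\<lambda>s. act s x) ` S"
  proof (intro equalityI image_subsetI)
    fix s assume "s \<in> S"
    then show "act s x \<in> (\<lambda>z. act (\<sigma> z) x) ` cspace {..<r}"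
      using FG[of s] * by (metis imageI)
  qed (use * in auto)
  then have "affine_cell I ((\<lambda>s. act s x) ` S) r" unfolding affine_cell_def
    using * GF ax poly by (intro exI[of _ "\<lambda>z. act (\<sigma> z) x"] exI[of _ G]) auto
  with * GF FG show ?thesis by (intro that[of \<sigma> G r]) auto
qed

end


section \<open>Conjugation of jets\<close>

text \<open>Taking \<open>s = h\<inverse>\<close> turns the conjugates \<open>h\<inverse> N h\<close> into the orbit of \<open>N\<close> under a left action.\<close>

definition conj_act :: "nat \<Rightarrow> 'n::finite fmap \<Rightarrow> ('n cindex \<Rightarrow> complex) \<Rightarrow> 'n cindex \<Rightarrow> complex" where
  "conj_act m s y = jet m (fcomp (fcomp s (fmap_of y)) (finv s))"

declare Ghat0_no_const [simp] finv_Ghat0 [simp] Ghat0_fcomp [simp] no_const_fcomp [simp]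
  finv_finv [simp]

definition left_act :: "nat \<Rightarrow> 'n::finite fmap \<Rightarrow> ('n cindex \<Rightarrow> complex) \<Rightarrow> 'n cindex \<Rightarrow> complex" where
  "left_act m s x = jet0 m (fcomp s (diffeo x))"

lemma conj_act_coeff:
  "(i, a) \<in> jet_index m \<Longrightarrow> conj_act m s y (i, a) = mcoeff (fcomp (fcomp s (fmap_of y)) (finv s) i) a"
  by (simp add: conj_act_def jet_def restr_def coeffs_def)

lemma left_act_coeff:
  "(i, a) \<in> jet0_index m \<Longrightarrow> left_act m s x (i, a) = mcoeff (fcomp s (diffeo x) i) a"
  by (simp add: left_act_def jet0_def restr_def coeffs_def)

lemma mcoeff_fmap_of: "(i, a) \<in> jet_index m \<Longrightarrow> mcoeff (fmap_of y i) a = y (i, a)"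
  by (auto simp: fmap_of_def jet_index_def)

lemma mcoeff_diffeo: "(i, a) \<in> jet0_index m \<Longrightarrow> mcoeff (diffeo x i) a = x (i, a)"
  by (auto simp: diffeo_def jet0_index_def)

lemma finite_jet0_index: "finite (jet0_index m :: 'n::finite cindex set)"
  by (rule finite_subset[OF _ finite_jet_index[of m]]) (auto simp: jet0_index_def jet_index_def)

lemma agree_fmap_of:
  assumes "y \<in> cspace (jet_index m)" "y' \<in> cspace (jet_index m)"
    and "\<And>w. w \<in> jet_index m \<Longrightarrow> mdeg (snd w) < d \<Longrightarrow> y w = y' w"
  shows "agree d (fmap_of y) (fmap_of y')"
  unfolding agree_iff
proof (intro allI impI)
  fix i and a :: "'a mono" assume "mdeg a < d"
  then have "y (i, a) = y' (i, a)"
    using assms by (cases "(i, a) \<in> jet_index m") (auto simp: cspace_def)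
  then show "mcoeff (fmap_of y i) a = mcoeff (fmap_of y' i) a" by (simp add: fmap_of_def)
qed

lemma agree_diffeo:
  assumes "x \<in> cspace (jet0_index m)" "x' \<in> cspace (jet0_index m)"
    and "\<And>w. w \<in> jet0_index m \<Longrightarrow> mdeg (snd w) < d \<Longrightarrow> x w = x' w"
  shows "agree d (diffeo x) (diffeo x')"
  unfolding agree_iff
proof (intro allI impI)
  fix i and a :: "'a mono" assume "mdeg a < d"
  then have "x (i, a) = x' (i, a)"
    using assms by (cases "(i, a) \<in> jet0_index m") (auto simp: cspace_def)
  then show "mcoeff (diffeo x i) a = mcoeff (diffeo x' i) a" by (simp add: diffeo_def)
qed

text \<open>Composition on the left with a map tangent to the identity does not change the leading term of
  a difference.\<close>

lemma ordge_fcomp_left_leading: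
  assumes "s \<in> Ghat0" "no_const F" "no_const G" "agree d F G"
  shows "ordge (Suc d) (fcomp s F i - fcomp s G i - (F i - G i))"
proof (cases d)
  case 0
  then show ?thesis using no_const_fcomp[OF Ghat0_no_const[OF assms(1)]] assms(2,3)
    by (auto simp: ordge_def no_const_def mdeg_eq_0_iff)
next
  case (Suc n)
  have "ordge (n + 2) (msubst (s i - mX i) F - msubst (s i - mX i) G)"
    by (rule ordge_msubst_diff) (use assms Suc in \<open>auto simp: Ghat0_ordge\<close>)
  then show ?thesis
    using assms by (simp add: Suc msubst_diff msubst_mX fcomp_def algebra_simps)
qed

text \<open>The same holds on the right, by comparing \<open>s\<close> with the identity.\<close>

lemma ordge_msubst_leading:
  assumes "s \<in> Ghat0" "ordge d p" shows "ordge (Suc d) (msubst p s - p)"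
  using ordge_msubst_diff[of s mX 1 d p] assms by (simp add: Ghat0_iff numeral_2_eq_2)

lemma conj_act_eqI:
  assumes "s \<in> Ghat0" "no_const F" "agree (Suc m) F (fmap_of y)"
  shows "conj_act m s y = jet m (fcomp (fcomp s F) (finv s))"
  unfolding conj_act_def using assms finv_Ghat0
  by (intro jet_eqI agree_fcomp_left agree_fcomp_right no_const_fcomp) (auto simp: Ghat0_no_const agree_sym)

lemma conj_act_jet:
  assumes "s \<in> Ghat0" "no_const F"
  shows "conj_act m s (jet m F) = jet m (fcomp (fcomp s F) (finv s))"
  by (rule conj_act_eqI[OF assms agree_sym[OF agree_fmap_of_jet[OF assms(2)]]])

lemma conj_act_cong:
  assumes "s \<in> Ghat0" "s' \<in> Ghat0" "agree (Suc m) s s'"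
  shows "conj_act m s y = conj_act m s' y"
  unfolding conj_act_def using assms finv_Ghat0
  by (intro jet_eqI agree_fcomp agree_fcomp_left agree_finv no_const_fcomp) (auto simp: Ghat0_no_const)

lemma finv_fcomp_distrib:
  assumes "g \<in> Ghat0" "h \<in> Ghat0" shows "finv (fcomp g h) = fcomp (finv h) (finv g)"
proof (rule finv_unique[symmetric])
  have nc: "no_const g" "no_const h" "no_const (finv g)" "no_const (finv h)"
    using assms finv_Ghat0 Ghat0_no_const by blast+
  have "fcomp (fcomp g h) (fcomp (finv h) (finv g)) = fcomp g (fcomp (fcomp h (finv h)) (finv g))"
    using nc by (simp add: fcomp_assoc no_const_fcomp)
  then show "fcomp (fcomp g h) (fcomp (finv h) (finv g)) = mX"
    using assms nc by (simp add: fcomp_finv fcomp_mX_left)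
qed (use assms in \<open>auto intro!: Ghat0_fcomp no_const_fcomp Ghat0_no_const finv_Ghat0\<close>)

lemma finv_mX [simp]: "finv mX = mX"
  using finv_unique[of mX mX, symmetric] by simp

lemma conj_act_poly:
  assumes "pfam \<sigma>" "\<And>v. polyfn (\<lambda>z. y z v)"
  shows "polyfn (\<lambda>z. conj_act m (\<sigma> z) (y z) v)"
  unfolding conj_act_def by (intro polyfn_jet pfam_fcomp pfam_finv pfam_fmap_of assms)

lemma left_act_poly:
  assumes "pfam \<sigma>" "\<And>v. polyfn (\<lambda>z. x z v)"
  shows "polyfn (\<lambda>z. left_act m (\<sigma> z) (x z) v)"
  unfolding left_act_def by (intro polyfn_jet0 pfam_fcomp pfam_diffeo assms)

global_interpretation conj: triangular_action "jet_index m" "\<lambda>w. mdeg (snd w)" "conj_act m"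
proof
  fix s s' :: "'a fmap" and x y :: "'a cindex \<Rightarrow> complex" and v :: "'a cindex"
  show "finite (jet_index m :: 'a cindex set)" by (rule finite_jet_index)
  show "conj_act m s x \<in> cspace (jet_index m)" by (simp add: conj_act_def)
  show "conj_act m mX x = x" if "x \<in> cspace (jet_index m)"
    using that by (simp add: conj_act_def jet_fmap_of fcomp_mX_left)
  show "conj_act m (fcomp s s') x = conj_act m s (conj_act m s' x)" if "s \<in> Ghat0" "s' \<in> Ghat0"
  proof -
    have nc: "no_const s" "no_const s'" "no_const (finv s)" "no_const (finv s')"
      using that finv_Ghat0 Ghat0_no_const by blast+
    show ?thesis unfolding conj_act_def[of m s']
      by (subst conj_act_jet)
        (use that nc in \<open>auto simp: conj_act_def finv_fcomp_distrib fcomp_assoc no_const_fcomp\<close>)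
  qed
  show "conj_act m s x v - x v = conj_act m s y v - y v"
    if s: "s \<in> Ghat0" and xy: "x \<in> cspace (jet_index m)" "y \<in> cspace (jet_index m)" "v \<in> jet_index m"
      "\<And>w. w \<in> jet_index m \<Longrightarrow> mdeg (snd w) < mdeg (snd v) \<Longrightarrow> x w = y w"
  proof -
    obtain i a where v: "v = (i, a)" by (cases v)
    let ?d = "mdeg a" and ?X = "fmap_of x" and ?Y = "fmap_of y"
    have XY: "agree ?d ?X ?Y" using xy by (intro agree_fmap_of[of _ m]) (auto simp: v)
    let ?q = "fcomp s ?X i - fcomp s ?Y i"
    have "ordge ?d ?q"
      using agree_fcomp_right[OF XY] s by (simp add: agree_def Ghat0_no_const)
    then have "ordge (Suc ?d) (msubst ?q (finv s) - ?q)"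
      by (rule ordge_msubst_leading[OF finv_Ghat0[OF s]])
    moreover have "ordge (Suc ?d) (?q - (?X i - ?Y i))"
      by (rule ordge_fcomp_left_leading[OF s _ _ XY]) auto
    ultimately have "mcoeff (msubst ?q (finv s)) a = mcoeff (?X i) a - mcoeff (?Y i) a"
      by (simp add: ordge_def)
    then have "mcoeff (fcomp (fcomp s ?X) (finv s) i) a - mcoeff (fcomp (fcomp s ?Y) (finv s) i) a
        = mcoeff (?X i) a - mcoeff (?Y i) a"
      by (simp add: fcomp_def msubst_diff)
    then show ?thesis using xy(3)
      by (simp add: v conj_act_coeff mcoeff_fmap_of algebra_simps)
  qed
  show "polyfn (\<lambda>z. conj_act m (\<sigma> z) x v)" if "pfam \<sigma>" for \<sigma> :: "(nat \<Rightarrow> complex) \<Rightarrow> 'a fmap"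
    using that by (intro conj_act_poly) auto
qed

global_interpretation left: triangular_action "jet0_index m" "\<lambda>w. mdeg (snd w)" "left_act m"
proof
  fix s s' :: "'a fmap" and x y :: "'a cindex \<Rightarrow> complex" and v :: "'a cindex"
  show "finite (jet0_index m :: 'a cindex set)" by (rule finite_jet0_index)
  show "left_act m s x \<in> cspace (jet0_index m)" by (simp add: left_act_def)
  show "left_act m mX x = x" if "x \<in> cspace (jet0_index m)"
    using that by (simp add: left_act_def jet0_diffeo fcomp_mX_left Ghat0_no_const)
  show "left_act m (fcomp s s') x = left_act m s (left_act m s' x)" if "s \<in> Ghat0" "s' \<in> Ghat0"
    using that unfolding left_act_def fcomp_assoc[OF Ghat0_no_const[OF that(2)] Ghat0_no_const[OF diffeo_Ghat0]]
    by (intro jet0_eqI agree_fcomp_right agree_sym[OF agree_diffeo_jet0] Ghat0_no_const Ghat0_fcomp) auto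
  show "left_act m s x v - x v = left_act m s y v - y v"
    if s: "s \<in> Ghat0" and xy: "x \<in> cspace (jet0_index m)" "y \<in> cspace (jet0_index m)" "v \<in> jet0_index m"
      "\<And>w. w \<in> jet0_index m \<Longrightarrow> mdeg (snd w) < mdeg (snd v) \<Longrightarrow> x w = y w"
  proof -
    obtain i a where v: "v = (i, a)" by (cases v)
    have "agree (mdeg a) (diffeo x) (diffeo y)" using xy by (intro agree_diffeo[of _ m]) (auto simp: v)
    from ordge_fcomp_left_leading[OF s _ _ this, of i]
    have "mcoeff (fcomp s (diffeo x) i) a - mcoeff (fcomp s (diffeo y) i) a
        = mcoeff (diffeo x i) a - mcoeff (diffeo y i) a"
      by (simp add: ordge_def)
    then show ?thesis using xy(3)
      by (simp add: v left_act_coeff mcoeff_diffeo algebra_simps)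
  qed
  show "polyfn (\<lambda>z. left_act m (\<sigma> z) x v)" if "pfam \<sigma>" for \<sigma> :: "(nat \<Rightarrow> complex) \<Rightarrow> 'a fmap"
    using that by (intro left_act_poly) auto
qed

text \<open>The jet of \<open>h\<inverse> \<circ> N \<circ> h\<close>, with \<open>f = h\<inverse> \<circ> N \<circ> h\<close> obtained as the solution of \<open>h \<circ> f = N \<circ> h\<close>, an
  equation in which the weights of the coefficients are visible.\<close>

definition conj_map :: "nat \<Rightarrow> 'n::finite fmap \<Rightarrow> ('n cindex \<Rightarrow> complex) \<Rightarrow> 'n cindex \<Rightarrow> complex" where
  "conj_map m N x = jet m (solve (diffeo x) (fcomp N (diffeo x)))"

definition jet_stabilizer :: "nat \<Rightarrow> 'n::finite fmap \<Rightarrow> 'n fmap set" where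
  "jet_stabilizer m N = {s \<in> Ghat0. conj_act m s (jet m N) = jet m N}"

lemma conj_orbit_eq: "conj_orbit N = {fcomp (fcomp (finv h) N) h |h. h \<in> Ghat0}"
  by (auto simp: conj_orbit_def) (metis Ghat_inv)+

context
  fixes N :: "'n::finite fmap" and m :: nat
  assumes N: "no_const N"
begin

lemma jet_conj_orbit: "jet m ` conj_orbit N = (\<lambda>s. conj_act m s (jet m N)) ` Ghat0"
proof (intro equalityI subsetI)
  fix y assume "y \<in> jet m ` conj_orbit N"
  then obtain h where "h \<in> Ghat0" "y = jet m (fcomp (fcomp (finv h) N) h)"
    by (auto simp: conj_orbit_eq)
  then have "y = conj_act m (finv h) (jet m N)"
    using N by (simp add: conj_act_jet finv_Ghat0 finv_finv)
  then show "y \<in> (\<lambda>s. conj_act m s (jet m N)) ` Ghat0" using \<open>h \<in> Ghat0\<close> finv_Ghat0 by blast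
next
  fix y assume "y \<in> (\<lambda>s. conj_act m s (jet m N)) ` Ghat0"
  then obtain s where s: "s \<in> Ghat0" "y = jet m (fcomp (fcomp s N) (finv s))"
    using N by (auto simp: conj_act_jet)
  then have "fcomp (fcomp s N) (finv s) \<in> conj_orbit N"
    unfolding conj_orbit_eq using s(1) by (intro CollectI exI[of _ "finv s"]) simp
  then show "y \<in> jet m ` conj_orbit N" using s by blast
qed

lemma conj_map_eq: "conj_map m N x = conj_act m (finv (diffeo x)) (jet m N)"
  using N finv_Ghat0[OF diffeo_Ghat0]
  by (simp add: conj_map_def solve_eq conj_act_jet finv_finv no_const_fcomp Ghat0_no_const fcomp_assoc)

lemma conj_act_conj_map: "conj_act m (diffeo x) (conj_map m N x) = jet m N"
  unfolding conj_map_eq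
  by (simp add: conj.act_fcomp[symmetric] finv_Ghat0 fcomp_finv conj.act_mX)

lemma conj_map_eq_iff:
  assumes "y \<in> cspace (jet_index m)"
  shows "conj_map m N x = y \<longleftrightarrow> conj_act m (diffeo x) y = jet m N"
proof
  assume "conj_act m (diffeo x) y = jet m N"
  then have "conj_map m N x = conj_act m (fcomp (finv (diffeo x)) (diffeo x)) y"
    unfolding conj_map_eq using assms by (simp add: conj.act_fcomp finv_Ghat0)
  then show "conj_map m N x = y" using assms by (simp add: finv_fcomp conj.act_mX)
qed (use conj_act_conj_map in auto)

lemma conj_map_onto: "conj_map m N ` cspace (jet0_index m) = jet m ` conj_orbit N"
  unfolding jet_conj_orbit
proof (intro equalityI subsetI)
  fix y assume "y \<in> (\<lambda>s. conj_act m s (jet m N)) ` Ghat0"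
  then obtain s where s: "s \<in> Ghat0" "y = conj_act m s (jet m N)" by blast
  have "conj_map m N (jet0 m (finv s)) = y" unfolding conj_map_eq s
    by (rule conj_act_cong)
      (use s finv_Ghat0 agree_finv[OF _ _ agree_diffeo_jet0[OF finv_Ghat0[OF s(1)]]] in \<open>auto simp: finv_finv\<close>)
  then show "y \<in> conj_map m N ` cspace (jet0_index m)" by (metis imageI jet0_cspace)
qed (use conj_map_eq finv_Ghat0 diffeo_Ghat0 in blast)

text \<open>A coefficient of degree \<open>d\<close> of the conjugate has weight at most \<open>d - 1\<close> in the coefficients of the
  conjugating map, each of which has weight at least 1.\<close>

lemma conj_map_pdeg: assumes "m \<ge> 1" shows "pdeg m (\<lambda>x. conj_map m N x v)"
proof (cases "v \<in> jet_index m")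
  case True
  obtain i a where v: "v = (i, a)" by (cases v)
  have d: "wser 1 (\<lambda>x. diffeo x j)" for j :: 'n
    unfolding wser_def
  proof (intro conjI allI)
    show "ordge 1 (diffeo x j)" for x
      by (rule no_const_iff[THEN iffD1, rule_format]) simp
    fix a :: "'n mono"
    show "pdeg (mdeg a - 1) (\<lambda>z. mcoeff (diffeo z j) a)"
    proof (cases "mdeg a < 2")
      case False
      then show ?thesis by (simp add: diffeo_def) (rule pdeg_mono[OF pdeg_coord], simp)
    qed (simp add: diffeo_def pdeg_const)
  qed
  have "wser 1 (\<lambda>x. fcomp N (diffeo x) j)" for j
    unfolding fcomp_def using N by (intro wser_msubst d wser_const) (simp add: no_const_iff)
  from wser_solve[OF d this, where a = a and i = i] have "pdeg m (\<lambda>x. mcoeff (solve (diffeo x) (fcomp N (diffeo x)) i) a)"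
    by (rule pdeg_mono) (use True in \<open>auto simp: v jet_index_def\<close>)
  then show ?thesis using True by (simp add: conj_map_def jet_def restr_def coeffs_def v)
qed (simp add: conj_map_def jet_def restr_def pdeg_const)

text \<open>A fiber of the orbit map is an orbit of the stabilizer acting by composition on the left.\<close>

lemma conj_map_fiber:
  assumes x: "x \<in> cspace (jet0_index m)"
  shows "{x' \<in> cspace (jet0_index m). conj_map m N x' = conj_map m N x} =
     (\<lambda>s. left_act m s x) ` jet_stabilizer m N"
proof (intro equalityI subsetI)
  let ?h = "diffeo x" and ?y = "conj_map m N x"
  have y: "?y \<in> cspace (jet_index m)" by (simp add: conj_map_def)
  fix x' assume x': "x' \<in> {x' \<in> cspace (jet0_index m). conj_map m N x' = conj_map m N x}"
  let ?s = "fcomp (diffeo x') (finv ?h)"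
  have s: "?s \<in> Ghat0" by (simp add: Ghat0_fcomp finv_Ghat0)
  have "conj_act m ?s (jet m N) = conj_act m (diffeo x') ?y"
    unfolding conj_map_eq by (simp add: conj.act_fcomp finv_Ghat0)
  then have "?s \<in> jet_stabilizer m N"
    using s x' conj_act_conj_map[of x'] by (simp add: jet_stabilizer_def)
  moreover have "left_act m ?s x = x'"
    using x' by (simp add: left_act_def fcomp_assoc Ghat0_no_const finv_Ghat0 finv_fcomp jet0_diffeo)
  ultimately show "x' \<in> (\<lambda>s. left_act m s x) ` jet_stabilizer m N" by (metis imageI)
next
  let ?h = "diffeo x" and ?y = "conj_map m N x"
  have y: "?y \<in> cspace (jet_index m)" by (simp add: conj_map_def)
  fix x' assume "x' \<in> (\<lambda>s. left_act m s x) ` jet_stabilizer m N"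
  then obtain s where s: "s \<in> Ghat0" "conj_act m s (jet m N) = jet m N" "x' = jet0 m (fcomp s ?h)"
    by (auto simp: jet_stabilizer_def left_act_def)
  have "conj_act m (diffeo x') ?y = conj_act m (fcomp s ?h) ?y"
    using s by (intro conj_act_cong) (auto simp: Ghat0_fcomp agree_diffeo_jet0)
  also have "\<dots> = jet m N" using s y by (simp add: conj.act_fcomp conj_act_conj_map)
  finally show "x' \<in> {x' \<in> cspace (jet0_index m). conj_map m N x' = conj_map m N x}"
    using y s by (simp add: conj_map_eq_iff)
qed

lemma power_group_jet_stabilizer: "power_group (jet_stabilizer m N)"
  unfolding jet_stabilizer_def by (rule conj.power_group_stabilizer) simp

lemma orbit_cell: "\<exists>r. affine_cell (jet_index m) (jet m ` conj_orbit N) r"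
  unfolding jet_conj_orbit
  by (rule conj.orbit_parametrization[OF power_group_Ghat0 jet_cspace]) (rule exI)

lemma fiber_cell:
  assumes "y \<in> jet m ` conj_orbit N"
  shows "\<exists>l. affine_cell (jet0_index m) {x \<in> cspace (jet0_index m). conj_map m N x = y} l"
proof -
  obtain x where x: "x \<in> cspace (jet0_index m)" "y = conj_map m N x"
    using assms by (auto simp: conj_map_onto[symmetric])
  show ?thesis unfolding x(2) conj_map_fiber[OF x(1)]
    by (rule left.orbit_parametrization[OF power_group_jet_stabilizer x(1)]) (rule exI)
qed

text \<open>Two fibers differ by composition on the right.\<close>

lemma fibers_isomorphic:
  assumes "y \<in> jet m ` conj_orbit N" "z \<in> jet m ` conj_orbit N"
  shows "alg_isomorphic {x \<in> cspace (jet0_index m). conj_map m N x = y}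
           {x \<in> cspace (jet0_index m). conj_map m N x = z}"
proof -
  define V where "V y = {x \<in> cspace (jet0_index m). conj_map m N x = y}" for y
  \<comment> \<open>Right translation by \<open>k\<close> carries the fiber over \<open>y\<close> to the fiber over \<open>k\<inverse> y k\<close>.\<close>
  define R where "R k x = jet0 m (fcomp (diffeo x) k)" for k :: "'n fmap" and x
  have R: "R k x \<in> V (conj_act m (finv k) y)" if "k \<in> Ghat0" "x \<in> V y" for k x y
  proof -
    have y: "y \<in> cspace (jet_index m)" using that by (auto simp: V_def conj_map_def)
    have "conj_act m (diffeo (R k x)) (conj_act m (finv k) y) =
        conj_act m (fcomp (diffeo x) k) (conj_act m (finv k) y)"
      using that by (intro conj_act_cong) (auto simp: R_def Ghat0_fcomp agree_diffeo_jet0)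
    also have "\<dots> = conj_act m (diffeo x) (conj_act m (fcomp k (finv k)) y)"
      using that y by (simp add: conj.act_fcomp finv_Ghat0 conj.act_cspace)
    also have "\<dots> = jet m N"
      using that y conj_act_conj_map[of x] by (simp add: fcomp_finv conj.act_mX V_def) 
    finally show ?thesis
      using that y by (simp add: V_def conj_map_eq_iff conj.act_cspace finv_Ghat0) (simp add: R_def)
  qed
  have RR: "R k' (R k x) = x" if "k \<in> Ghat0" "k' \<in> Ghat0" "fcomp k k' = mX" "x \<in> V y" for k k' x y
  proof -
    have "R k' (R k x) = jet0 m (fcomp (fcomp (diffeo x) k) k')" unfolding R_def
      using that by (intro jet0_eqI agree_fcomp_left agree_diffeo_jet0 Ghat0_fcomp) (auto simp: Ghat0_no_const)
    then show ?thesis using that by (simp add: fcomp_assoc Ghat0_no_const jet0_diffeo V_def)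
  qed
  have poly: "poly_map_on W (R k)" for k W
    unfolding R_def by (intro poly_map_onI polyfn_jet0 pfam_fcomp pfam_diffeo) auto
  obtain s s' where s: "s \<in> Ghat0" "y = conj_act m s (jet m N)" "s' \<in> Ghat0" "z = conj_act m s' (jet m N)"
    using assms by (auto simp: jet_conj_orbit)
  define k where "k = fcomp s (finv s')"
  have k: "k \<in> Ghat0" "finv k \<in> Ghat0" by (auto simp: k_def s Ghat0_fcomp finv_Ghat0)
  have kz: "conj_act m k z = y"
    using s by (simp add: k_def conj.act_fcomp[symmetric] Ghat0_fcomp finv_Ghat0 fcomp_assoc
        Ghat0_no_const finv_fcomp)
  have z: "z \<in> cspace (jet_index m)" using s conj.act_cspace jet_cspace by blast
  then have ky: "conj_act m (finv k) y = z"
    using k by (simp add: kz[symmetric] conj.act_fcomp[symmetric] finv_fcomp conj.act_mX)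
  have 1: "\<forall>x\<in>V y. R k x \<in> V z" using R[OF k(1), of _ y] by (simp add: ky)
  have 2: "\<forall>x\<in>V z. R (finv k) x \<in> V y" using R[OF k(2), of _ z] by (simp add: kz finv_finv k)
  have "alg_isomorphic (V y) (V z)" unfolding alg_isomorphic_def
    by (intro exI[of _ "R k"] exI[of _ "R (finv k)"] conjI poly ballI image_subsetI)
      (use 1 2 k RR in \<open>auto simp: fcomp_finv finv_fcomp\<close>)
  then show ?thesis by (simp add: V_def)
qed

text \<open>Writing an element of the group as a point of the section supplied by the orbit times an element
  of the stabilizer identifies the product of orbit and stabilizer with the group, which is an
  affine space of known dimension.\<close>

lemma orbit_stabilizer_dim:
  assumes "y \<in> jet m ` conj_orbit N"
  shows "variety_dim (jet m ` conj_orbit N) +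
     variety_dim {x \<in> cspace (jet0_index m). conj_map m N x = y} = card (jet0_index m :: 'n cindex set)"
proof -
  let ?n = "jet m N" and ?S = "jet_stabilizer m N" and ?o = "\<lambda>_. 0 :: complex"
  let ?J = "jet0_index m :: 'n cindex set"
  obtain r \<sigma> G where o: "pfam \<sigma>" "\<forall>z. \<sigma> z \<in> Ghat0" "\<forall>k. polyfn (\<lambda>y. G y k)" "\<forall>y. G y \<in> cspace {..<r}"
    "\<forall>z\<in>cspace {..<r}. G (conj_act m (\<sigma> z) ?n) = z"
    "\<forall>s\<in>Ghat0. conj_act m (\<sigma> (G (conj_act m s ?n))) ?n = conj_act m s ?n"
    "affine_cell (jet_index m) ((\<lambda>s. conj_act m s ?n) ` Ghat0) r"
    by (rule conj.orbit_parametrization[OF power_group_Ghat0 jet_cspace[of m N]]) (rule that)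
  note \<sigma> = o(1) o(2)[rule_format] and G = o(3,4)[rule_format] and GF = o(5)[rule_format]
    and FG = o(6)[rule_format] and cell = o(7)
  obtain l \<sigma>' G' where o': "pfam \<sigma>'" "\<forall>z. \<sigma>' z \<in> ?S" "\<forall>k. polyfn (\<lambda>y. G' y k)" "\<forall>y. G' y \<in> cspace {..<l}"
    "\<forall>z\<in>cspace {..<l}. G' (left_act m (\<sigma>' z) ?o) = z"
    "\<forall>s\<in>?S. left_act m (\<sigma>' (G' (left_act m s ?o))) ?o = left_act m s ?o"
    "affine_cell ?J ((\<lambda>s. left_act m s ?o) ` ?S) l"
    by (rule left.orbit_parametrization[OF power_group_jet_stabilizer zero_in_cspace(1)]) (rule that)
  note \<sigma>' = o'(1) o'(2)[rule_format] and G' = o'(3,4)[rule_format] and GF' = o'(5)[rule_format]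
    and FG' = o'(6)[rule_format] and cell' = o'(7)
  have S: "s \<in> Ghat0" "conj_act m s ?n = ?n" if "s \<in> ?S" for s using that by (auto simp: jet_stabilizer_def)
  have left0: "left_act m s ?o = jet0 m s" for s :: "'n fmap" by (simp add: left_act_def)
  \<comment> \<open>The first \<open>r\<close> coordinates parametrize the orbit, the following \<open>l\<close> the stabilizer.\<close>
  define a where "a z = restr {..<r} z" for z :: "nat \<Rightarrow> complex"
  define b where "b z = (\<lambda>k. if k < l then z (k + r) else 0)" for z :: "nat \<Rightarrow> complex"
  define \<Phi> where "\<Phi> z = jet0 m (fcomp (\<sigma> (a z)) (\<sigma>' (b z)))" for z
  define t where "t u = G (conj_act m (diffeo u) ?n)" for u
  define t' where "t' u = G' (left_act m (finv (\<sigma> (t u))) u)" for u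
  define \<Gamma> where "\<Gamma> u = (\<lambda>k. if k < r then t u k else t' u (k - r))" for u
  have ab: "a z \<in> cspace {..<r}" "b z \<in> cspace {..<l}" for z unfolding a_def by (auto simp: b_def cspace_def restr_def)
  have "polyfn (\<lambda>z. a z v)" "polyfn (\<lambda>z. b z v)" for v
    unfolding a_def b_def by (intro polyfn_restr polyfn_if polyfn_coord polyfn_const)+
  then have "polyfn (\<lambda>z. \<Phi> z v)" for v unfolding \<Phi>_def
    by (intro polyfn_jet0 pfam_fcomp pfam_subst[OF \<sigma>(1)] pfam_subst[OF \<sigma>'(1)])
  moreover have "polyfn (\<lambda>u. \<Gamma> u k)" for k
  proof -
    have t: "polyfn (\<lambda>u. t u k)" for k unfolding t_def
      by (intro polyfn_subst[OF G(1)] conj_act_poly pfam_diffeo) auto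
    have "polyfn (\<lambda>u. t' u k)" for k unfolding t'_def
      by (intro polyfn_subst[OF G'(1)] left_act_poly pfam_finv pfam_subst[OF \<sigma>(1)] t polyfn_coord)
    with t show ?thesis unfolding \<Gamma>_def by (intro polyfn_if)
  qed
  moreover have "\<Gamma> u \<in> cspace {..<r + l}" for u
    using G'(2)[of "left_act m (finv (\<sigma> (t u))) u"] by (auto simp: \<Gamma>_def t'_def cspace_def)
  moreover have "\<Gamma> (\<Phi> z) = z" if z: "z \<in> cspace {..<r + l}" for z
  proof -
    let ?g = "\<sigma> (a z)" and ?s = "\<sigma>' (b z)"
    have gs: "?g \<in> Ghat0" "?s \<in> Ghat0" "conj_act m ?s ?n = ?n" using \<sigma> \<sigma>' S by blast+
    have eq: "agree (Suc m) (diffeo (\<Phi> z)) (fcomp ?g ?s)"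
      unfolding \<Phi>_def by (intro agree_diffeo_jet0 Ghat0_fcomp gs)
    have "conj_act m (diffeo (\<Phi> z)) ?n = conj_act m (fcomp ?g ?s) ?n"
      by (intro conj_act_cong eq) (auto simp: gs Ghat0_fcomp)
    then have t: "t (\<Phi> z) = a z" using gs by (simp add: t_def conj.act_fcomp GF ab)
    have "left_act m (finv ?g) (\<Phi> z) = jet0 m (fcomp (finv ?g) (fcomp ?g ?s))"
      unfolding left_act_def using gs
      by (intro jet0_eqI agree_fcomp_right eq) (auto simp: Ghat0_no_const Ghat0_fcomp finv_Ghat0)
    also have "\<dots> = left_act m ?s ?o"
      using gs by (simp add: left0 fcomp_assoc[symmetric] Ghat0_no_const finv_Ghat0 finv_fcomp fcomp_mX_left)
    finally have "t' (\<Phi> z) = b z" by (simp add: t'_def t GF' ab)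
    with t z show ?thesis by (auto simp: \<Gamma>_def a_def b_def restr_def cspace_def fun_eq_iff)
  qed
  moreover have "u \<in> \<Phi> ` cspace {..<r + l}" if u: "u \<in> cspace ?J" for u
  proof -
    let ?g = "\<sigma> (t u)"
    let ?s = "fcomp (finv ?g) (diffeo u)"
    have g: "?g \<in> Ghat0" "finv ?g \<in> Ghat0" "?s \<in> Ghat0" using \<sigma> by (auto simp: finv_Ghat0 Ghat0_fcomp)
    have "conj_act m ?g ?n = conj_act m (diffeo u) ?n" unfolding t_def by (rule FG) simp
    then have "conj_act m ?s ?n = conj_act m (fcomp (finv ?g) ?g) ?n"
      using g by (simp add: conj.act_fcomp)
    then have "?s \<in> ?S" using g by (simp add: jet_stabilizer_def finv_fcomp conj.act_mX)
    then have "jet0 m (\<sigma>' (t' u)) = jet0 m ?s"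
      using FG'[of ?s] by (simp add: left0 t'_def) (simp add: left_act_def)
    then have "agree (Suc m) (\<sigma>' (t' u)) ?s" using g \<sigma>' S by (intro agree_if_jet0_eq) auto
    then have "jet0 m (fcomp ?g (\<sigma>' (t' u))) = jet0 m (fcomp ?g ?s)"
      using g \<sigma>' S by (intro jet0_eqI agree_fcomp_right) (auto simp: Ghat0_no_const)
    also have "\<dots> = u"
      using g u by (simp add: fcomp_assoc[symmetric] Ghat0_no_const fcomp_finv fcomp_mX_left jet0_diffeo)
    finally have "jet0 m (fcomp ?g (\<sigma>' (t' u))) = u" .
    moreover have "a (\<Gamma> u) = t u" "b (\<Gamma> u) = t' u"
      using G(2) G'(2) by (auto simp: a_def b_def \<Gamma>_def t_def t'_def restr_def cspace_def fun_eq_iff)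
    ultimately have "\<Phi> (\<Gamma> u) = u" by (simp add: \<Phi>_def)
    then show ?thesis using \<open>\<Gamma> u \<in> cspace {..<r + l}\<close> by (metis imageI)
  qed
  moreover have "\<Phi> z \<in> cspace ?J" for z by (simp add: \<Phi>_def)
  ultimately have "affine_cell ?J (cspace ?J) (r + l)" unfolding affine_cell_def
    by (intro exI[of _ \<Phi>] exI[of _ \<Gamma>]) auto
  then have rl: "r + l = card ?J"
    using affine_cell_cspace[OF finite_jet0_index] affine_cell_dim by metis
  have "conj_map m N ?o = ?n" by (simp add: conj_map_eq conj.act_mX)
  then have "variety_dim {x \<in> cspace ?J. conj_map m N x = ?n} = l"
    using conj_map_fiber[of ?o] affine_cell_dim[OF cell'] by simp
  moreover have "?n \<in> jet m ` conj_orbit N"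
    unfolding jet_conj_orbit by (rule image_eqI[of _ _ mX]) (auto simp: conj.act_mX)
  ultimately have "variety_dim {x \<in> cspace ?J. conj_map m N x = y} = l"
    using variety_dim_alg_isomorphic[OF fibers_isomorphic[OF assms, of ?n]] by simp
  with affine_cell_dim[OF cell] rl show ?thesis by (simp add: jet_conj_orbit)
qed

end


section \<open>Linear coordinates\<close>

lemma sum_cscale_apply: "(\<Sum>j\<in>A. cscale (u j) (b j)) v = (\<Sum>j\<in>A. u j * b j v)"
  by (induction A rule: infinite_finite_induct) (auto simp: cscale_def)

lemma restr_eq_sum:
  assumes "finite K" shows "restr K x = (\<Sum>k\<in>K. cscale (x k) (\<lambda>v. if v = k then 1 else 0))"
  using assms by (auto simp: fun_eq_iff sum_cscale_apply restr_def if_distrib[where f = "(*) _"] cong: if_cong)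

lemma linear_restr_polyfn:
  assumes "Vector_Spaces.linear cscale cscale L" "finite K"
  shows "polyfn (\<lambda>x. L (restr K x) w)"
  unfolding restr_eq_sum[OF assms(2)] cfun_pair.linear_sum[OF assms(1)] cfun_pair.linear_scale[OF assms(1)] sum_cscale_apply
  by (intro polyfn_sum polyfn_mult) auto

lemma affine_isoE:
  assumes "affine_iso T I S"
  obtains c L where "Vector_Spaces.linear cscale cscale L" "T = (\<lambda>x. c + L x)" "bij_betw T (cspace I) S"
  using assms unfolding affine_iso_def by blast

text \<open>A linear embedding of a finite-dimensional space has a linear left inverse, and linear functions of
  finitely many coordinates are polynomial.\<close>

lemma affine_iso_imp_cell:
  assumes T: "affine_iso T {..<l} V" and V: "V \<subseteq> cspace J" "finite J"
  shows "affine_cell J V l"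
proof -
  from T obtain c L where L: "Vector_Spaces.linear cscale cscale L" and Tc: "T = (\<lambda>x. c + L x)"
    and bij: "bij_betw T (cspace {..<l}) V" by (rule affine_isoE)
  have "inj_on L (cspace {..<l})" using bij by (auto simp: bij_betw_def inj_on_def Tc)
  then obtain g where g: "range g \<subseteq> cspace {..<l}" "Vector_Spaces.linear cscale cscale g"
    "\<forall>x\<in>cspace {..<l}. g (L x) = x"
    using cfun_pair.linear_exists_left_inverse_on[OF L subspace_cspace] by blast
  define F where "F z = T (restr {..<l} z)" for z
  define G where "G y = g (restr J (y - c))" for y
  have TV: "T z \<in> V" if "z \<in> cspace {..<l}" for z using bij that by (auto simp: bij_betw_def)
  have c: "c \<in> cspace J" using TV[of 0] V by (auto simp: Tc cfun_pair.linear_0[OF L])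
  have Lc: "L z \<in> cspace J" if "z \<in> cspace {..<l}" for z
    using TV[OF that] V c by (fastforce simp: Tc cspace_def)
  have F: "F z = T z" if "z \<in> cspace {..<l}" for z using that by (simp add: F_def restr_cspace)
  have "F ` cspace {..<l} = V" using bij F by (auto simp: bij_betw_def image_def)
  moreover have "G (F z) = z" if "z \<in> cspace {..<l}" for z
    using that g Lc by (simp add: F G_def Tc restr_cspace)
  moreover have "polyfn (\<lambda>z. F z v)" for v
    unfolding F_def Tc plus_fun_def
    using linear_restr_polyfn[OF L, of "{..<l}"] by (intro polyfn_add) auto
  moreover have "polyfn (\<lambda>y. G y k)" for k
  proof -
    have "polyfn (\<lambda>y. (y - c) v)" for v unfolding fun_diff_def by (intro polyfn_diff) auto
    then have "polyfn (\<lambda>y. g (restr J (y - c)) k)"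
      using polyfn_subst[OF linear_restr_polyfn[OF g(2) V(2)], of "\<lambda>y. y - c" k] by blast
    then show ?thesis by (simp add: G_def)
  qed
  moreover have "G y \<in> cspace {..<l}" for y using g(1) by (auto simp: G_def)
  ultimately show ?thesis unfolding affine_cell_def
    using V(1) by (intro exI[of _ F] exI[of _ G]) auto
qed

lemma affine_iso_imp_affine_subspace:
  assumes "affine_iso T {..<l} V" shows "affine_subspace V l"
proof -
  from assms obtain c L where L: "Vector_Spaces.linear cscale cscale L" and Tc: "T = (\<lambda>x. c + L x)"
    and bij: "bij_betw T (cspace {..<l}) V" by (rule affine_isoE)
  have inj: "inj_on L (cspace {..<l})" using bij by (auto simp: bij_betw_def inj_on_def Tc)
  have "V = (\<lambda>w. c + w) ` L ` cspace {..<l}"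
    using bij by (simp add: bij_betw_def Tc image_image)
  then show ?thesis unfolding affine_subspace_def
    using dim_image_inj[OF L inj subspace_cspace] cfun_pair.linear_subspace_image[OF L subspace_cspace]
    by (intro exI[of _ c] exI[of _ "L ` cspace {..<l}"]) (simp add: dim_cspace)
qed

lemma linear_iso_imp_subspace:
  assumes "linear_iso L {..<l} V" shows "cfun.subspace V \<and> cfun.dim V = l"
proof -
  have L: "Vector_Spaces.linear cscale cscale L" and bij: "bij_betw L (cspace {..<l}) V"
    using assms by (auto simp: linear_iso_def)
  have "V = L ` cspace {..<l}" "inj_on L (cspace {..<l})" using bij by (auto simp: bij_betw_def)
  then show ?thesis
    using dim_image_inj[OF L _ subspace_cspace] cfun_pair.linear_subspace_image[OF L subspace_cspace]
    by (simp add: dim_cspace)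
qed

lemma finite_dim_coordinates:
  assumes W: "cfun.subspace W" "W \<subseteq> cspace K" "finite K"
  shows "\<exists>B. (\<forall>j. B j \<in> W) \<and>
     bij_betw (\<lambda>t v. \<Sum>j<cfun.dim W. t j * B j v) (cspace {..<cfun.dim W}) W"
proof -
  let ?n = "cfun.dim W"
  obtain Bs where Bs: "Bs \<subseteq> W" "cfun.independent Bs" "W \<subseteq> cfun.span Bs" "card Bs = ?n"
    using cfun.basis_exists[of W] by blast
  define e where "e k = (\<lambda>v. if v = k then 1 else 0 :: complex)" for k :: 'a
  have "W \<subseteq> cfun.span (e ` K)"
  proof
    fix x assume "x \<in> W"
    then have "x = (\<Sum>k\<in>K. cscale (x k) (e k))"
      using restr_eq_sum[OF W(3), of x] restr_cspace[of x K] W(2) by (auto simp: e_def)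
    also have "\<dots> \<in> cfun.span (e ` K)"
      by (intro cfun.span_sum cfun.span_scale cfun.span_base) auto
    finally show "x \<in> cfun.span (e ` K)" .
  qed
  then have fin: "finite Bs"
    using cfun.independent_span_bound[of "e ` K" Bs] Bs W(3) by auto
  then obtain b where b: "bij_betw b {..<?n} Bs"
    using ex_bij_betw_nat_finite[of Bs] Bs by (auto simp: atLeast0LessThan)
  define B where "B j = (if j < ?n then b j else 0)" for j
  have BW: "B j \<in> W" for j
    using bij_betwE[OF b] Bs cfun.subspace_0[OF W(1)] by (auto simp: B_def)
  define T where "T t = (\<Sum>j<?n. cscale (t j) (b j))" for t
  have T: "(\<lambda>t v. \<Sum>j<?n. t j * B j v) = T"
    by (simp add: fun_eq_iff T_def sum_cscale_apply B_def)
  have reidx: "T t = (\<Sum>w\<in>Bs. cscale (t (inv_into {..<?n} b w)) w)" for t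
    unfolding T_def using bij_betw_inv_into_left[OF b]
    by (intro sum.reindex_bij_betw[OF b, symmetric, THEN trans] trans[OF _ sum.reindex_bij_betw[OF b]] sum.cong) auto
  have ind: "(\<Sum>v\<in>Bs. cscale (u v) v) = 0 \<Longrightarrow> \<forall>v\<in>Bs. u v = 0" for u
    using Bs(2) cfun.dependent_finite[OF fin] by blast
  have "inj_on T (cspace {..<?n})"
  proof (rule inj_onI)
    fix t t' assume t: "t \<in> cspace {..<?n}" "t' \<in> cspace {..<?n}" "T t = T t'"
    have "(\<Sum>w\<in>Bs. cscale (t (inv_into {..<?n} b w) - t' (inv_into {..<?n} b w)) w) = 0"
      using t(3) by (simp add: reidx cfun.scale_left_diff_distrib sum_subtractf)
    then have *: "\<forall>w\<in>Bs. t (inv_into {..<?n} b w) - t' (inv_into {..<?n} b w) = 0"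
      by (rule ind[of "\<lambda>w. t (inv_into {..<?n} b w) - t' (inv_into {..<?n} b w)"])
    have "t j = t' j" if "j < ?n" for j
    proof -
      have "b j \<in> Bs" "inv_into {..<?n} b (b j) = j"
        using bij_betwE[OF b] bij_betw_inv_into_left[OF b, of j] that by auto
      then show ?thesis using *[rule_format, of "b j"] by simp
    qed
    then show "t = t'" using t by (auto simp: cspace_def fun_eq_iff) (metis)
  qed
  moreover have "T ` cspace {..<?n} = W"
  proof (intro equalityI subsetI)
    fix w assume "w \<in> T ` cspace {..<?n}"
    then show "w \<in> W" unfolding T_def
      using bij_betwE[OF b] Bs by (auto intro!: cfun.subspace_sum[OF W(1)] cfun.subspace_scale[OF W(1)])
  next
    fix w assume "w \<in> W"
    then obtain u where u: "w = (\<Sum>v\<in>Bs. cscale (u v) v)"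
      using Bs(3) cfun.span_finite[OF fin] by blast
    let ?t = "\<lambda>j. if j < ?n then u (b j) else 0"
    have "T ?t = (\<Sum>j<?n. cscale (u (b j)) (b j))" unfolding T_def by (rule sum.cong) auto
    also have "\<dots> = w" unfolding u by (rule sum.reindex_bij_betw[OF b])
    finally show "w \<in> T ` cspace {..<?n}" by (intro image_eqI[of _ _ ?t]) (auto simp: cspace_def)
  qed
  ultimately have "bij_betw (\<lambda>t v. \<Sum>j<?n. t j * B j v) (cspace {..<?n}) W"
    unfolding T by (simp add: bij_betw_def)
  with BW show ?thesis by blast
qed

text \<open>A space of coefficient families that is the product of its homogeneous components has
  coordinates compatible with truncation: concatenate bases of the components, in order of
  degree.\<close>

lemma graded_coordinates:
  fixes J :: "'v set" and rank :: "'v \<Rightarrow> nat" and lev :: "nat \<Rightarrow> 'v set"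
  defines "lev d \<equiv> {v \<in> J. rank v = d}"
  assumes Z: "cfun.subspace Z" "Z \<subseteq> cspace J" and fin: "\<And>d. finite (lev d)"
    and component: "\<And>x d. x \<in> Z \<Longrightarrow> restr (lev d) x \<in> Z"
    and assemble: "\<And>x. x \<in> cspace J \<Longrightarrow> (\<And>d. restr (lev d) x \<in> Z) \<Longrightarrow> x \<in> Z"
  obtains off :: "nat \<Rightarrow> nat" and \<psi> where "mono off" "Vector_Spaces.linear cscale cscale \<psi>"
    "bij_betw \<psi> (cspace {k. \<exists>d. k < off d}) Z"
    "\<forall>d t. \<forall>v. rank v \<le> d \<longrightarrow> \<psi> (restr {..<off (Suc d)} t) v = \<psi> t v"
    "\<forall>d. \<forall>t\<in>cspace {..<off (Suc d)}. \<forall>v. d < rank v \<longrightarrow> \<psi> t v = 0"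
proof -
  define W where "W d = Z \<inter> cspace (lev d)" for d
  define n where "n d = cfun.dim (W d)" for d
  have W: "cfun.subspace (W d)" for d
    unfolding W_def by (intro cfun.subspace_inter Z subspace_cspace)
  have "\<exists>B. (\<forall>j. B j \<in> W d) \<and> bij_betw (\<lambda>t v. \<Sum>j<n d. t j * B j v) (cspace {..<n d}) (W d)" for d
    unfolding n_def by (rule finite_dim_coordinates[OF W _ fin]) (auto simp: W_def)
  then have "\<exists>B. \<forall>d. (\<forall>j. B d j \<in> W d) \<and>
      bij_betw (\<lambda>t v. \<Sum>j<n d. t j * B d j v) (cspace {..<n d}) (W d)"
    by (intro choice allI)
  then obtain B where *: "\<forall>d. (\<forall>j. B d j \<in> W d) \<and>
      bij_betw (\<lambda>t v. \<Sum>j<n d. t j * B d j v) (cspace {..<n d}) (W d)"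
    by (rule exE)
  then have B: "B d j \<in> W d"
    and bij: "bij_betw (\<lambda>t v. \<Sum>j<n d. t j * B d j v) (cspace {..<n d}) (W d)" for d j
    by simp_all
  define T where "T d t = (\<lambda>v. \<Sum>j<n d. t j * B d j v)" for d t
  have T: "bij_betw (T d) (cspace {..<n d}) (W d)" for d using bij[of d] by (simp add: T_def[abs_def])
  define off where "off d = (\<Sum>e<d. n e)" for d
  have off_Suc: "off (Suc d) = off d + n d" and off_0: "off 0 = 0" for d by (auto simp: off_def)
  have mono: "mono off" by (rule incseq_SucI) (simp add: off_Suc)
  \<comment> \<open>The block of parameters of degree \<open>d\<close> starts at \<open>off d\<close> and has length \<open>n d\<close>.\<close>
  define cut where "cut d t = (\<lambda>j. if j < n d then t (off d + j) else 0)" for d and t :: "nat \<Rightarrow> complex"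
  define \<psi> where "\<psi> t = (\<lambda>v. if v \<in> J then T (rank v) (cut (rank v) t) v else 0)" for t
  have cut: "cut d t \<in> cspace {..<n d}" for d t by (auto simp: cut_def cspace_def)
  have TW: "T d s \<in> W d" if "s \<in> cspace {..<n d}" for d s
    using T[of d] that by (auto simp: bij_betw_def)
  have lev: "restr (lev d) (\<psi> t) = T d (cut d t)" for d t
  proof
    fix v show "restr (lev d) (\<psi> t) v = T d (cut d t) v"
      using TW[OF cut[of d t]] by (auto simp: restr_def \<psi>_def lev_def W_def cspace_def)
  qed
  have \<psi>Z: "\<psi> t \<in> Z" for t
    by (rule assemble) (use TW[OF cut] lev in \<open>auto simp: \<psi>_def cspace_def W_def\<close>)
  \<comment> \<open>\<open>bl k\<close> is the degree whose block of parameters contains the index \<open>k\<close>.\<close>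
  define bl where "bl k = (LEAST d. k < off (Suc d))" for k
  have bl_off: "bl (off d + j) = d" if "j < n d" for d j
    unfolding bl_def
  proof (rule Least_equality)
    fix e assume e: "off d + j < off (Suc e)"
    show "d \<le> e"
    proof (rule ccontr)
      assume "\<not> d \<le> e"
      then have "off (Suc e) \<le> off d" using monoD[OF mono] by simp
      with e show False by simp
    qed
  qed (use that in \<open>simp add: off_Suc\<close>)
  have blk: "\<exists>d j. k = off d + j \<and> j < n d" if k: "k < off d'" for k d'
  proof -
    obtain e where "d' = Suc e" using k off_0 by (cases d') auto
    then have 1: "k < off (Suc (bl k))" unfolding bl_def using k by (metis LeastI)
    have 2: "off (bl k) \<le> k"
    proof (cases "bl k")
      case (Suc e)
      then have "\<not> k < off (Suc e)" using not_less_Least[of e "\<lambda>d. k < off (Suc d)"] by (simp add: bl_def)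
      then show ?thesis using Suc by simp
    qed (simp add: off_0)
    show ?thesis using 1 2 by (intro exI[of _ "bl k"] exI[of _ "k - off (bl k)"]) (auto simp: off_Suc)
  qed
  have "inj_on \<psi> (cspace {k. \<exists>d. k < off d})"
  proof (rule inj_onI)
    fix t t' assume t: "t \<in> cspace {k. \<exists>d. k < off d}" "t' \<in> cspace {k. \<exists>d. k < off d}" "\<psi> t = \<psi> t'"
    have "cut d t = cut d t'" for d
      using lev[of d t] lev[of d t'] t(3) T[of d] cut by (metis bij_betw_def inj_onD)
    then have "t (off d + j) = t' (off d + j)" if "j < n d" for d j
      using that by (auto simp: cut_def fun_eq_iff) metis
    then have "t k = t' k" if "k < off d'" for k d' using blk[OF that] by blast
    moreover have "t k = t' k" if "\<not> (\<exists>d. k < off d)" for k using t(1,2) that by (auto simp: cspace_def)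
    ultimately show "t = t'" by blast
  qed
  moreover have "\<psi> ` cspace {k. \<exists>d. k < off d} = Z"
  proof (intro equalityI subsetI)
    fix x assume x: "x \<in> Z"
    define c where "c d = inv_into (cspace {..<n d}) (T d) (restr (lev d) x)" for d
    have "restr (lev d) x \<in> W d" for d using component[OF x] by (simp add: W_def)
    then have c: "c d \<in> cspace {..<n d}" "T d (c d) = restr (lev d) x" for d
      using T[of d] bij_betw_inv_into_right[OF T[of d]] bij_betwE[OF bij_betw_inv_into[OF T[of d]]]
      by (auto simp: c_def)
    define t where "t k = (if \<exists>d. k < off d then c (bl k) (k - off (bl k)) else 0)" for k
    have "cut d t = c d" for d
    proof
      fix j
      have "off d + j < off (Suc d)" if "j < n d" using that by (simp add: off_Suc)
      then show "cut d t j = c d j"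
        using c(1)[of d] bl_off[of j d] by (auto simp: cut_def t_def cspace_def)
    qed
    then have "restr (lev d) (\<psi> t) = restr (lev d) x" for d by (simp add: lev c)
    then have "\<psi> t v = x v" if "v \<in> J" for v
      using that by (metis (mono_tags, lifting) lev_def mem_Collect_eq restr_def)
    moreover have "\<psi> t v = x v" if "v \<notin> J" for v
      using that x Z by (auto simp: \<psi>_def cspace_def)
    ultimately have "\<psi> t = x" by blast
    moreover have "t \<in> cspace {k. \<exists>d. k < off d}" by (auto simp: t_def cspace_def)
    ultimately show "x \<in> \<psi> ` cspace {k. \<exists>d. k < off d}" by blast
  qed (use \<psi>Z in auto)
  moreover have "Vector_Spaces.linear cscale cscale \<psi>"
    by (rule linear_cscaleI)
      (auto simp: \<psi>_def T_def cut_def fun_eq_iff cscale_def distrib_right sum.distrib sum_distrib_left mult.assoc)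
  moreover have "\<psi> (restr {..<off (Suc d)} t) v = \<psi> t v" if "rank v \<le> d" for d t v
  proof -
    have "off (Suc (rank v)) \<le> off (Suc d)" using that monoD[OF mono] by simp
    then have "cut (rank v) (restr {..<off (Suc d)} t) = cut (rank v) t"
      by (auto simp: cut_def restr_def off_Suc)
    then show ?thesis by (simp add: \<psi>_def)
  qed
  moreover have "\<psi> t v = 0" if "t \<in> cspace {..<off (Suc d)}" "d < rank v" for d t v
  proof -
    have "off (Suc d) \<le> off (rank v)" using that monoD[OF mono] by simp
    then have "cut (rank v) t = (\<lambda>_. 0)" using that(1) by (auto simp: cut_def cspace_def)
    then show ?thesis by (simp add: \<psi>_def T_def)
  qed
  ultimately show ?thesis using mono by (intro that[of off \<psi>]) (auto simp: bij_betw_def)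
qed


section \<open>The commutant of a linear map\<close>

lemma mcoeff_matrix_map_fcomp:
  assumes "no_const G"
  shows "fcomp (matrix_map A) G i = (\<Sum>j\<in>UNIV. const_series (A $ i $ j) * G j)"
  by (simp add: fcomp_def matrix_map_def const_series_def[symmetric] msubst_sum msubst_const_mult msubst_mX assms)

lemma matrix_map_eq: "matrix_map A i = (\<Sum>j\<in>UNIV. const_series (A $ i $ j) * mX j)"
  by (simp add: matrix_map_def const_series_def)

lemma no_const_matrix_map [simp]: "no_const (matrix_map A)"
  by (simp add: no_const_def matrix_map_eq)

text \<open>A power product of linear forms is homogeneous.\<close>

lemma matrix_map_homogeneous: "mdeg a \<noteq> mdeg b \<Longrightarrow> mcoeff (mpw (matrix_map A) b) a = 0"
proof (induction b arbitrary: a rule: mono_induct)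
  case (add i b)
  have "mcoeff (matrix_map A i) c * mcoeff (mpw (matrix_map A) b) d = 0" if "c + d = a" for c d
  proof (cases "mdeg d = mdeg b")
    case True
    then have "mdeg c \<noteq> 1" using that add.prems by auto
    then have "mcoeff (mX j) c = 0" for j by auto
    then show ?thesis by (simp add: matrix_map_eq)
  qed (simp add: add.IH)
  then show ?case by (auto simp: mpw_add mcoeff_mult intro!: sum.neutral)
qed auto

text \<open>The maps tangent to the identity that commute with \<open>A\<close>, represented by their terms of degree at
  least 2. These form a linear space, because \<open>A\<close> commutes with the identity and composition with \<open>A\<close> is
  additive on either side.\<close>

definition commutant :: "complex ^ 'n ^ 'n \<Rightarrow> ('n::finite cindex \<Rightarrow> complex) set" where
  "commutant A = {x \<in> cspace higher_index.
     fcomp (fmap_of x) (matrix_map A) = fcomp (matrix_map A) (fmap_of x)}"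

lemma fmap_of_add: "fmap_of (x + y) = (\<lambda>i. fmap_of x i + fmap_of y i)"
  by (intro ext mfps_eqI) (auto simp: fmap_of_def)

lemma fmap_of_cscale: "fmap_of (cscale c x) = (\<lambda>i. const_series c * fmap_of x i)"
  by (intro ext mfps_eqI) (auto simp: fmap_of_def cscale_def)

lemma diffeo_eq: "x \<in> cspace higher_index \<Longrightarrow> diffeo x = (\<lambda>i. mX i + fmap_of x i)"
  by (intro ext mfps_eqI) (auto simp: diffeo_def fmap_of_def cspace_def higher_index_def)

lemma fcomp_diffeo:
  "x \<in> cspace higher_index \<Longrightarrow> no_const G \<Longrightarrow> fcomp (diffeo x) G = (\<lambda>i. G i + fcomp (fmap_of x) G i)"
  by (simp add: diffeo_eq fcomp_def msubst_add msubst_mX)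

lemma commutator_coeff:
  "mcoeff (fcomp (fmap_of x) (matrix_map A) i) a - mcoeff (fcomp (matrix_map A) (fmap_of x) i) a =
     (\<Sum>b | mdeg b = mdeg a. mcoeff (fmap_of x i) b * mcoeff (mpw (matrix_map A) b) a)
     - (\<Sum>j\<in>UNIV. A $ i $ j * mcoeff (fmap_of x j) a)"
proof -
  have "mcoeff (fcomp (fmap_of x) (matrix_map A) i) a =
      (\<Sum>b | mdeg b = mdeg a. mcoeff (fmap_of x i) b * mcoeff (mpw (matrix_map A) b) a)"
    unfolding fcomp_def mcoeff_msubst
    by (rule sum.mono_neutral_right) (auto simp: finite_mdeg_le matrix_map_homogeneous)
  then show ?thesis by (simp add: mcoeff_matrix_map_fcomp)
qed

text \<open>Composition with a linear map preserves degrees, so the commutation equation can be tested one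
  degree at a time.\<close>

lemma commutator_local:
  assumes "\<And>i b. mdeg b = mdeg a \<Longrightarrow> x (i, b) = y (i, b)"
    and "mcoeff (fcomp (fmap_of y) (matrix_map A) i) a = mcoeff (fcomp (matrix_map A) (fmap_of y) i) a"
  shows "mcoeff (fcomp (fmap_of x) (matrix_map A) i) a = mcoeff (fcomp (matrix_map A) (fmap_of x) i) a"
proof -
  have *: "mcoeff (fmap_of x i) b = mcoeff (fmap_of y i) b" if "mdeg b = mdeg a" for i b
    using assms(1)[OF that] by (simp add: fmap_of_def)
  have "mcoeff (fcomp (fmap_of x) (matrix_map A) i) a - mcoeff (fcomp (matrix_map A) (fmap_of x) i) a =
      mcoeff (fcomp (fmap_of y) (matrix_map A) i) a - mcoeff (fcomp (matrix_map A) (fmap_of y) i) a"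
    unfolding commutator_coeff by (simp add: *)
  then show ?thesis using assms(2) by simp
qed

lemma zero_in_commutant: "0 \<in> commutant A"
proof -
  have "fmap_of (0 :: 'a cindex \<Rightarrow> complex) = (\<lambda>_. 0)" by (intro ext mfps_eqI) (simp add: fmap_of_def)
  moreover have "fcomp (matrix_map A) (\<lambda>_. 0) i = 0" for i
    by (subst mcoeff_matrix_map_fcomp) (simp_all add: no_const_def)
  ultimately have "fcomp (fmap_of 0) (matrix_map A) i = fcomp (matrix_map A) (fmap_of 0) i" for i
    by (simp add: fcomp_def)
  then show ?thesis by (auto simp: commutant_def)
qed

lemma fcomp_matrix_map_add:
  "no_const F \<Longrightarrow> no_const G \<Longrightarrow>
    fcomp (matrix_map A) (\<lambda>i. F i + G i) i = fcomp (matrix_map A) F i + fcomp (matrix_map A) G i"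
  by (subst mcoeff_matrix_map_fcomp)
    (simp_all add: mcoeff_matrix_map_fcomp distrib_left sum.distrib no_const_def)

lemma commutant_subspace: "cfun.subspace (commutant A)"
proof (rule cfun.subspaceI)
  show "0 \<in> commutant A" by (rule zero_in_commutant)
  fix x y assume x: "x \<in> commutant A"
  show "cscale c x \<in> commutant A" for c
  proof -
    have "fcomp (fmap_of (cscale c x)) (matrix_map A) i = const_series c * fcomp (fmap_of x) (matrix_map A) i" for i
      by (simp add: fcomp_def fmap_of_cscale msubst_const_mult)
    moreover have "fcomp (matrix_map A) (fmap_of (cscale c x)) i = const_series c * fcomp (matrix_map A) (fmap_of x) i" for i
      by (simp add: mcoeff_matrix_map_fcomp) (simp add: fmap_of_cscale sum_distrib_left mult_ac)
    ultimately show ?thesis using x by (auto simp: commutant_def cspace_def cscale_def fun_eq_iff)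
  qed
  assume y: "y \<in> commutant A"
  have "fcomp (fmap_of (x + y)) (matrix_map A) i = fcomp (fmap_of x) (matrix_map A) i + fcomp (fmap_of y) (matrix_map A) i" for i
    by (simp add: fcomp_def fmap_of_add msubst_add)
  moreover have "fcomp (matrix_map A) (fmap_of (x + y)) i = fcomp (matrix_map A) (fmap_of x) i + fcomp (matrix_map A) (fmap_of y) i" for i
    unfolding fmap_of_add by (rule fcomp_matrix_map_add) auto
  ultimately show "x + y \<in> commutant A" using x y by (auto simp: commutant_def cspace_def fun_eq_iff)
qed

lemma restr_commutant_iff:
  assumes "x \<in> cspace higher_index"
  shows "restr {v \<in> higher_index. mdeg (snd v) = d} x \<in> commutant A \<longleftrightarrow>
    (\<forall>i a. mdeg a = d \<longrightarrow> mcoeff (fcomp (fmap_of x) (matrix_map A) i) a = mcoeff (fcomp (matrix_map A) (fmap_of x) i) a)"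
    (is "?y \<in> _ \<longleftrightarrow> ?R")
proof
  have eq: "?y (i, b) = x (i, b)" if "mdeg b = d" for i b
    using assms that by (auto simp: restr_def cspace_def)
  have eq0: "?y (i, b) = 0 (i, b)" if "mdeg b \<noteq> d" for i b
    using that by (auto simp: restr_def)
  show ?R if "?y \<in> commutant A"
  proof (intro allI impI)
    fix i and a :: "'a mono" assume a: "mdeg a = d"
    show "mcoeff (fcomp (fmap_of x) (matrix_map A) i) a = mcoeff (fcomp (matrix_map A) (fmap_of x) i) a"
      by (rule commutator_local[of a x ?y]) (use that a eq in \<open>auto simp: commutant_def\<close>)
  qed
  show "?y \<in> commutant A" if ?R
    unfolding commutant_def
  proof (intro CollectI conjI ext mfps_eqI)
    show "?y \<in> cspace higher_index" by (auto simp: cspace_def restr_def)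
    fix i a
    show "mcoeff (fcomp (fmap_of ?y) (matrix_map A) i) a = mcoeff (fcomp (matrix_map A) (fmap_of ?y) i) a"
    proof (cases "mdeg a = d")
      case True
      show ?thesis by (rule commutator_local[of a ?y x]) (use that True eq in auto)
    next
      case False
      show ?thesis
        by (rule commutator_local[of a ?y 0])
          (use False eq0 zero_in_commutant[of A] in \<open>auto simp: commutant_def\<close>)
    qed
  qed
qed

text \<open>Coordinates of the commutant adapted to the degree: the first \<open>off (Suc d)\<close> parameters describe
  the terms of degree at most \<open>d\<close>.\<close>

definition commutant_basis ::
  "complex ^ 'n ^ 'n \<Rightarrow> (nat \<Rightarrow> nat) \<Rightarrow> ((nat \<Rightarrow> complex) \<Rightarrow> 'n::finite cindex \<Rightarrow> complex) \<Rightarrow> bool" where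
  "commutant_basis A off \<psi> \<longleftrightarrow> mono off \<and> Vector_Spaces.linear cscale cscale \<psi> \<and>
     bij_betw \<psi> (cspace {k. \<exists>d. k < off d}) (commutant A) \<and>
     (\<forall>d t v. mdeg (snd v) \<le> d \<longrightarrow> \<psi> (restr {..<off (Suc d)} t) v = \<psi> t v) \<and>
     (\<forall>d. \<forall>t\<in>cspace {..<off (Suc d)}. \<forall>v. d < mdeg (snd v) \<longrightarrow> \<psi> t v = 0)"

lemma commutant_basis_exists: "\<exists>off \<psi>. commutant_basis A off \<psi>"
proof (rule graded_coordinates[of "commutant A" higher_index "\<lambda>v. mdeg (snd v)"])
  show "finite {v \<in> higher_index. mdeg (snd v) = d}" for d
    by (rule finite_subset[of _ "UNIV \<times> {a. mdeg a \<le> d}"]) (auto simp: finite_mdeg_le)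
  show "x \<in> commutant A" if "x \<in> cspace higher_index"
    "\<And>d. restr {v \<in> higher_index. mdeg (snd v) = d} x \<in> commutant A" for x
  proof -
    have "mcoeff (fcomp (fmap_of x) (matrix_map A) i) a = mcoeff (fcomp (matrix_map A) (fmap_of x) i) a" for i a
      using that(2)[of "mdeg a"] unfolding restr_commutant_iff[OF that(1)] by blast
    then show ?thesis using that(1) by (auto simp: commutant_def fun_eq_iff intro!: mfps_eqI)
  qed
  show "restr {v \<in> higher_index. mdeg (snd v) = d} x \<in> commutant A" if "x \<in> commutant A" for x d
  proof -
    have "x \<in> cspace higher_index" using that by (simp add: commutant_def)
    from restr_commutant_iff[OF this] show ?thesis using that by (auto simp: commutant_def)
  qed
  show "cfun.subspace (commutant A)" by (rule commutant_subspace)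
  show "commutant A \<subseteq> cspace higher_index" by (auto simp: commutant_def)
qed (unfold commutant_basis_def, blast)


section \<open>Linearizations\<close>

lemma coeffs0_cspace [simp]: "coeffs0 h \<in> cspace higher_index"
  by (simp add: coeffs0_def)

lemma diffeo_coeffs0:
  assumes "h \<in> Ghat0" shows "diffeo (coeffs0 h) = h"
proof (intro ext mfps_eqI)
  fix i a
  have "mcoeff (h i) a = mcoeff (mX i) a" if "mdeg a < 2"
    using assms that by (simp add: Ghat0_iff agree_iff del: mcoeff_simps)
  then show "mcoeff (diffeo (coeffs0 h) i) a = mcoeff (h i) a"
    by (cases "mdeg a < 2") (simp_all add: diffeo_def coeffs0_def coeffs_def restr_def higher_index_def)
qed

lemma coeffs0_diffeo: "x \<in> cspace higher_index \<Longrightarrow> coeffs0 (diffeo x) = x"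
  by (auto simp: diffeo_def coeffs0_def coeffs_def restr_def higher_index_def cspace_def fun_eq_iff)

lemma jet0_eq_restr: "jet0 m h = restr (jet0_index m) (coeffs0 h)"
  by (auto simp: jet0_def coeffs0_def restr_def jet0_index_def higher_index_def fun_eq_iff)

lemma agree_diffeo_iff:
  "agree (Suc m) (diffeo x) (diffeo y) \<longleftrightarrow> restr (jet0_index m) x = restr (jet0_index m) y"
  by (auto simp: agree_iff diffeo_def restr_def jet0_index_def fun_eq_iff)

lemma cspace_jet0_subset: "cspace (jet0_index m) \<subseteq> cspace higher_index"
  by (auto simp: cspace_def jet0_index_def higher_index_def)

lemma diffeo_commutes_iff:
  assumes "x \<in> cspace higher_index"
  shows "fcomp (diffeo x) (matrix_map A) = fcomp (matrix_map A) (diffeo x) \<longleftrightarrow> x \<in> commutant A"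
proof -
  have "fcomp (matrix_map A) (diffeo x) i = matrix_map A i + fcomp (matrix_map A) (fmap_of x) i" for i
    unfolding diffeo_eq[OF assms] by (subst fcomp_matrix_map_add) simp_all
  moreover have "fcomp (diffeo x) (matrix_map A) i = matrix_map A i + fcomp (fmap_of x) (matrix_map A) i" for i
    by (simp add: fcomp_diffeo[OF assms])
  ultimately show ?thesis using assms by (auto simp: commutant_def fun_eq_iff)
qed

lemma linearizations_eq:
  "linearizations A f = {h \<in> Ghat0. fcomp (fcomp (finv h) f) h = matrix_map A}"
  by (auto simp: linearizations_def)

text \<open>The inverses of the linearizations form a right coset of the centralizer of the linear map.\<close>

lemma finv_linearizations:
  assumes f: "no_const f" and h0: "h0 \<in> linearizations A f"
  shows "finv ` linearizations A f = (\<lambda>x. fcomp (diffeo x) (finv h0)) ` commutant A"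
proof -
  let ?M = "matrix_map A"
  have h0: "h0 \<in> Ghat0" "fcomp (fcomp (finv h0) f) h0 = ?M" using h0 by (auto simp: linearizations_eq)
  have f0: "f = fcomp (fcomp h0 ?M) (finv h0)"
  proof -
    have "fcomp (fcomp h0 ?M) (finv h0) = fcomp (fcomp (fcomp h0 (finv h0)) f) (fcomp h0 (finv h0))"
      using f h0(1) unfolding h0(2)[symmetric] by (simp add: fcomp_assoc)
    then show ?thesis using f h0(1) by (simp add: fcomp_finv fcomp_mX_left)
  qed
  show ?thesis
  proof (intro equalityI subsetI)
    fix g assume "g \<in> finv ` linearizations A f"
    then obtain h where h: "g = finv h" "h \<in> Ghat0" "fcomp (fcomp (finv h) f) h = ?M"
      by (auto simp: linearizations_eq)
    define c where "c = fcomp (finv h) h0"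
    have c: "c \<in> Ghat0" using h h0 by (simp add: c_def)
    have "fcomp c ?M = fcomp (fcomp (finv h) f) h0"
      using h h0(1) by (simp add: c_def f0 fcomp_assoc finv_fcomp)
    moreover have "fcomp ?M c = fcomp (fcomp (finv h) f) h0"
    proof -
      have "fcomp ?M c = fcomp (fcomp (finv h) f) (fcomp (fcomp h (finv h)) h0)"
        unfolding h(3)[symmetric] c_def using f h(2) h0(1) by (simp add: fcomp_assoc)
      then show ?thesis using h(2) h0(1) by (simp add: fcomp_finv fcomp_mX_left)
    qed
    ultimately have "coeffs0 c \<in> commutant A"
      using diffeo_commutes_iff[of "coeffs0 c" A] c by (simp add: diffeo_coeffs0)
    moreover have "g = fcomp (diffeo (coeffs0 c)) (finv h0)"
      using c h h0 by (simp add: diffeo_coeffs0) (simp add: c_def fcomp_assoc fcomp_finv)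
    ultimately show "g \<in> (\<lambda>x. fcomp (diffeo x) (finv h0)) ` commutant A" by blast
  next
    fix g assume "g \<in> (\<lambda>x. fcomp (diffeo x) (finv h0)) ` commutant A"
    then obtain x where x: "x \<in> commutant A" "g = fcomp (diffeo x) (finv h0)" by blast
    let ?c = "diffeo x"
    have comm: "fcomp ?c ?M = fcomp ?M ?c"
      using x diffeo_commutes_iff[of x A] by (simp add: commutant_def)
    have g: "g \<in> Ghat0" using h0 by (simp add: x)
    have fg: "finv g = fcomp h0 (finv ?c)" using h0 by (simp add: x finv_fcomp_distrib)
    have "fcomp (fcomp g f) (finv g) = fcomp (fcomp ?c (fcomp (fcomp (finv h0) f) h0)) (finv ?c)"
      using f h0(1) by (simp add: fg) (simp add: x fcomp_assoc)
    also have "\<dots> = ?M"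
      unfolding h0(2) comm by (simp add: fcomp_assoc fcomp_finv)
    finally have "finv g \<in> linearizations A f" using g by (simp add: linearizations_eq)
    then show "g \<in> finv ` linearizations A f" using g by (metis finv_finv imageI)
  qed
qed

lemma finv_linearizations_linear: "finv ` linearizations A (matrix_map A) = linearizations A (matrix_map A)"
proof -
  let ?M = "matrix_map A"
  have "finv h \<in> linearizations A ?M" if "h \<in> linearizations A ?M" for h
  proof -
    have h: "h \<in> Ghat0" "fcomp (fcomp (finv h) ?M) h = ?M" using that by (auto simp: linearizations_eq)
    have "fcomp (fcomp h ?M) (finv h) = fcomp (fcomp h (fcomp (fcomp (finv h) ?M) h)) (finv h)"
      by (simp only: h(2))
    also have "\<dots> = fcomp (fcomp (fcomp h (finv h)) ?M) (fcomp h (finv h))"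
      using h(1) by (simp add: fcomp_assoc)
    also have "\<dots> = ?M" using h(1) by (simp add: fcomp_finv fcomp_mX_left)
    finally show ?thesis using h(1) by (simp add: linearizations_eq)
  qed
  note closed = this
  show ?thesis
  proof (intro equalityI image_subsetI closed subsetI)
    fix h assume h: "h \<in> linearizations A ?M"
    then have "h = finv (finv h)" by (simp add: linearizations_eq)
    then show "h \<in> finv ` linearizations A ?M" using closed[OF h] by (rule image_eqI)
  qed
qed

lemma linear_restr: "Vector_Spaces.linear cscale cscale (restr I)"
  by (rule linear_cscaleI) (auto simp: restr_def cscale_def fun_eq_iff)

lemma linear_comp:
  "Vector_Spaces.linear cscale cscale f \<Longrightarrow> Vector_Spaces.linear cscale cscale g \<Longrightarrow>
    Vector_Spaces.linear cscale cscale (\<lambda>x. g (f x))"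
  using Vector_Spaces.linear_compose[of cscale cscale f cscale g] by (simp add: o_def)

lemma linear_fcomp_left: "Vector_Spaces.linear cscale cscale (\<lambda>x. coeffs0 (fcomp (fmap_of x) g))"
proof (rule linear_cscaleI)
  fix x y :: "'a cindex \<Rightarrow> complex" and c
  have "fcomp (fmap_of (x + y)) g = (\<lambda>i. fcomp (fmap_of x) g i + fcomp (fmap_of y) g i)"
    by (simp add: fcomp_def fmap_of_add msubst_add)
  then show "coeffs0 (fcomp (fmap_of (x + y)) g) = coeffs0 (fcomp (fmap_of x) g) + coeffs0 (fcomp (fmap_of y) g)"
    by (auto simp: coeffs0_def restr_def coeffs_def fun_eq_iff)
  have "fcomp (fmap_of (cscale c x)) g = (\<lambda>i. const_series c * fcomp (fmap_of x) g i)"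
    by (simp add: fcomp_def fmap_of_cscale msubst_const_mult)
  then show "coeffs0 (fcomp (fmap_of (cscale c x)) g) = cscale c (coeffs0 (fcomp (fmap_of x) g))"
    by (auto simp: coeffs0_def restr_def coeffs_def fun_eq_iff cscale_def)
qed

lemma affine_isoI:
  assumes "Vector_Spaces.linear cscale cscale L" "\<And>x. T x = c + L x" "bij_betw T (cspace I) S"
  shows "affine_iso T I S"
proof -
  have "T = (\<lambda>x. c + L x)" using assms(2) by (rule ext)
  then show ?thesis unfolding affine_iso_def using assms(1,3) by blast
qed

context
  fixes A :: "complex ^ 'n ^ 'n::finite" and off \<psi>
  assumes coords: "commutant_basis A off \<psi>"
begin

lemma mono: "mono off" and lin: "Vector_Spaces.linear cscale cscale \<psi>"
  and bij: "bij_betw \<psi> (cspace {k. \<exists>d. k < off d}) (commutant A)"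
  and trunc: "mdeg (snd v) \<le> d \<Longrightarrow> \<psi> (restr {..<off (Suc d)} t) v = \<psi> t v"
  and supp: "t \<in> cspace {..<off (Suc d)} \<Longrightarrow> d < mdeg (snd v) \<Longrightarrow> \<psi> t v = 0"
  using coords unfolding commutant_basis_def by blast+

lemma cspace_off_subset: "cspace {..<off (Suc m)} \<subseteq> cspace {k. \<exists>d. k < off d}"
  by (auto simp: cspace_def)

lemma restr_jet0_\<psi>: "restr (jet0_index m) (\<psi> (restr {..<off (Suc m)} t)) = restr (jet0_index m) (\<psi> t)"
  using trunc by (auto simp: restr_def jet0_index_def fun_eq_iff)

lemma \<psi>_truncated:
  "bij_betw \<psi> (cspace {..<off (Suc m)}) (commutant A \<inter> cspace (jet0_index m))"
  unfolding bij_betw_def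
proof (intro conjI equalityI subsetI)
  show "inj_on \<psi> (cspace {..<off (Suc m)})"
    by (rule inj_on_subset[OF bij_betw_imp_inj_on[OF bij] cspace_off_subset])
  show "x \<in> commutant A \<inter> cspace (jet0_index m)" if x: "x \<in> \<psi> ` cspace {..<off (Suc m)}" for x
  proof -
    obtain t where t: "t \<in> cspace {..<off (Suc m)}" "x = \<psi> t" using x by blast
    then have Z: "x \<in> commutant A" using bij cspace_off_subset unfolding bij_betw_def by blast
    moreover have "x v = 0" if "v \<notin> jet0_index m" for v
    proof (cases "v \<in> higher_index")
      case True
      then have "m < mdeg (snd v)" using that by (auto simp: jet0_index_def higher_index_def)
      then show ?thesis using supp t by blast
    next
      case False
      then show ?thesis using Z by (auto simp: commutant_def cspace_def simp del: split_paired_All)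
    qed
    ultimately show ?thesis by (auto simp: cspace_def)
  qed
  show "x \<in> \<psi> ` cspace {..<off (Suc m)}" if x: "x \<in> commutant A \<inter> cspace (jet0_index m)" for x
  proof -
    obtain t where t: "t \<in> cspace {k. \<exists>d. k < off d}" "x = \<psi> t" using x bij unfolding bij_betw_def by blast
    let ?t = "restr {..<off (Suc m)} t"
    have "\<psi> ?t v = x v" for v
    proof (cases "mdeg (snd v) \<le> m")
      case False
      then have "v \<notin> jet0_index m" by (auto simp: jet0_index_def)
      then have "x v = 0" using x by (auto simp: cspace_def simp del: split_paired_All)
      then show ?thesis
        using supp[OF restr_in_cspace, of m v] False by simp
    qed (use trunc t in blast)
    then have "x = \<psi> ?t" by (metis ext)
    then show ?thesis by (metis imageI restr_in_cspace)
  qed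
qed

text \<open>A truncated map that commutes with \<open>A\<close> up to degree \<open>m\<close> commutes with it exactly, again because
  composition with \<open>A\<close> preserves degrees. So the solutions of the jet equation are the truncations of
  the formal solutions.\<close>

lemma commutant_fiber:
  "{x \<in> cspace (jet0_index m). conj_map m (matrix_map A) x = jet m (matrix_map A)} =
     commutant A \<inter> cspace (jet0_index m)"
proof -
  let ?M = "matrix_map A"
  have "conj_map m ?M x = jet m ?M \<longleftrightarrow> x \<in> commutant A" if x: "x \<in> cspace (jet0_index m)" for x
  proof -
    let ?h = "diffeo x"
    have xh: "x \<in> cspace higher_index" using x cspace_jet0_subset by blast
    have "conj_map m ?M x = jet m ?M \<longleftrightarrow> jet m (fcomp (fcomp ?h ?M) (finv ?h)) = jet m ?M"
      by (simp add: conj_map_eq_iff conj_act_jet)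
    also have "\<dots> \<longleftrightarrow> agree (Suc m) (fcomp (fcomp ?h ?M) (finv ?h)) ?M"
      using agree_if_jet_eq[of "fcomp (fcomp ?h ?M) (finv ?h)" ?M m] jet_eqI by auto
    also have "\<dots> \<longleftrightarrow> agree (Suc m) (fcomp ?h ?M) (fcomp ?M ?h)"
    proof
      assume "agree (Suc m) (fcomp (fcomp ?h ?M) (finv ?h)) ?M"
      from agree_fcomp_left[OF this, of ?h] show "agree (Suc m) (fcomp ?h ?M) (fcomp ?M ?h)"
        by (simp add: fcomp_assoc finv_fcomp)
    next
      assume "agree (Suc m) (fcomp ?h ?M) (fcomp ?M ?h)"
      from agree_fcomp_left[OF this, of "finv ?h"]
      have "agree (Suc m) (fcomp (fcomp ?h ?M) (finv ?h)) (fcomp ?M (fcomp ?h (finv ?h)))"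
        by (simp add: fcomp_assoc)
      then show "agree (Suc m) (fcomp (fcomp ?h ?M) (finv ?h)) ?M" by (simp add: fcomp_finv)
    qed
    also have "\<dots> \<longleftrightarrow> (\<forall>i a. mdeg a < Suc m \<longrightarrow>
        mcoeff (fcomp (fmap_of x) ?M i) a = mcoeff (fcomp ?M (fmap_of x) i) a)"
    proof -
      have "fcomp ?M ?h i = ?M i + fcomp ?M (fmap_of x) i" for i
        unfolding diffeo_eq[OF xh] by (subst fcomp_matrix_map_add) simp_all
      then show ?thesis by (simp add: agree_iff fcomp_diffeo[OF xh])
    qed
    also have "\<dots> \<longleftrightarrow> x \<in> commutant A"
    proof
      assume low: "\<forall>i a. mdeg a < Suc m \<longrightarrow>
        mcoeff (fcomp (fmap_of x) ?M i) a = mcoeff (fcomp ?M (fmap_of x) i) a"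
      have "mcoeff (fcomp (fmap_of x) ?M i) a = mcoeff (fcomp ?M (fmap_of x) i) a" for i a
      proof (cases "mdeg a < Suc m")
        case False
        show ?thesis
          by (rule commutator_local[of a x 0])
            (use x False zero_in_commutant[of A] in \<open>auto simp: cspace_def jet0_index_def commutant_def\<close>)
      qed (use low in blast)
      then show "x \<in> commutant A" using xh by (auto simp: commutant_def fun_eq_iff intro!: mfps_eqI)
    qed (auto simp: commutant_def)
    finally show ?thesis .
  qed
  then show ?thesis by blast
qed

lemma orbit_dim_plus:
  assumes "m \<ge> 1"
  shows "orbit_dim (matrix_map A) m + off (Suc m) = jet_size TYPE('n) m - jet_size TYPE('n) 1"
proof -
  let ?M = "matrix_map A"
  have "affine_iso \<psi> {..<off (Suc m)} (commutant A \<inter> cspace (jet0_index m))"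
    by (rule affine_isoI[OF lin _ \<psi>_truncated, of 0]) simp
  then have "affine_cell (jet0_index m) (commutant A \<inter> cspace (jet0_index m)) (off (Suc m))"
    by (rule affine_iso_imp_cell) (auto simp: finite_jet0_index)
  then have "variety_dim (commutant A \<inter> cspace (jet0_index m)) = off (Suc m)" by (rule affine_cell_dim)
  moreover have "jet m ?M \<in> jet m ` conj_orbit ?M"
    unfolding conj_orbit_eq by (intro imageI CollectI exI[of _ mX]) (simp add: fcomp_mX_left)
  ultimately show ?thesis
    using orbit_stabilizer_dim[of ?M "jet m ?M" m] card_jet0_index[OF assms, where 'n = 'n]
    by (simp add: commutant_fiber orbit_dim_def)
qed

lemma delta_eq_off: "m \<ge> 1 \<Longrightarrow> delta A m = off (Suc m)"
  using orbit_dim_plus[of m] by (simp add: delta_def)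

lemma delta_tendsto: "(\<lambda>m. enat (delta A m)) \<longlonglongrightarrow> (SUP m. enat (off (Suc m)))"
proof -
  have "incseq (\<lambda>m. enat (off (Suc m)))" using mono by (auto simp: mono_def)
  then have "(\<lambda>m. enat (off (Suc m))) \<longlonglongrightarrow> (SUP m. enat (off (Suc m)))" by (rule LIMSEQ_SUP)
  moreover have "\<forall>\<^sub>F m in sequentially. enat (off (Suc m)) = enat (delta A m)"
    using eventually_ge_at_top[of 1] by eventually_elim (simp add: delta_eq_off)
  ultimately show ?thesis by (rule Lim_transform_eventually)
qed

lemma delta_inf_eq: "delta_inf A = (SUP m. enat (off (Suc m)))"
  unfolding delta_inf_def by (rule limI[OF delta_tendsto])

lemma delta_inf_index: "{k. enat k < delta_inf A} = {k. \<exists>d. k < off d}"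
proof -
  have "(\<exists>m. k < off (Suc m)) \<longleftrightarrow> (\<exists>d. k < off d)" for k
    using mono by (meson lessI less_imp_le monoD order_less_le_trans)
  then show ?thesis by (simp add: delta_inf_eq less_SUP_iff)
qed

context
  fixes f h0 :: "'n fmap"
  assumes f: "no_const f" and h0: "h0 \<in> linearizations A f"
begin

lemma h0_Ghat0: "h0 \<in> Ghat0"
  using h0 by (simp add: linearizations_eq)

text \<open>The inverse linearization \<open>c \<circ> h\<^sub>0\<inverse>\<close> for \<open>c = id + \<psi> t\<close>, expanded into its constant and its linear
  part in \<open>t\<close>. This form is affine for all parameter sequences \<open>t\<close>, also those outside the domain of
  \<open>\<psi>\<close>.\<close>

definition univ_lin :: "(nat \<Rightarrow> complex) \<Rightarrow> 'n cindex \<Rightarrow> complex" where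
  "univ_lin t = coeffs0 (finv h0) + coeffs0 (fcomp (fmap_of (\<psi> t)) (finv h0))"

lemma univ_lin_eq:
  assumes "t \<in> cspace {k. \<exists>d. k < off d}"
  shows "univ_lin t = coeffs0 (fcomp (diffeo (\<psi> t)) (finv h0))"
proof -
  have "\<psi> t \<in> cspace higher_index"
    using assms bij unfolding bij_betw_def commutant_def by blast
  then show ?thesis
    using h0_Ghat0 by (auto simp: univ_lin_def fcomp_diffeo coeffs0_def coeffs_def restr_def fun_eq_iff)
qed

text \<open>Composition with a fixed map on the right identifies jets of order \<open>m\<close> with jets of order \<open>m\<close>; this is
  the compatibility of \<open>univ_lin\<close> with truncation.\<close>

lemma jet0_coset_eq_iff:
  "jet0 m (fcomp (diffeo x) (finv h0)) = jet0 m (fcomp (diffeo y) (finv h0)) \<longleftrightarrow>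
     restr (jet0_index m) x = restr (jet0_index m) y"
proof
  assume "jet0 m (fcomp (diffeo x) (finv h0)) = jet0 m (fcomp (diffeo y) (finv h0))"
  then have "agree (Suc m) (fcomp (diffeo x) (finv h0)) (fcomp (diffeo y) (finv h0))"
    using h0_Ghat0 by (intro agree_if_jet0_eq) auto
  from agree_fcomp_left[OF this, of h0] have "agree (Suc m) (diffeo x) (diffeo y)"
    using h0_Ghat0 by (simp add: fcomp_assoc finv_fcomp)
  then show "restr (jet0_index m) x = restr (jet0_index m) y" by (simp add: agree_diffeo_iff)
next
  assume "restr (jet0_index m) x = restr (jet0_index m) y"
  then show "jet0 m (fcomp (diffeo x) (finv h0)) = jet0 m (fcomp (diffeo y) (finv h0))"
    using h0_Ghat0 by (intro jet0_eqI agree_fcomp_left) (auto simp: agree_diffeo_iff)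
qed

lemma univ_lin_bij:
  "bij_betw univ_lin (cspace {k. \<exists>d. k < off d}) (coeffs0 ` finv ` linearizations A f)"
proof -
  let ?\<Phi> = "\<lambda>x. coeffs0 (fcomp (diffeo x) (finv h0))"
  have "inj_on ?\<Phi> (commutant A)"
  proof (rule inj_onI)
    fix x y assume xy: "x \<in> commutant A" "y \<in> commutant A" "?\<Phi> x = ?\<Phi> y"
    then have "fcomp (diffeo x) (finv h0) = fcomp (diffeo y) (finv h0)"
      using h0_Ghat0 by (metis Ghat0_fcomp diffeo_Ghat0 diffeo_coeffs0 finv_Ghat0)
    then have "fcomp (fcomp (diffeo x) (finv h0)) h0 = fcomp (fcomp (diffeo y) (finv h0)) h0" by simp
    then have "diffeo x = diffeo y" using h0_Ghat0 by (simp add: fcomp_assoc finv_fcomp)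
    then show "x = y" using xy by (metis (no_types, lifting) coeffs0_diffeo commutant_def mem_Collect_eq)
  qed
  then have "bij_betw ?\<Phi> (commutant A) (coeffs0 ` finv ` linearizations A f)"
    by (simp add: bij_betw_def finv_linearizations[OF f h0] image_image)
  from bij_betw_trans[OF bij this] show ?thesis
    by (rule bij_betw_cong[THEN iffD1, rotated]) (simp add: univ_lin_eq)
qed

definition jet_lin :: "nat \<Rightarrow> (nat \<Rightarrow> complex) \<Rightarrow> 'n cindex \<Rightarrow> complex" where
  "jet_lin m t = restr (jet0_index m) (univ_lin (restr {..<off (Suc m)} t))"

lemma jet_lin_eq:
  "jet_lin m t = jet0 m (fcomp (diffeo (\<psi> (restr {..<off (Suc m)} t))) (finv h0))"
proof -
  have "restr {..<off (Suc m)} t \<in> cspace {k. \<exists>d. k < off d}"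
    using cspace_off_subset restr_in_cspace by blast
  then show ?thesis by (simp add: jet_lin_def univ_lin_eq jet0_eq_restr)
qed

lemma restr_univ_lin:
  assumes "t \<in> cspace {k. \<exists>d. k < off d}"
  shows "restr (jet0_index m) (univ_lin t) = jet_lin m (restr {..<off (Suc m)} t)"
  unfolding jet_lin_eq restr_cspace[OF restr_in_cspace] univ_lin_eq[OF assms] jet0_eq_restr[symmetric]
  by (simp add: jet0_coset_eq_iff restr_jet0_\<psi>)

lemma jet_lin_bij:
  "bij_betw (jet_lin m) (cspace {..<off (Suc m)}) (jet0 m ` finv ` linearizations A f)"
  unfolding bij_betw_def
proof (intro conjI equalityI subsetI)
  show "inj_on (jet_lin m) (cspace {..<off (Suc m)})"
  proof (rule inj_onI)
    fix t t' assume t: "t \<in> cspace {..<off (Suc m)}" "t' \<in> cspace {..<off (Suc m)}" "jet_lin m t = jet_lin m t'"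
    then have "restr (jet0_index m) (\<psi> t) = restr (jet0_index m) (\<psi> t')"
      by (simp add: jet_lin_eq restr_cspace jet0_coset_eq_iff)
    then have "\<psi> t = \<psi> t'"
      using bij_betwE[OF \<psi>_truncated[of m]] t by (simp add: restr_cspace)
    then show "t = t'" using \<psi>_truncated[of m] t by (meson bij_betw_def inj_onD)
  qed
  have img: "jet0 m ` finv ` linearizations A f = restr (jet0_index m) ` univ_lin ` cspace {k. \<exists>d. k < off d}"
    using univ_lin_bij by (simp add: bij_betw_def jet0_eq_restr image_image)
  show "y \<in> jet0 m ` finv ` linearizations A f" if "y \<in> jet_lin m ` cspace {..<off (Suc m)}" for y
    using that cspace_off_subset unfolding img by (auto simp: jet_lin_def restr_cspace)
  show "y \<in> jet_lin m ` cspace {..<off (Suc m)}" if "y \<in> jet0 m ` finv ` linearizations A f" for y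
    using that restr_in_cspace unfolding img by (auto simp: restr_univ_lin)
qed

lemma univ_lin_affine:
  "affine_iso univ_lin {k. \<exists>d. k < off d} (coeffs0 ` finv ` linearizations A f)"
  by (rule affine_isoI[OF linear_comp[OF lin linear_fcomp_left] _ univ_lin_bij]) (simp add: univ_lin_def)

lemma jet_lin_affine:
  "affine_iso (jet_lin m) {..<off (Suc m)} (jet0 m ` finv ` linearizations A f)"
proof (rule affine_isoI[OF _ _ jet_lin_bij])
  show "Vector_Spaces.linear cscale cscale
      (\<lambda>t. restr (jet0_index m) (coeffs0 (fcomp (fmap_of (\<psi> (restr {..<off (Suc m)} t))) (finv h0))))"
    by (intro linear_comp[OF _ linear_restr] linear_comp[OF _ linear_fcomp_left] linear_comp[OF linear_restr lin])
  show "jet_lin m t = restr (jet0_index m) (coeffs0 (finv h0)) +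
      restr (jet0_index m) (coeffs0 (fcomp (fmap_of (\<psi> (restr {..<off (Suc m)} t))) (finv h0)))" for t
    by (auto simp: jet_lin_def univ_lin_def restr_def fun_eq_iff)
qed

text \<open>The inverses of the linearizations form an affine subspace; inversion is a polynomial involution of
  the group of jets and carries this subspace to the set of jets of linearizations.\<close>

lemma linearizations_cell:
  "affine_cell (jet0_index m) (jet0 m ` linearizations A f) (off (Suc m))"
proof -
  define inv_jet where "inv_jet u = jet0 m (finv (diffeo u))" for u :: "'n cindex \<Rightarrow> complex"
  have inv: "inv_jet (jet0 m g) = jet0 m (finv g)" if "g \<in> Ghat0" for g
    unfolding inv_jet_def using that by (intro jet0_eqI agree_finv agree_diffeo_jet0) auto
  have sub: "h \<in> Ghat0" if "h \<in> linearizations A f" for h using that by (simp add: linearizations_eq)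
  have cell: "affine_cell (jet0_index m) (jet0 m ` finv ` linearizations A f) (off (Suc m))"
    by (rule affine_iso_imp_cell[OF jet_lin_affine]) (auto simp: finite_jet0_index)
  have poly: "polyfn (\<lambda>u. inv_jet u v)" for v
    unfolding inv_jet_def by (intro polyfn_jet0 pfam_finv pfam_diffeo) auto
  have "inv_jet u \<in> cspace (jet0_index m)" for u by (simp add: inv_jet_def)
  then have "affine_cell (jet0_index m) (inv_jet ` jet0 m ` finv ` linearizations A f) (off (Suc m))"
    by (intro affine_cell_image[OF cell poly poly]) (auto simp: inv sub)
  moreover have "inv_jet ` jet0 m ` finv ` linearizations A f = jet0 m ` linearizations A f"
    unfolding image_image by (rule image_cong) (simp_all add: inv sub)
  ultimately show ?thesis by simp
qed

end

end


section \<open>Structure of orbits and linearizations\<close>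

lemma inv_image_linearizations:
  "(\<lambda>h. inv\<^bsub>Ghat\<^esub> h) ` linearizations A f = finv ` linearizations A f"
  by (rule image_cong) (simp_all add: linearizations_eq)

lemma conj_orbit_linearization:
  assumes "f \<in> conj_orbit (matrix_map A)"
  shows "no_const f" "\<exists>h0 \<in> linearizations A f. f = matrix_map A \<longrightarrow> h0 = mX"
proof -
  obtain h where h: "h \<in> Ghat0" "f = fcomp (fcomp (finv h) (matrix_map A)) h"
    using assms by (auto simp: conj_orbit_eq)
  then show "no_const f" by simp
  show "\<exists>h0 \<in> linearizations A f. f = matrix_map A \<longrightarrow> h0 = mX"
  proof (cases "f = matrix_map A")
    case True
    then have "mX \<in> linearizations A f" by (simp add: linearizations_eq fcomp_mX_left)
    then show ?thesis by blast
  next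
    case False
    have "fcomp (fcomp h f) (finv h) = fcomp (fcomp (fcomp h (finv h)) (matrix_map A)) (fcomp h (finv h))"
      using h(1) unfolding h(2) by (simp add: fcomp_assoc)
    then have "finv h \<in> linearizations A f"
      using h(1) by (simp add: linearizations_eq fcomp_finv fcomp_mX_left)
    with False show ?thesis by blast
  qed
qed

lemma coeffs0_mX: "coeffs0 mX = 0"
  by (auto simp: coeffs0_def coeffs_def restr_def higher_index_def fun_eq_iff)

lemma orbit_structure:
  fixes N :: "'n::finite fmap"
  assumes "N \<in> carrier Ghat" "m \<ge> 1"
  shows "affine_variety (jet_index m) (jet m ` conj_orbit N) \<and>
      (\<exists>\<phi>. poly_map_deg_le (cspace (jet0_index m :: 'n cindex set)) m \<phi> \<and>
           \<phi> ` cspace (jet0_index m) = jet m ` conj_orbit N \<and>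
           (\<forall>y \<in> jet m ` conj_orbit N.
              affine_variety (jet0_index m) {x \<in> cspace (jet0_index m). \<phi> x = y} \<and>
              nonsingular (jet0_index m) {x \<in> cspace (jet0_index m). \<phi> x = y}) \<and>
           (\<forall>y \<in> jet m ` conj_orbit N. \<forall>z \<in> jet m ` conj_orbit N.
              alg_isomorphic {x \<in> cspace (jet0_index m). \<phi> x = y}
                             {x \<in> cspace (jet0_index m). \<phi> x = z}))"
proof -
  note N = Ghat_no_const[OF assms(1)]
  have "poly_map_deg_le (cspace (jet0_index m)) m (conj_map m N)"
    using conj_map_pdeg[OF N assms(2)] unfolding poly_map_deg_le_def pdeg_def by blast
  moreover have "affine_variety (jet0_index m) {x \<in> cspace (jet0_index m). conj_map m N x = y} \<and>
      nonsingular (jet0_index m) {x \<in> cspace (jet0_index m). conj_map m N x = y}"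
    if "y \<in> jet m ` conj_orbit N" for y
    using fiber_cell[OF N that] affine_cell_affine_variety affine_cell_nonsingular by blast
  moreover have "affine_variety (jet_index m) (jet m ` conj_orbit N)"
    using orbit_cell[OF N] affine_cell_affine_variety by blast
  ultimately show ?thesis
    by (intro conjI exI[of _ "conj_map m N"] ballI conj_map_onto[OF N] fibers_isomorphic[OF N]) auto
qed

lemma orbit_dim_le:
  fixes A :: "complex ^ 'n ^ 'n::finite"
  assumes "m \<ge> 1"
  shows "orbit_dim (matrix_map A) m \<le> jet_size TYPE('n) m - jet_size TYPE('n) 1"
proof -
  obtain off \<psi> where c: "commutant_basis A off \<psi>" using commutant_basis_exists by blast
  show ?thesis using orbit_dim_plus[OF c assms] by linarith
qed

lemma delta_LIMSEQ: "(\<lambda>m. enat (delta A m)) \<longlonglongrightarrow> delta_inf A"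
proof -
  obtain off \<psi> where c: "commutant_basis A off \<psi>" using commutant_basis_exists by blast
  show ?thesis using delta_tendsto[OF c] by (simp add: delta_inf_eq[OF c])
qed

lemma linearization_structure:
  fixes A :: "complex ^ 'n ^ 'n::finite"
  assumes f: "f \<in> conj_orbit (matrix_map A)"
  shows "(\<forall>m \<ge> 1.
      affine_variety (jet0_index m) (jet0 m ` linearizations A f) \<and>
      variety_dim (jet0 m ` linearizations A f) = delta A m \<and>
      alg_isomorphic (cspace {..<delta A m}) (jet0 m ` linearizations A f) \<and>
      affine_subspace (jet0 m ` (\<lambda>h. inv\<^bsub>Ghat\<^esub> h) ` linearizations A f) (delta A m) \<and>
      (f = matrix_map A \<longrightarrow>
         cfun.subspace (jet0 m ` linearizations A f) \<and>
         cfun.dim (jet0 m ` linearizations A f) = delta A m)) \<and>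
   (\<exists>\<psi> \<psi>_inf.
      (\<forall>m \<ge> 1.
         affine_iso (\<psi> m) {..<delta A m} (jet0 m ` (\<lambda>h. inv\<^bsub>Ghat\<^esub> h) ` linearizations A f) \<and>
         (\<forall>t \<in> cspace {k. enat k < delta_inf A}.
            restr (jet0_index m) (\<psi>_inf t) = \<psi> m (restr {..<delta A m} t))) \<and>
      affine_iso \<psi>_inf {k. enat k < delta_inf A} (coeffs0 ` (\<lambda>h. inv\<^bsub>Ghat\<^esub> h) ` linearizations A f) \<and>
      (f = matrix_map A \<longrightarrow>
         (\<forall>m \<ge> 1. linear_iso (\<psi> m) {..<delta A m} (jet0 m ` linearizations A f)) \<and>
         linear_iso \<psi>_inf {k. enat k < delta_inf A} (coeffs0 ` linearizations A f)))"
proof -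
  obtain off \<psi> where c: "commutant_basis A off \<psi>" using commutant_basis_exists by blast
  note off = delta_eq_off[OF c] and index = delta_inf_index[OF c]
  note nc = conj_orbit_linearization(1)[OF f]
  obtain h0 where h0: "h0 \<in> linearizations A f" "f = matrix_map A \<longrightarrow> h0 = mX"
    using conj_orbit_linearization(2)[OF f] by blast
  let ?U = "univ_lin \<psi> h0" and ?T = "jet_lin off \<psi> h0"
  note cell = linearizations_cell[OF c nc h0(1)]
  note U = univ_lin_affine[OF c nc h0(1)] and T = jet_lin_affine[OF c nc h0(1)]
  have iso: "linear_iso ?U {k. \<exists>d. k < off d} (coeffs0 ` linearizations A f)"
    "linear_iso (?T m) {..<off (Suc m)} (jet0 m ` linearizations A f)" if "f = matrix_map A" for m
  proof -
    have h: "finv h0 = mX" "finv ` linearizations A f = linearizations A f"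
      using h0(2) that finv_linearizations_linear by auto
    have UT: "?U = (\<lambda>t. coeffs0 (fcomp (fmap_of (\<psi> t)) mX))"
      "?T m = (\<lambda>t. restr (jet0_index m) (coeffs0 (fcomp (fmap_of (\<psi> (restr {..<off (Suc m)} t))) mX)))"
      unfolding jet_lin_def[OF c nc h0(1), abs_def] univ_lin_def[OF c nc h0(1), abs_def] h(1) coeffs0_mX by auto
    have "Vector_Spaces.linear cscale cscale ?U" unfolding UT
      by (intro linear_comp[OF lin[OF c] linear_fcomp_left])
    moreover have "Vector_Spaces.linear cscale cscale (?T m)" unfolding UT
      by (intro linear_comp[OF _ linear_restr] linear_comp[OF _ linear_fcomp_left] linear_comp[OF linear_restr lin[OF c]])
    ultimately show "linear_iso ?U {k. \<exists>d. k < off d} (coeffs0 ` linearizations A f)"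
      "linear_iso (?T m) {..<off (Suc m)} (jet0 m ` linearizations A f)"
      using U T h(2) by (auto simp: affine_iso_def linear_iso_def)
  qed
  have iso': "linear_iso ?U {k. \<exists>d. k < off d} (coeffs0 ` linearizations A (matrix_map A))"
    "linear_iso (?T m) {..<off (Suc m)} (jet0 m ` linearizations A (matrix_map A))"
    if "f = matrix_map A" for m
    using iso[OF that] that by simp_all
  show ?thesis unfolding index inv_image_linearizations
    using cell[THEN affine_cell_affine_variety] cell[THEN affine_cell_dim] cell[THEN affine_cell_alg_isomorphic]
      T[THEN affine_iso_imp_affine_subspace] iso(2)[THEN linear_iso_imp_subspace]
    by (intro conjI exI[of _ ?T] exI[of _ ?U] U allI impI ballI)
      (simp_all add: off T iso' restr_univ_lin[OF c nc h0(1)])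
qed

theorem theorem1:
  shows "(\<forall>N \<in> carrier (Ghat :: ('n::finite fmap) monoid). \<forall>m \<ge> 1.
      affine_variety (jet_index m) (jet m ` conj_orbit N) \<and>
      (\<exists>\<phi>. poly_map_deg_le (cspace (jet0_index m :: 'n cindex set)) m \<phi> \<and>
           \<phi> ` cspace (jet0_index m) = jet m ` conj_orbit N \<and>
           (\<forall>y \<in> jet m ` conj_orbit N.
              affine_variety (jet0_index m) {x \<in> cspace (jet0_index m). \<phi> x = y} \<and>
              nonsingular (jet0_index m) {x \<in> cspace (jet0_index m). \<phi> x = y}) \<and>
           (\<forall>y \<in> jet m ` conj_orbit N. \<forall>z \<in> jet m ` conj_orbit N.
              alg_isomorphic {x \<in> cspace (jet0_index m). \<phi> x = y}
                             {x \<in> cspace (jet0_index m). \<phi> x = z})))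
    \<and>
    (\<forall>A :: complex ^ 'n ^ 'n. invertible A \<longrightarrow>
      (\<forall>m \<ge> 1. orbit_dim (matrix_map A) m \<le> jet_size TYPE('n) m - jet_size TYPE('n) 1) \<and>
      (\<lambda>m. enat (delta A m)) \<longlonglongrightarrow> delta_inf A \<and>
      (\<forall>f \<in> conj_orbit (matrix_map A).
        (\<forall>m \<ge> 1.
           affine_variety (jet0_index m) (jet0 m ` linearizations A f) \<and>
           variety_dim (jet0 m ` linearizations A f) = delta A m \<and>
           alg_isomorphic (cspace {..<delta A m}) (jet0 m ` linearizations A f) \<and>
           affine_subspace (jet0 m ` (\<lambda>h. inv\<^bsub>Ghat\<^esub> h) ` linearizations A f) (delta A m) \<and>
           (f = matrix_map A \<longrightarrow>
              cfun.subspace (jet0 m ` linearizations A f) \<and>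
              cfun.dim (jet0 m ` linearizations A f) = delta A m)) \<and>
        (\<exists>\<psi> \<psi>_inf.
           (\<forall>m \<ge> 1.
              affine_iso (\<psi> m) {..<delta A m}
                (jet0 m ` (\<lambda>h. inv\<^bsub>Ghat\<^esub> h) ` linearizations A f) \<and>
              (\<forall>t \<in> cspace {k. enat k < delta_inf A}.
                 restr (jet0_index m) (\<psi>_inf t) = \<psi> m (restr {..<delta A m} t))) \<and>
           affine_iso \<psi>_inf {k. enat k < delta_inf A}
             (coeffs0 ` (\<lambda>h. inv\<^bsub>Ghat\<^esub> h) ` linearizations A f) \<and>
           (f = matrix_map A \<longrightarrow>
              (\<forall>m \<ge> 1. linear_iso (\<psi> m) {..<delta A m} (jet0 m ` linearizations A f)) \<and>
              linear_iso \<psi>_inf {k. enat k < delta_inf A}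
                (coeffs0 ` linearizations A f)))))"
  by (rule conjI; intro ballI allI impI)
    (rule orbit_structure, assumption+,
      rule conjI[OF allI[OF impI[OF orbit_dim_le]] conjI[OF delta_LIMSEQ ballI[OF linearization_structure]]])

end
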